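(* Consider the symmetric V-cycle multigrid algorithm on the locally refined spaces $V_0\subset\dots\subset V_J$, with smoothing error operators $S_k=\widehat E^s_{p_k}$ given by the symmetric successive subspace correction (SSC) algorithm with the non-nested overlapping-subdomain subspaces $V_k^i$ and exact subsolvers $R_k^i$ (all defined in the context). Let $C_5=\widehat C_0(3+2g_0)^2$. If $m_k$ is chosen so that $\psi_k=\dfrac{m_k}{\widehat C_0(1+k^2)(3+2g_0)^2}$, $k=1,\dots,J$, is non-increasing in $k$, then the multigrid algorithm converges with $$\gamma_k=\frac{C_5(1+k^2)}{C_5(1+k^2)+2m_k},\qquad k=1,\dots,J,$$ that is, $a(E_Jv,v)\le\gamma_J\,a(v,v)$ for all $v\in V_J$. Moreover, the error bound is optimal (in the sense that it does not depend on the number of multigrid spaces $J$) if and only if $m_k=q(1+k^2)$ for some $q\in\mathbb N$, and in that case it is given by $$\gamma_1=\gamma_2=\dots=\gamma_J=\frac{C_5}{2q+C_5}.$$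
   Context: Model problem. $\Omega\subset\mathbb R^n$ is polygonal, $\Theta=(\theta_{ij})$ is a symmetric matrix, $(\cdot,\cdot)$ is the $L^2(\Omega)$ inner product, and $a(u,v)=\sum_{i,j=1}^n\int_\Omega\theta_{ij}\,\partial_{x_j}u\,\partial_{x_i}v\,dx$. There are constants $C_{\Theta,1},C_{\Theta,2}>0$ depending on $\Theta$ with $C_{\Theta,1}\|u\|_{H^1}^2\le a(u,u)\le C_{\Theta,2}\|u\|_{H^1}^2$ for $u\in V_k\subset H_0^1(\Omega)$. Triangulations. $\Omega_J\subset\Omega_{J-1}\subset\dots\subset\Omega_0\equiv\Omega$ are closed subdomains of $\Omega$. $\mathcal T_0$ is a coarse quasi-uniform triangulation of $\Omega$ of size $h_0\in(0,1]$, and $\mathcal T_k$ is obtained from $\mathcal T_{k-1}$ by midpoint refinement of only those elements of $\mathcal T_{k-1}$ that belong to $\Omega_k$. (It is understood that $\Omega_k$ is a union of elements of $\mathcal T_{k-1}$.) Thus $\mathcal T_k$ may have hanging nodes, but restricted to $\Omega_k$ it is a regular grid of size $h_k=2^{-k}h_0$. $V_k=\{v\in H_0^1(\Omega)\cap C^0(\Omega): v|_\tau\in\mathcal P_1\ \forall\tau\in\mathcal T_k\}$ ($\mathcal P_1$ = linear polynomials), $k=0,\dots,J$. Subdomains. For each $k$, $\{\Omega_k^i\}_{i=1}^{p_k}$ are non-overlapping open subdomains of $\Omega$ whose boundaries align with $\mathcal T_k$, with $\overline\Omega=\bigcup_{i=1}^{p_k}\overline{\Omega_k^i}$. The overlapping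 subdomains are $\widehat\Omega_k^i=\{x\in\Omega:\mathrm{dist}(x,\Omega_k^i)\le h_0\}$, whose boundaries are also assumed to align with $\mathcal T_k$. Subspaces and subsolvers. $V_k^0=V_0$, $V_k^i=\{v\in V_k:\mathrm{supp}(v)\subseteq\widehat\Omega_k^i\}$ for $i=1,\dots,p_k$, and $R_k^i=(A_k^i)^{-1}$. Here $A_k:V_k\to V_k$ is defined by $(A_ku,v)=a(u,v)$, $A_k^i:V_k^i\to V_k^i$ by $(A_k^iu,v)=(A_ku,v)$ for $u,v\in V_k^i$, and $Q_k^i:V_k\to V_k^i$ is the $(\cdot,\cdot)$-orthogonal projection. Smoother. $T_k^i=R_k^iQ_k^iA_k$ on $V_k$ and, for $k\ge1$, $$S_k=\widehat E^s_{p_k}=(I-T_k^{p_k})\cdots(I-T_k^1)(I-T_k^0)^2(I-T_k^1)\cdots(I-T_k^{p_k}).$$ Multigrid. $m_k\ge1$ is the integer number of pre-smoothing steps, and also of post-smoothing steps, at level $k$. $P_k:V_J\to V_k$ is the $a$-orthogonal projection. The multigrid error operators of the V-cycle (exact solve at level $0$) are $E_0=0$, $E_k=S_k^{m_k}[I-(I-E_{k-1})P_{k-1}]S_k^{m_k}$. Constants. $\widehat C_0$ is a constant independent of $k$ such that, for every $k$, every $v\in V_k$ has a decomposition $v=\sum_{i=0}^{p_k}v_i$, $v_i\in V_k^i$, with $\sum_{i=0}^{p_k}a(v_i,v_i)\le\widehat C_0(1+k^2)\,a(v,v)$ (the paper shows that such a constant exists). $g_0=\max_{i=1,\dots,p_k}\sum_{j=1}^{p_k}G_{ij}$,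 where $G_{ij}=1$ if $\widehat\Omega_k^i\cap\widehat\Omega_k^j\neq\emptyset$ and $G_{ij}=0$ otherwise. By standing assumption on the choice of subdomains this quantity is uniformly bounded, and $g_0$ denotes a bound independent of $k$. *)

theory Defs
  imports "HOL-Analysis.Analysis"
begin

definition partial :: "'n::finite \<Rightarrow> (real^'n \<Rightarrow> real) \<Rightarrow> real^'n \<Rightarrow> real" where
  "partial i f x = frechet_derivative f (at x) (axis i 1)"

primrec Ck :: "nat \<Rightarrow> (real^'n::finite \<Rightarrow> real) \<Rightarrow> bool" where
  "Ck 0 f \<longleftrightarrow> continuous_on UNIV f"
| "Ck (Suc r) f \<longleftrightarrow> (\<forall>x. f differentiable (at x)) \<and> (\<forall>i. Ck r (partial i f))"

definition test_functions :: "(real^'n::finite) set \<Rightarrow> (real^'n \<Rightarrow> real) set" where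
  "test_functions \<Omega> =
     {\<phi>. (\<forall>r. Ck r \<phi>) \<and> compact (closure {x. \<phi> x \<noteq> 0}) \<and> closure {x. \<phi> x \<noteq> 0} \<subseteq> \<Omega>}"

definition L2 :: "(real^'n::finite) set \<Rightarrow> (real^'n \<Rightarrow> real) set" where
  "L2 \<Omega> = {f. f \<in> borel_measurable (lebesgue_on \<Omega>) \<and> integrable (lebesgue_on \<Omega>) (\<lambda>x. (f x)\<^sup>2)}"

definition l2 :: "(real^'n::finite) set \<Rightarrow> (real^'n \<Rightarrow> real) \<Rightarrow> (real^'n \<Rightarrow> real) \<Rightarrow> real" where
  "l2 \<Omega> u v = (\<integral>x. u x * v x \<partial>(lebesgue_on \<Omega>))"

definition is_weak_partial ::
    "(real^'n::finite) set \<Rightarrow> 'n \<Rightarrow> (real^'n \<Rightarrow> real) \<Rightarrow> (real^'n \<Rightarrow> real) \<Rightarrow> bool" where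
  "is_weak_partial \<Omega> i u g \<longleftrightarrow>
     g \<in> L2 \<Omega> \<and> (\<forall>\<phi>\<in>test_functions \<Omega>. l2 \<Omega> u (partial i \<phi>) = - l2 \<Omega> g \<phi>)"

definition H1 :: "(real^'n::finite) set \<Rightarrow> (real^'n \<Rightarrow> real) set" where
  "H1 \<Omega> = {u \<in> L2 \<Omega>. \<forall>i. \<exists>g. is_weak_partial \<Omega> i u g}"

text \<open>A representative of the weak derivative, which is unique only up to null sets.\<close>

definition weak_partial ::
    "(real^'n::finite) set \<Rightarrow> 'n \<Rightarrow> (real^'n \<Rightarrow> real) \<Rightarrow> real^'n \<Rightarrow> real" where
  "weak_partial \<Omega> i u = (SOME g. is_weak_partial \<Omega> i u g)"

definition H1_norm :: "(real^'n::finite) set \<Rightarrow> (real^'n \<Rightarrow> real) \<Rightarrow> real" where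
  "H1_norm \<Omega> u =
     sqrt (l2 \<Omega> u u + (\<Sum>i\<in>UNIV. l2 \<Omega> (weak_partial \<Omega> i u) (weak_partial \<Omega> i u)))"

definition H10 :: "(real^'n::finite) set \<Rightarrow> (real^'n \<Rightarrow> real) set" where
  "H10 \<Omega> = {u \<in> H1 \<Omega>. \<exists>\<phi>. (\<forall>n::nat. \<phi> n \<in> test_functions \<Omega>) \<and>
                        (\<lambda>n. H1_norm \<Omega> (\<lambda>x. u x - \<phi> n x)) \<longlonglongrightarrow> 0}"

definition bilin ::
    "(real^'n::finite) set \<Rightarrow> real^'n^'n \<Rightarrow> (real^'n \<Rightarrow> real) \<Rightarrow> (real^'n \<Rightarrow> real) \<Rightarrow> real" where
  "bilin \<Omega> \<Theta> u v = (\<Sum>i\<in>UNIV. \<Sum>j\<in>UNIV.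
     \<integral>x. \<Theta> $ i $ j * weak_partial \<Omega> j u x * weak_partial \<Omega> i v x \<partial>(lebesgue_on \<Omega>))"

definition polygonal :: "(real^'n::finite) set \<Rightarrow> bool" where
  "polygonal \<Omega> \<longleftrightarrow> open \<Omega> \<and> bounded \<Omega> \<and> \<Omega> \<noteq> {} \<and>
     (\<exists>F. finite F \<and> (\<forall>P\<in>F. polytope P) \<and> frontier \<Omega> = \<Union>F)"

definition quasi_uniform_triangulation ::
    "(real^'n::finite) set \<Rightarrow> real \<Rightarrow> (real^'n) set set \<Rightarrow> bool" where
  "quasi_uniform_triangulation \<Omega> h \<T> \<longleftrightarrow>
     triangulation \<T> \<and> (\<forall>\<tau>\<in>\<T>. int CARD('n) simplex \<tau>) \<and> \<Union>\<T> = closure \<Omega> \<and>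
     h = Max (diameter ` \<T>) \<and>
     (\<exists>\<kappa>>0. \<forall>\<tau>\<in>\<T>. \<exists>z. cball z (\<kappa> * h) \<subseteq> \<tau>)"

text \<open>
  Midpoint (red) refinement of an \<open>n\<close>-simplex with vertices \<open>x 0, \<dots>, x n\<close> into \<open>2 ^ n\<close> simplices
  whose vertices are midpoints of \<open>x p\<close> and \<open>x q\<close> with \<open>p \<le> q\<close>.  A child is a path of \<open>n\<close> steps
  from \<open>(p, q) = (0, a)\<close> to \<open>(a, n)\<close>, where \<open>a = card A\<close>: step \<open>j\<close> increments \<open>p\<close> if \<open>j \<in> A\<close>, and
  \<open>q\<close> otherwise.  For a triangle these are the four congruent triangles cut out by the edge
  midpoints; from dimension three on, the numbering of the vertices selects the interior diagonals.
\<close>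

definition midpoint_child :: "(nat \<Rightarrow> real^'n::finite) \<Rightarrow> nat set \<Rightarrow> (real^'n) set" where
  "midpoint_child x A = convex hull
     ((\<lambda>j. midpoint (x (card (A \<inter> {..<j}))) (x (card A + card ({..<j} - A)))) ` {..CARD('n)})"

definition midpoint_refinement :: "(real^'n::finite) set \<Rightarrow> (real^'n) set set \<Rightarrow> bool" where
  "midpoint_refinement \<tau> R \<longleftrightarrow>
     (\<exists>x. inj_on x {..CARD('n)} \<and> \<not> affine_dependent (x ` {..CARD('n)}) \<and>
          \<tau> = convex hull (x ` {..CARD('n)}) \<and>
          R = midpoint_child x ` Pow {..<CARD('n)})"

definition local_refinement ::
    "(real^'n::finite) set \<Rightarrow> (real^'n) set set \<Rightarrow> (real^'n) set set \<Rightarrow> bool" where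
  "local_refinement D \<T> \<T>' \<longleftrightarrow>
     (\<exists>R. (\<forall>\<tau>\<in>\<T>. \<tau> \<subseteq> D \<longrightarrow> midpoint_refinement \<tau> (R \<tau>)) \<and>
          \<T>' = {\<tau>\<in>\<T>. \<not> \<tau> \<subseteq> D} \<union> (\<Union>\<tau>\<in>{\<tau>\<in>\<T>. \<tau> \<subseteq> D}. R \<tau>))"

definition refinement_hierarchy ::
    "(real^'n::finite) set \<Rightarrow> nat \<Rightarrow> real \<Rightarrow> (nat \<Rightarrow> (real^'n) set) \<Rightarrow> (nat \<Rightarrow> (real^'n) set set) \<Rightarrow> bool"
  where
  "refinement_hierarchy \<Omega> J h\<^sub>0 \<Omega>s \<T> \<longleftrightarrow>
     polygonal \<Omega> \<and>
     0 < h\<^sub>0 \<and> h\<^sub>0 \<le> 1 \<and> quasi_uniform_triangulation \<Omega> h\<^sub>0 (\<T> 0) \<and>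
     \<Omega>s 0 = closure \<Omega> \<and>
     (\<forall>k\<in>{1..J}. closed (\<Omega>s k) \<and> \<Omega>s k \<subseteq> \<Omega>s (k - 1) \<and>
        (\<exists>M\<subseteq>\<T> (k - 1). \<Omega>s k = \<Union>M) \<and>
        local_refinement (\<Omega>s k) (\<T> (k - 1)) (\<T> k))"

text \<open>Functions on \<open>\<Omega>\<close> are represented by their extension by zero, so that elements of the finite
  element space are equal as soon as they agree on \<open>\<Omega>\<close>.\<close>

definition fe_space :: "(real^'n::finite) set \<Rightarrow> (real^'n) set set \<Rightarrow> (real^'n \<Rightarrow> real) set" where
  "fe_space \<Omega> \<T> = {v \<in> H10 \<Omega>. continuous_on \<Omega> v \<and> (\<forall>x. x \<notin> \<Omega> \<longrightarrow> v x = 0) \<and>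
     (\<forall>\<tau>\<in>\<T>. \<exists>b c. \<forall>x\<in>\<tau> \<inter> \<Omega>. v x = b \<bullet> x + c)}"

definition aligned :: "(real^'n::finite) set set \<Rightarrow> (real^'n) set \<Rightarrow> bool" where
  "aligned \<T> D \<longleftrightarrow> frontier D \<subseteq> (\<Union>\<tau>\<in>\<T>. frontier \<tau>)"

definition overlap_domain :: "(real^'n::finite) set \<Rightarrow> real \<Rightarrow> (real^'n) set \<Rightarrow> (real^'n) set" where
  "overlap_domain \<Omega> h D = {x\<in>\<Omega>. infdist x D \<le> h}"

text \<open>Nonemptiness matters, because \<open>infdist x {} = 0\<close>.\<close>

definition subdomain_partition ::
    "(real^'n::finite) set \<Rightarrow> real \<Rightarrow> (real^'n) set set \<Rightarrow> nat \<Rightarrow> (nat \<Rightarrow> (real^'n) set) \<Rightarrow> bool" where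
  "subdomain_partition \<Omega> h \<T> p D \<longleftrightarrow>
     (\<forall>i\<in>{1..p}. open (D i) \<and> D i \<noteq> {} \<and> D i \<subseteq> \<Omega> \<and>
        aligned \<T> (D i) \<and> aligned \<T> (overlap_domain \<Omega> h (D i))) \<and>
     (\<forall>i\<in>{1..p}. \<forall>j\<in>{1..p}. i \<noteq> j \<longrightarrow> D i \<inter> D j = {}) \<and>
     closure \<Omega> = (\<Union>i\<in>{1..p}. closure (D i))"

definition overlap_number ::
    "(real^'n::finite) set \<Rightarrow> real \<Rightarrow> nat \<Rightarrow> (nat \<Rightarrow> (real^'n) set) \<Rightarrow> nat" where
  "overlap_number \<Omega> h p D = Max ((\<lambda>i. \<Sum>j=1..p.
     if overlap_domain \<Omega> h (D i) \<inter> overlap_domain \<Omega> h (D j) \<noteq> {} then 1 else 0) ` {1..p})"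

text \<open>The support of a function on the open set \<open>\<Omega>\<close>: the closure is taken relative to \<open>\<Omega>\<close>.\<close>

definition supp :: "(real^'n::finite) set \<Rightarrow> (real^'n \<Rightarrow> real) \<Rightarrow> (real^'n) set" where
  "supp \<Omega> v = \<Omega> \<inter> closure {x\<in>\<Omega>. v x \<noteq> 0}"

definition subspace_family ::
    "(real^'n::finite) set \<Rightarrow> real \<Rightarrow> (nat \<Rightarrow> (real^'n) set set) \<Rightarrow> (nat \<Rightarrow> nat \<Rightarrow> (real^'n) set) \<Rightarrow>
     nat \<Rightarrow> nat \<Rightarrow> (real^'n \<Rightarrow> real) set" where
  "subspace_family \<Omega> h \<T> D k i =
     (if i = 0 then fe_space \<Omega> (\<T> 0)
      else {v \<in> fe_space \<Omega> (\<T> k). supp \<Omega> v \<subseteq> overlap_domain \<Omega> h (D k i)})"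

type_synonym 'n fun_op = "(real^'n \<Rightarrow> real) \<Rightarrow> (real^'n \<Rightarrow> real)"

definition stiffness ::
    "(real^'n::finite) set \<Rightarrow> real^'n^'n \<Rightarrow> (real^'n \<Rightarrow> real) set \<Rightarrow> 'n fun_op" where
  "stiffness \<Omega> \<Theta> V u = (THE w. w \<in> V \<and> (\<forall>v\<in>V. l2 \<Omega> w v = bilin \<Omega> \<Theta> u v))"

definition l2_projection :: "(real^'n::finite) set \<Rightarrow> (real^'n \<Rightarrow> real) set \<Rightarrow> 'n fun_op" where
  "l2_projection \<Omega> W f = (THE w. w \<in> W \<and> (\<forall>v\<in>W. l2 \<Omega> w v = l2 \<Omega> f v))"

definition sub_stiffness ::
    "(real^'n::finite) set \<Rightarrow> real^'n^'n \<Rightarrow> (real^'n \<Rightarrow> real) set \<Rightarrow> (real^'n \<Rightarrow> real) set \<Rightarrow> 'n fun_op"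
  where
  "sub_stiffness \<Omega> \<Theta> V W u = (THE w. w \<in> W \<and> (\<forall>v\<in>W. l2 \<Omega> w v = l2 \<Omega> (stiffness \<Omega> \<Theta> V u) v))"

definition subspace_solve ::
    "(real^'n::finite) set \<Rightarrow> real^'n^'n \<Rightarrow> (real^'n \<Rightarrow> real) set \<Rightarrow> (real^'n \<Rightarrow> real) set \<Rightarrow> 'n fun_op"
  where
  "subspace_solve \<Omega> \<Theta> V W u =
     inv_into W (sub_stiffness \<Omega> \<Theta> V W) (l2_projection \<Omega> W (stiffness \<Omega> \<Theta> V u))"

definition id_minus :: "'n::finite fun_op \<Rightarrow> 'n fun_op" where
  "id_minus T u = (\<lambda>x. u x - T u x)"

primrec symmetric_ssc :: "(nat \<Rightarrow> 'n::finite fun_op) \<Rightarrow> nat \<Rightarrow> 'n fun_op" where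
  "symmetric_ssc T 0 = id_minus (T 0) \<circ> id_minus (T 0)"
| "symmetric_ssc T (Suc i) = id_minus (T (Suc i)) \<circ> symmetric_ssc T i \<circ> id_minus (T (Suc i))"

definition ssc_smoother ::
    "(real^'n::finite) set \<Rightarrow> real^'n^'n \<Rightarrow> real \<Rightarrow> (nat \<Rightarrow> (real^'n) set set) \<Rightarrow>
     (nat \<Rightarrow> nat) \<Rightarrow> (nat \<Rightarrow> nat \<Rightarrow> (real^'n) set) \<Rightarrow> nat \<Rightarrow> 'n fun_op" where
  "ssc_smoother \<Omega> \<Theta> h \<T> p D k =
     symmetric_ssc (\<lambda>i. subspace_solve \<Omega> \<Theta> (fe_space \<Omega> (\<T> k)) (subspace_family \<Omega> h \<T> D k i)) (p k)"

definition a_projection ::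
    "(real^'n::finite) set \<Rightarrow> real^'n^'n \<Rightarrow> (real^'n \<Rightarrow> real) set \<Rightarrow> 'n fun_op" where
  "a_projection \<Omega> \<Theta> W u = (THE w. w \<in> W \<and> (\<forall>v\<in>W. bilin \<Omega> \<Theta> w v = bilin \<Omega> \<Theta> u v))"

text \<open>Exact solve at level \<open>0\<close>.  The projection \<open>P k\<close> onto level \<open>k\<close> is applied to functions of
  level \<open>k + 1\<close>.\<close>

primrec mg_error ::
    "(nat \<Rightarrow> 'n::finite fun_op) \<Rightarrow> (nat \<Rightarrow> 'n fun_op) \<Rightarrow> (nat \<Rightarrow> nat) \<Rightarrow> nat \<Rightarrow> 'n fun_op" where
  "mg_error S P m 0 = (\<lambda>v x. 0)"
| "mg_error S P m (Suc k) =
     (S (Suc k) ^^ m (Suc k)) \<circ> id_minus (id_minus (mg_error S P m k) \<circ> P k) \<circ> (S (Suc k) ^^ m (Suc k))"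

definition rate :: "real \<Rightarrow> (nat \<Rightarrow> nat) \<Rightarrow> nat \<Rightarrow> real" where
  "rate C m k = C * (1 + real k ^ 2) / (C * (1 + real k ^ 2) + 2 * real (m k))"

end

theory Submission
  imports Defs
begin

text \<open>
  Each \<open>V k\<close> is finite-dimensional, because the elements of every mesh are finite in number and cover
  \<open>\<Omega>\<close>; hence the operators of the algorithm exist, and every subspace solve is the \<open>a\<close>-orthogonal
  projection onto its subspace.  The smoother is \<open>S = K\<^sup>* K\<close> with \<open>K = (I - T\<^sub>0) \<cdots> (I - T\<^sub>p)\<close>.  The energy
  lost by \<open>K\<close> is the sum of the energies of the successive corrections, so the stable decomposition
  and the bounded overlap give \<open>\<parallel>v\<parallel>\<^sup>2 \<le> C (\<parallel>v\<parallel>\<^sup>2 - \<parallel>K v\<parallel>\<^sup>2)\<close> with \<open>C = C\<^sub>5 (1 + k\<^sup>2)\<close>.  Since the coarse space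
  is one of the subspaces, the smoother alone is a contraction with factor \<open>1 - 1/C \<le> C/(C + 1)\<close>.  The
  coarse grid correction does not increase the energy, whence
  \<open>a(E v, v) \<le> \<parallel>S\<^sup>m v\<parallel>\<^sup>2 \<le> (C/(C + 1))\<^sup>2\<^sup>m \<parallel>v\<parallel>\<^sup>2\<close>, and Bernoulli's inequality yields \<open>C/(C + 2m)\<close>.
\<close>

text \<open>The operators of the algorithm are definite descriptions and an inverse on an image, so
  nothing is known about them before Riesz representation is available on sets of functions. This is
  what finite dimension is for, and why refinement must be shown to leave no gap in any dimension:
  on a gap, a function of \<open>V k\<close> would not be determined by finitely many coefficients.
  Moreover \<open>weak_partial\<close> is a choice among functions that agree almost everywhere.
  Even the additivity of \<open>bilin\<close>, and the orthogonality of functions with disjoint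
  supports that the bounded overlap exploits, therefore rest on the fundamental lemma, for which
  smooth approximations of boxes are constructed. The factor C/(C + 1) is preferred to 1 - 1/C
  because it is nonnegative for every C > 0 and its reciprocal 1 + 1/C has the form that Bernoulli's
  inequality wants; the exponent 2m is that of a squared norm after m smoothing steps.\<close>

subsection \<open>Midpoint refinement covers the simplex\<close>

text \<open>The north-west corner rule, run from the end: the last point of the lattice path carries the
  smaller of the two last masses, and the path goes on along the axis where mass is left.\<close>

lemma monotone_coupling:
  fixes f g :: "nat \<Rightarrow> 'a::real_vector" and \<alpha> \<beta> :: "nat \<Rightarrow> real"
  assumes "\<And>i. i \<le> a \<Longrightarrow> 0 \<le> \<alpha> i" "\<And>i. i \<le> b \<Longrightarrow> 0 \<le> \<beta> i"
    and "(\<Sum>i\<le>a. \<alpha> i) = (\<Sum>i\<le>b. \<beta> i)"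
  shows "\<exists>A c. A \<subseteq> {..<a + b} \<and> card A = a \<and> (\<forall>j\<le>a + b. 0 \<le> (c j :: real)) \<and>
    (\<Sum>j\<le>a + b. c j) = (\<Sum>i\<le>a. \<alpha> i) \<and>
    (\<Sum>i\<le>a. \<alpha> i *\<^sub>R f i) + (\<Sum>i\<le>b. \<beta> i *\<^sub>R g i) =
      (\<Sum>j\<le>a + b. c j *\<^sub>R (f (card (A \<inter> {..<j})) + g (card ({..<j} - A))))"
  using assms
proof (induction "a + b" arbitrary: a b \<alpha> \<beta>)
  case 0
  then show ?case
    by (intro exI[of _ "{}"] exI[of _ \<alpha>]) (auto simp: scaleR_right_distrib)
next
  case (Suc n)
  \<comment> \<open>Each recursive call drops the exhausted last mass of one side and lowers the
    last mass of the other; these facts describe the lowering.\<close>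
  have suma: "(\<Sum>i\<le>a. (\<alpha>(a := x)) i *\<^sub>R f i) = (\<Sum>i\<le>a. \<alpha> i *\<^sub>R f i) + (x - \<alpha> a) *\<^sub>R f a" for x
  proof (cases a)
    case (Suc k)
    have "(\<Sum>i\<le>k. (\<alpha>(a := x)) i *\<^sub>R f i) = (\<Sum>i\<le>k. \<alpha> i *\<^sub>R f i)"
      by (rule sum.cong) (auto simp: Suc)
    then show ?thesis
      by (simp add: Suc algebra_simps)
  qed (simp add: algebra_simps)
  have sumb: "(\<Sum>i\<le>b. (\<beta>(b := x)) i *\<^sub>R g i) = (\<Sum>i\<le>b. \<beta> i *\<^sub>R g i) + (x - \<beta> b) *\<^sub>R g b" for x
  proof (cases b)
    case (Suc k)
    have "(\<Sum>i\<le>k. (\<beta>(b := x)) i *\<^sub>R g i) = (\<Sum>i\<le>k. \<beta> i *\<^sub>R g i)"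
      by (rule sum.cong) (auto simp: Suc)
    then show ?thesis
      by (simp add: Suc algebra_simps)
  qed (simp add: algebra_simps)
  have sa: "(\<Sum>i\<le>a. (\<alpha>(a := x)) i) = (\<Sum>i\<le>a. \<alpha> i) + (x - \<alpha> a)" for x
    by (cases a) (auto intro!: sum.cong)
  have sb: "(\<Sum>i\<le>b. (\<beta>(b := x)) i) = (\<Sum>i\<le>b. \<beta> i) + (x - \<beta> b)" for x
    by (cases b) (auto intro!: sum.cong)
  \<comment> \<open>Both branches end by appending the point \<open>(a, b)\<close> with mass
    \<open>x\<close>. The number \<open>n\<close> of the appended step enters the set
    \<open>A'\<close> exactly if that step increments the first index; below \<open>n\<close> the
    sets \<open>A\<close> and \<open>A'\<close> agree, so the earlier points are unchanged.\<close>
  have last_step: "\<exists>A c. A \<subseteq> {..<a + b} \<and> card A = a \<and> (\<forall>j\<le>a + b. 0 \<le> (c j :: real)) \<and>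
      (\<Sum>j\<le>a + b. c j) = (\<Sum>i\<le>a. \<alpha> i) \<and>
      (\<Sum>i\<le>a. \<alpha> i *\<^sub>R f i) + (\<Sum>i\<le>b. \<beta> i *\<^sub>R g i) =
        (\<Sum>j\<le>a + b. c j *\<^sub>R (f (card (A \<inter> {..<j})) + g (card ({..<j} - A))))"
    if A: "A \<subseteq> {..<n}" and c: "\<forall>j\<le>n. 0 \<le> (c j :: real)" and x: "0 \<le> x"
      and A': "A' = A \<or> A' = insert n A" and cardA': "card A' = a" 
      and c_sum: "(\<Sum>j\<le>n. c j) = (\<Sum>i\<le>a. \<alpha> i) - x"
      and s: "(\<Sum>i\<le>a. \<alpha> i *\<^sub>R f i) + (\<Sum>i\<le>b. \<beta> i *\<^sub>R g i) - x *\<^sub>R (f a + g b) =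
        (\<Sum>j\<le>n. c j *\<^sub>R (f (card (A \<inter> {..<j})) + g (card ({..<j} - A))))"
    for A A' c x
  proof (intro exI conjI)
    have sub: "A' \<subseteq> {..<Suc n}"
      using A A' by auto
    then show "A' \<subseteq> {..<a + b}"
      using Suc.hyps by simp
    show "card A' = a" by fact
    show "\<forall>j\<le>a + b. 0 \<le> (c(Suc n := x)) j"
      using c x Suc.hyps by (auto simp flip: Suc.hyps(2))
    have "(\<Sum>j\<le>n. (c(Suc n := x)) j) = (\<Sum>j\<le>n. c j)"
      by (rule sum.cong) auto
    then show "(\<Sum>j\<le>a + b. (c(Suc n := x)) j) = (\<Sum>i\<le>a. \<alpha> i)"
      using c_sum by (simp flip: Suc.hyps(2))
    have "A' \<inter> {..<j} = A \<inter> {..<j}" "{..<j} - A' = {..<j} - A" if "j \<le> n" for j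
      using A' A that by auto
    then have 1: "(\<Sum>j\<le>n. (c(Suc n := x)) j *\<^sub>R (f (card (A' \<inter> {..<j})) + g (card ({..<j} - A')))) =
        (\<Sum>j\<le>n. c j *\<^sub>R (f (card (A \<inter> {..<j})) + g (card ({..<j} - A))))"
      by (intro sum.cong) auto
    have "A' \<inter> {..<Suc n} = A'"
      using sub by auto
    moreover have "card ({..<Suc n} - A') = b"
      using card_Diff_subset[of A' "{..<Suc n}"] sub cardA' Suc.hyps(2) finite_subset[OF sub] by simp
    ultimately show "(\<Sum>i\<le>a. \<alpha> i *\<^sub>R f i) + (\<Sum>i\<le>b. \<beta> i *\<^sub>R g i) =
        (\<Sum>j\<le>a + b. (c(Suc n := x)) j *\<^sub>R (f (card (A' \<inter> {..<j})) + g (card ({..<j} - A'))))"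
      using 1 s cardA' by (simp add: algebra_simps flip: Suc.hyps(2))
  qed
  have nA: "card (insert n A) = Suc (card A)" "finite A" if "A \<subseteq> {..<n}" for A
    using that finite_subset[OF that] by (auto simp: card_insert_if)
  \<comment> \<open>The axis with the smaller last mass must have a further point. If it has none,
    its total is that single mass, and equality of the totals makes the other last mass no
    larger.\<close>
  consider k where "a = Suc k" "\<alpha> a \<le> \<beta> b" | k where "b = Suc k" "\<beta> b \<le> \<alpha> a"
  proof (cases "\<alpha> a \<le> \<beta> b")
    case True
    show ?thesis
    proof (cases a)
      case 0
      then obtain k where k: "b = Suc k"
        using Suc.hyps by (cases b) auto
      have "0 \<le> (\<Sum>i\<le>k. \<beta> i)"
        by (rule sum_nonneg) (use Suc.prems k in auto)
      then have "\<beta> b \<le> \<alpha> a"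
        using Suc.prems(3) 0 k by simp
      then show ?thesis
        using k that by blast
    qed (use that True in blast)
  next
    case False
    show ?thesis
    proof (cases b)
      case 0
      then obtain k where k: "a = Suc k"
        using Suc.hyps by (cases a) auto
      have "0 \<le> (\<Sum>i\<le>k. \<alpha> i)"
        by (rule sum_nonneg) (use Suc.prems k in auto)
      then have "\<alpha> a \<le> \<beta> b"
        using Suc.prems(3) 0 k by simp
      then show ?thesis
        using False by simp
    qed (use that False in auto)
  qed
  then show ?case
  proof cases
    case 1
    let ?\<beta> = "\<beta>(b := \<beta> b - \<alpha> a)"
    have "\<exists>A c. A \<subseteq> {..<k + b} \<and> card A = k \<and> (\<forall>j\<le>k + b. 0 \<le> (c j :: real)) \<and>
      (\<Sum>j\<le>k + b. c j) = (\<Sum>i\<le>k. \<alpha> i) \<and>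
      (\<Sum>i\<le>k. \<alpha> i *\<^sub>R f i) + (\<Sum>i\<le>b. ?\<beta> i *\<^sub>R g i) =
        (\<Sum>j\<le>k + b. c j *\<^sub>R (f (card (A \<inter> {..<j})) + g (card ({..<j} - A))))"
      using Suc.prems 1 Suc.hyps(2) sb[of "\<beta> b - \<alpha> a"] by (intro Suc.hyps(1)) auto
    then obtain A c where "A \<subseteq> {..<n}" "card A = k" "\<forall>j\<le>n. 0 \<le> (c j :: real)"
      "(\<Sum>j\<le>n. c j) = (\<Sum>i\<le>k. \<alpha> i)"
      "(\<Sum>i\<le>k. \<alpha> i *\<^sub>R f i) + (\<Sum>i\<le>b. ?\<beta> i *\<^sub>R g i) =
        (\<Sum>j\<le>n. c j *\<^sub>R (f (card (A \<inter> {..<j})) + g (card ({..<j} - A))))"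
      using 1 Suc.hyps(2) by auto
    moreover have "(\<Sum>i\<le>b. \<beta> i *\<^sub>R g i) = (\<Sum>i\<le>b. ?\<beta> i *\<^sub>R g i) + \<alpha> a *\<^sub>R g b"
      using sumb[of "\<beta> b - \<alpha> a"] by simp
    ultimately show ?thesis
      using 1 Suc.prems nA
      by (intro last_step[of A c "\<alpha> a" "insert n A"]) (simp_all add: algebra_simps del: fun_upd_apply)
  next
    case 2
    let ?\<alpha> = "\<alpha>(a := \<alpha> a - \<beta> b)"
    have "\<exists>A c. A \<subseteq> {..<a + k} \<and> card A = a \<and> (\<forall>j\<le>a + k. 0 \<le> (c j :: real)) \<and>
      (\<Sum>j\<le>a + k. c j) = (\<Sum>i\<le>a. ?\<alpha> i) \<and>
      (\<Sum>i\<le>a. ?\<alpha> i *\<^sub>R f i) + (\<Sum>i\<le>k. \<beta> i *\<^sub>R g i) =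
        (\<Sum>j\<le>a + k. c j *\<^sub>R (f (card (A \<inter> {..<j})) + g (card ({..<j} - A))))"
      using Suc.prems 2 Suc.hyps(2) sa[of "\<alpha> a - \<beta> b"] by (intro Suc.hyps(1)) auto
    then obtain A c where "A \<subseteq> {..<n}" "card A = a" "\<forall>j\<le>n. 0 \<le> (c j :: real)"
      "(\<Sum>j\<le>n. c j) = (\<Sum>i\<le>a. \<alpha> i) - \<beta> b"
      "(\<Sum>i\<le>a. ?\<alpha> i *\<^sub>R f i) + (\<Sum>i\<le>k. \<beta> i *\<^sub>R g i) =
        (\<Sum>j\<le>n. c j *\<^sub>R (f (card (A \<inter> {..<j})) + g (card ({..<j} - A))))"
      using 2 Suc.hyps(2) sa[of "\<alpha> a - \<beta> b"] by auto
    moreover have "(\<Sum>i\<le>a. \<alpha> i *\<^sub>R f i) = (\<Sum>i\<le>a. ?\<alpha> i *\<^sub>R f i) + \<beta> b *\<^sub>R f a"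
      using suma[of "\<alpha> a - \<beta> b"] by simp
    ultimately show ?thesis
      using 2 Suc.prems nA
      by (intro last_step[of A c "\<beta> b" A]) (simp_all add: algebra_simps del: fun_upd_apply)
  qed
qed

text \<open>\<open>a\<close> is the median of the mass distribution, the first index at which the
  cumulative mass reaches one half. Its own mass is divided between the two halves, with
  \<open>x\<close> going to the lower one.\<close>

lemma split_half_mass:
  fixes u :: "nat \<Rightarrow> real"
  assumes "\<And>i. i \<le> n \<Longrightarrow> 0 \<le> u i" "(\<Sum>i\<le>n. u i) = 1"
  obtains a x where "a \<le> n" "0 \<le> x" "x \<le> u a" "(\<Sum>i<a. u i) + x = 1 / 2"
proof -
  define a where "a = (LEAST a. 1 / 2 \<le> (\<Sum>i\<le>a. u i))"
  have half: "1 / 2 \<le> (\<Sum>i\<le>a. u i)" "a \<le> n"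
    unfolding a_def using assms(2) by (auto intro: LeastI[of _ n] Least_le)
  have less: "(\<Sum>i<a. u i) < 1 / 2"
  proof (cases a)
    case (Suc k)
    then have "\<not> 1 / 2 \<le> (\<Sum>i\<le>k. u i)"
      unfolding a_def by (intro not_less_Least) simp
    then show ?thesis
      by (simp add: Suc lessThan_Suc_atMost)
  qed simp
  show ?thesis
  proof (rule that)
    show "1 / 2 - (\<Sum>i<a. u i) \<le> u a"
      using half by (simp add: lessThan_Suc_atMost[symmetric])
  qed (use half less in auto)
qed

text \<open>The barycentric mass of a point is split into a lower and an upper half, which share the vertex
  \<open>x a\<close>; a monotone coupling of the halves is a path as in the definition of the children.\<close>

lemma simplex_subset_midpoint_children:
  fixes x :: "nat \<Rightarrow> real^'n::finite"
  assumes "inj_on x {..CARD('n)}"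
  shows "convex hull (x ` {..CARD('n)}) \<subseteq> (\<Union>A\<in>Pow {..<CARD('n)}. midpoint_child x A)"
proof
  let ?n = "CARD('n)"
  fix y assume "y \<in> convex hull (x ` {..?n})"
  then obtain w where w: "\<forall>v\<in>x ` {..?n}. 0 \<le> w v" "sum w (x ` {..?n}) = 1"
    "(\<Sum>v\<in>x ` {..?n}. w v *\<^sub>R v) = y"
    by (auto simp: convex_hull_finite)
  define u where "u = w \<circ> x"
  have u: "\<And>i. i \<le> ?n \<Longrightarrow> 0 \<le> u i" "(\<Sum>i\<le>?n. u i) = 1" "(\<Sum>i\<le>?n. u i *\<^sub>R x i) = y"
    using w assms by (auto simp: u_def sum.reindex)
  obtain a t where a: "a \<le> ?n" "0 \<le> t" "t \<le> u a" "(\<Sum>i<a. u i) + t = 1 / 2"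
    using split_half_mass[of ?n u] u by metis
  obtain b where b: "?n = a + b"
    using a(1) le_Suc_ex by blast
  define \<alpha> where "\<alpha> = u(a := t)"
  define \<beta> where "\<beta> = (\<lambda>i. if i = 0 then u a - t else u (a + i))"
  \<comment> \<open>Stated for arbitrary \<open>h\<close>, because it is needed for the points
    (\<open>h = x\<close>) and, with the constant \<open>1\<close>, for the masses.\<close>
  have lo: "(\<Sum>i\<le>a. \<alpha> i *\<^sub>R h i) = (\<Sum>i<a. u i *\<^sub>R h i) + t *\<^sub>R h a" for h :: "nat \<Rightarrow> 'b::real_vector"
    by (simp add: \<alpha>_def lessThan_Suc_atMost[symmetric])
  have hi: "(\<Sum>i\<le>b. \<beta> i *\<^sub>R h (a + i)) =
      (\<Sum>i\<le>?n. u i *\<^sub>R h i) - (\<Sum>i<a. u i *\<^sub>R h i) - t *\<^sub>R h a" for h :: "nat \<Rightarrow> 'b::real_vector"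
  proof -
    have "(\<Sum>i\<le>?n. u i *\<^sub>R h i) = (\<Sum>i<a + Suc b. u i *\<^sub>R h i)"
      by (simp add: b lessThan_Suc_atMost[symmetric])
    also have "(\<Sum>i<a + Suc k. u i *\<^sub>R h i) = (\<Sum>i<a. u i *\<^sub>R h i) + (\<Sum>i<Suc k. u (a + i) *\<^sub>R h (a + i))" for k
      by (induction k) (auto simp: algebra_simps)
    also have "(\<Sum>i<Suc b. u (a + i) *\<^sub>R h (a + i)) = (\<Sum>i<Suc b. \<beta> i *\<^sub>R h (a + i)) + t *\<^sub>R h a"
      by (simp add: sum.lessThan_Suc_shift \<beta>_def algebra_simps del: sum.lessThan_Suc)
    finally show ?thesis
      by (simp add: lessThan_Suc_atMost)
  qed
  have "\<exists>A c. A \<subseteq> {..<a + b} \<and> card A = a \<and> (\<forall>j\<le>a + b. 0 \<le> (c j :: real)) \<and>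
      (\<Sum>j\<le>a + b. c j) = (\<Sum>i\<le>a. \<alpha> i) \<and>
      (\<Sum>i\<le>a. \<alpha> i *\<^sub>R x i) + (\<Sum>i\<le>b. \<beta> i *\<^sub>R x (a + i)) =
        (\<Sum>j\<le>a + b. c j *\<^sub>R (x (card (A \<inter> {..<j})) + x (a + card ({..<j} - A))))"
  proof (rule monotone_coupling)
    show "0 \<le> \<alpha> i" if "i \<le> a" for i
      using that a u(1) by (auto simp: \<alpha>_def)
    show "0 \<le> \<beta> i" if "i \<le> b" for i
      using that a u(1) b by (auto simp: \<beta>_def)
    show "(\<Sum>i\<le>a. \<alpha> i) = (\<Sum>i\<le>b. \<beta> i)"
      using lo[of "\<lambda>_. 1::real"] hi[of "\<lambda>_. 1::real"] a(4) u(2) by simp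
  qed
  then obtain A c where A: "A \<subseteq> {..<?n}" "card A = a" "\<forall>j\<le>?n. 0 \<le> (c j :: real)"
      "(\<Sum>j\<le>?n. c j) = (\<Sum>i\<le>a. \<alpha> i)"
    and *: "(\<Sum>i\<le>a. \<alpha> i *\<^sub>R x i) + (\<Sum>i\<le>b. \<beta> i *\<^sub>R x (a + i)) =
        (\<Sum>j\<le>?n. c j *\<^sub>R (x (card (A \<inter> {..<j})) + x (a + card ({..<j} - A))))"
    unfolding b by blast
  let ?m = "\<lambda>j. midpoint (x (card (A \<inter> {..<j}))) (x (card A + card ({..<j} - A)))"
  have "y = (\<Sum>j\<le>?n. c j *\<^sub>R (x (card (A \<inter> {..<j})) + x (a + card ({..<j} - A))))"
    using * lo[of x] hi[of x] u(3) by simp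
  \<comment> \<open>A midpoint is half the sum of its end points, and each half of the mass totals
    1/2, so the doubled weights sum to one.\<close>
  also have "\<dots> = (\<Sum>j\<le>?n. (2 * c j) *\<^sub>R ?m j)"
    by (simp add: midpoint_def A(2))
  also have "\<dots> \<in> midpoint_child x A"
    unfolding midpoint_child_def
  proof (rule convex_sum)
    show "(\<Sum>j\<le>?n. 2 * c j) = 1"
      using lo[of "\<lambda>_. 1::real"] a(4) A(4) by (simp flip: sum_distrib_left)
    show "?m j \<in> convex hull (?m ` {..?n})" if "j \<in> {..?n}" for j
      using that by (intro hull_inc) blast
  qed (use A in auto)
  finally show "y \<in> (\<Union>A\<in>Pow {..<?n}. midpoint_child x A)"
    using A(1) by blast
qed

text \<open>Along the path both indices count subsets of \<open>{..<CARD('n)}\<close>, so they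
  always number vertices of the simplex.\<close>

lemma midpoint_child_subset:
  fixes x :: "nat \<Rightarrow> real^'n::finite"
  assumes "A \<subseteq> {..<CARD('n)}"
  shows "midpoint_child x A \<subseteq> convex hull (x ` {..CARD('n)})"
  unfolding midpoint_child_def
proof (rule hull_minimal)
  have fin: "finite A"
    using assms finite_subset by blast
  show "(\<lambda>j. midpoint (x (card (A \<inter> {..<j}))) (x (card A + card ({..<j} - A)))) ` {..CARD('n)}
      \<subseteq> convex hull (x ` {..CARD('n)})"
  proof (rule image_subsetI)
    fix j assume "j \<in> {..CARD('n)}"
    then have j: "{..<j} \<subseteq> {..<CARD('n)}" by auto
    have "card (A \<inter> {..<j}) \<le> CARD('n)"
      using card_mono[of "{..<CARD('n)}" "A \<inter> {..<j}"] assms by auto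
    moreover have "card A + card ({..<j} - A) = card (A \<union> ({..<j} - A))"
      using fin by (subst card_Un_disjoint) auto
    then have "card A + card ({..<j} - A) \<le> CARD('n)"
      using card_mono[of "{..<CARD('n)}" "A \<union> ({..<j} - A)"] assms j by auto
    ultimately show "midpoint (x (card (A \<inter> {..<j}))) (x (card A + card ({..<j} - A)))
        \<in> convex hull (x ` {..CARD('n)})"
      by (intro subsetD[OF closed_segment_subset_convex_hull midpoint_in_closed_segment] hull_inc) auto
  qed
qed simp

text \<open>What the finite element spaces need from a refinement: finiteness and covering yield
  finite dimension, and the containment of every child in a parent yields nested spaces.\<close>

lemma local_refinement_properties:
  fixes \<T> :: "(real^'n::finite) set set"
  assumes ref: "local_refinement D \<T> \<T>'" and fin: "finite \<T>"
  shows "finite \<T>'" and "\<Union>\<T> \<subseteq> \<Union>\<T>'" and "\<tau> \<in> \<T>' \<Longrightarrow> \<exists>\<sigma>\<in>\<T>. \<tau> \<subseteq> \<sigma>"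
proof -
  obtain R where R: "\<And>\<tau>. \<lbrakk>\<tau> \<in> \<T>; \<tau> \<subseteq> D\<rbrakk> \<Longrightarrow> midpoint_refinement \<tau> (R \<tau>)"
    and \<T>': "\<T>' = {\<tau>\<in>\<T>. \<not> \<tau> \<subseteq> D} \<union> (\<Union>\<tau>\<in>{\<tau>\<in>\<T>. \<tau> \<subseteq> D}. R \<tau>)"
    using ref unfolding local_refinement_def by auto
  have refine: "finite (R \<tau>)" "\<tau> \<subseteq> \<Union>(R \<tau>)" "\<And>\<sigma>. \<sigma> \<in> R \<tau> \<Longrightarrow> \<sigma> \<subseteq> \<tau>"
    if \<tau>: "\<tau> \<in> \<T>" "\<tau> \<subseteq> D" for \<tau>
  proof -
    obtain x where x: "inj_on x {..CARD('n)}" "\<tau> = convex hull (x ` {..CARD('n)})"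
      "R \<tau> = midpoint_child x ` Pow {..<CARD('n)}"
      using R[OF \<tau>] unfolding midpoint_refinement_def by blast
    show "finite (R \<tau>)"
      by (simp add: x(3))
    show "\<tau> \<subseteq> \<Union>(R \<tau>)"
      using simplex_subset_midpoint_children[OF x(1)] x(2,3) by metis
    show "\<sigma> \<subseteq> \<tau>" if "\<sigma> \<in> R \<tau>" for \<sigma>
      using that midpoint_child_subset[of _ x] x(2,3) by auto
  qed
  show "finite \<T>'"
    unfolding \<T>' using fin refine(1) by auto
  show "\<Union>\<T> \<subseteq> \<Union>\<T>'"
  proof
    fix x assume "x \<in> \<Union>\<T>"
    then obtain \<tau> where \<tau>: "\<tau> \<in> \<T>" "x \<in> \<tau>"
      by blast
    show "x \<in> \<Union>\<T>'"
    proof (cases "\<tau> \<subseteq> D")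
      case True
      then obtain \<sigma> where "\<sigma> \<in> R \<tau>" "x \<in> \<sigma>"
        using refine(2)[of \<tau>] \<tau> by auto
      then show ?thesis
        using \<tau>(1) True unfolding \<T>' by blast
    qed (use \<tau> in \<open>auto simp: \<T>'\<close>)
  qed
  show "\<exists>\<sigma>\<in>\<T>. \<tau> \<subseteq> \<sigma>" if "\<tau> \<in> \<T>'"
    using that refine(3)[of _ \<tau>] unfolding \<T>' by auto
qed

lemma refinement_hierarchy_mesh:
  assumes "refinement_hierarchy \<Omega> J h \<Omega>s \<T>" "k \<le> J"
  shows "finite (\<T> k)" and "\<Omega> \<subseteq> \<Union>(\<T> k)"
    and "\<lbrakk>j \<le> k; \<tau> \<in> \<T> k\<rbrakk> \<Longrightarrow> \<exists>\<sigma>\<in>\<T> j. \<tau> \<subseteq> \<sigma>"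
proof -
  have "finite (\<T> k) \<and> \<Omega> \<subseteq> \<Union>(\<T> k) \<and> (\<forall>j\<le>k. \<forall>\<tau>\<in>\<T> k. \<exists>\<sigma>\<in>\<T> j. \<tau> \<subseteq> \<sigma>)"
    using assms(2)
  proof (induction k)
    case 0
    then show ?case
      using assms(1) closure_subset[of \<Omega>]
      by (auto simp: refinement_hierarchy_def quasi_uniform_triangulation_def triangulation_def)
  next
    case (Suc k)
    then have "local_refinement (\<Omega>s (Suc k)) (\<T> k) (\<T> (Suc k))"
      using assms(1) unfolding refinement_hierarchy_def
      by (metis atLeastAtMost_iff diff_Suc_1 le_add1 plus_1_eq_Suc)
    note ref = local_refinement_properties[OF this]
    have IH: "finite (\<T> k)" "\<Omega> \<subseteq> \<Union>(\<T> k)"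
      "\<And>j \<tau>. \<lbrakk>j \<le> k; \<tau> \<in> \<T> k\<rbrakk> \<Longrightarrow> \<exists>\<sigma>\<in>\<T> j. \<tau> \<subseteq> \<sigma>"
      using Suc by auto
    have "\<exists>\<sigma>\<in>\<T> j. \<tau> \<subseteq> \<sigma>" if "j \<le> Suc k" "\<tau> \<in> \<T> (Suc k)" for j \<tau>
    proof (cases "j = Suc k")
      case False
      then show ?thesis
        using ref(3)[OF IH(1) that(2)] IH(3)[of j] that(1) by (meson le_SucE order_trans)
    qed (use that in blast)
    then show ?case
      using ref(1,2)[OF IH(1)] IH(2) by auto
  qed
  then show "finite (\<T> k)" "\<Omega> \<subseteq> \<Union>(\<T> k)"
    "\<lbrakk>j \<le> k; \<tau> \<in> \<T> k\<rbrakk> \<Longrightarrow> \<exists>\<sigma>\<in>\<T> j. \<tau> \<subseteq> \<sigma>"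
    by blast+
qed

subsection \<open>Finite-dimensional function spaces with an inner product\<close>

definition fun_subspace :: "('a \<Rightarrow> real) set \<Rightarrow> bool" where
  "fun_subspace W \<longleftrightarrow> (\<lambda>x. 0) \<in> W \<and> (\<forall>u\<in>W. \<forall>v\<in>W. (\<lambda>x. u x + v x) \<in> W) \<and>
     (\<forall>c. \<forall>u\<in>W. (\<lambda>x. c * u x) \<in> W)"

lemma
  assumes "fun_subspace W"
  shows fun_subspace_0: "(\<lambda>x. 0) \<in> W"
    and fun_subspace_add: "\<lbrakk>u \<in> W; v \<in> W\<rbrakk> \<Longrightarrow> (\<lambda>x. u x + v x) \<in> W"
    and fun_subspace_scale: "u \<in> W \<Longrightarrow> (\<lambda>x. c * u x) \<in> W"
  using assms by (auto simp: fun_subspace_def)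

lemma fun_subspace_diff:
  assumes "fun_subspace W" "u \<in> W" "v \<in> W"
  shows "(\<lambda>x. u x - v x) \<in> W"
  using fun_subspace_add[OF assms(1,2) fun_subspace_scale[OF assms(1,3), of "-1"]] by simp

lemma fun_subspace_sum:
  assumes "fun_subspace W" "\<And>i. i \<in> I \<Longrightarrow> u i \<in> W"
  shows "(\<lambda>x. \<Sum>i\<in>I. u i x) \<in> W"
  using assms(2)
  by (induction I rule: infinite_finite_induct) (auto intro: fun_subspace_0 fun_subspace_add assms(1))

text \<open>Linearity is relative to a set of functions because the L2 product and the energy form
  are additive only where the integrals and weak derivatives exist.\<close>

definition fun_linear :: "('a \<Rightarrow> real) set \<Rightarrow> (('a \<Rightarrow> real) \<Rightarrow> real) \<Rightarrow> bool" where
  "fun_linear W L \<longleftrightarrow> (\<forall>u\<in>W. \<forall>v\<in>W. L (\<lambda>x. u x + v x) = L u + L v) \<and>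
     (\<forall>c. \<forall>u\<in>W. L (\<lambda>x. c * u x) = c * L u)"

lemma fun_linear_add: "\<lbrakk>fun_linear W L; u \<in> W; v \<in> W\<rbrakk> \<Longrightarrow> L (\<lambda>x. u x + v x) = L u + L v"
  and fun_linear_scale: "\<lbrakk>fun_linear W L; u \<in> W\<rbrakk> \<Longrightarrow> L (\<lambda>x. c * u x) = c * L u"
  by (auto simp: fun_linear_def)

lemma fun_linear_subset: "\<lbrakk>fun_linear V L; W \<subseteq> V\<rbrakk> \<Longrightarrow> fun_linear W L"
  unfolding fun_linear_def by blast

lemma fun_linear_diff:
  assumes "fun_linear W L" "fun_subspace W" "u \<in> W" "v \<in> W"
  shows "L (\<lambda>x. u x - v x) = L u - L v"
  using fun_linear_add[OF assms(1,3) fun_subspace_scale[OF assms(2,4), of "-1"]]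
    fun_linear_scale[OF assms(1,4), of "-1"] by simp

lemma fun_linear_sum:
  assumes "fun_linear W L" "fun_subspace W" "\<And>i. i \<in> I \<Longrightarrow> u i \<in> W"
  shows "L (\<lambda>x. \<Sum>i\<in>I. u i x) = (\<Sum>i\<in>I. L (u i))"
proof -
  have 0: "L (\<lambda>x. 0) = 0"
    using fun_linear_scale[OF assms(1) fun_subspace_0[OF assms(2)], of 0] by simp
  show ?thesis
    using assms(3)
    by (induction I rule: infinite_finite_induct)
      (auto simp: 0 fun_linear_add[OF assms(1)] fun_subspace_sum[OF assms(2)])
qed

text \<open>The family may lie outside \<open>W\<close>, so every subset of \<open>W\<close>
  inherits it. This allows the finite element spaces to be spanned by discontinuous cut-off
  functions.\<close>

definition spanned_by :: "('a \<Rightarrow> real) set \<Rightarrow> 'i set \<Rightarrow> ('i \<Rightarrow> 'a \<Rightarrow> real) \<Rightarrow> bool" where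
  "spanned_by W I \<phi> \<longleftrightarrow> (\<forall>v\<in>W. \<exists>c. v = (\<lambda>x. \<Sum>i\<in>I. c i * \<phi> i x))"

text \<open>Instantiated with both the L2 product, through which the discrete operators are defined,
  and the energy form, in which the corrections are projections.\<close>

locale inner_form =
  fixes V :: "('a \<Rightarrow> real) set" and B :: "('a \<Rightarrow> real) \<Rightarrow> ('a \<Rightarrow> real) \<Rightarrow> real"
  assumes subspace: "fun_subspace V"
    and linear: "u \<in> V \<Longrightarrow> fun_linear V (B u)"
    and sym: "\<lbrakk>u \<in> V; v \<in> V\<rbrakk> \<Longrightarrow> B u v = B v u"
    and definite: "\<lbrakk>u \<in> V; u \<noteq> (\<lambda>x. 0)\<rbrakk> \<Longrightarrow> 0 < B u u"
begin

lemmas V_0 = fun_subspace_0[OF subspace]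
lemmas V_add = fun_subspace_add[OF subspace]
lemmas V_scale = fun_subspace_scale[OF subspace]
lemmas V_diff = fun_subspace_diff[OF subspace]
lemmas V_sum = fun_subspace_sum[OF subspace]

lemma add_right: "\<lbrakk>u \<in> V; v \<in> V; w \<in> V\<rbrakk> \<Longrightarrow> B u (\<lambda>x. v x + w x) = B u v + B u w"
  and scale_right: "\<lbrakk>u \<in> V; v \<in> V\<rbrakk> \<Longrightarrow> B u (\<lambda>x. c * v x) = c * B u v"
  and diff_right: "\<lbrakk>u \<in> V; v \<in> V; w \<in> V\<rbrakk> \<Longrightarrow> B u (\<lambda>x. v x - w x) = B u v - B u w"
  using fun_linear_add[OF linear] fun_linear_scale[OF linear] fun_linear_diff[OF linear subspace]
  by blast+

lemma sum_right:
  assumes "u \<in> V" "\<And>i. i \<in> I \<Longrightarrow> w i \<in> V"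
  shows "B u (\<lambda>x. \<Sum>i\<in>I. w i x) = (\<Sum>i\<in>I. B u (w i))"
  using fun_linear_sum[OF linear subspace] assms by blast

lemma add_left: "\<lbrakk>u \<in> V; v \<in> V; w \<in> V\<rbrakk> \<Longrightarrow> B (\<lambda>x. v x + w x) u = B v u + B w u"
  and scale_left: "\<lbrakk>u \<in> V; v \<in> V\<rbrakk> \<Longrightarrow> B (\<lambda>x. c * v x) u = c * B v u"
  and diff_left: "\<lbrakk>u \<in> V; v \<in> V; w \<in> V\<rbrakk> \<Longrightarrow> B (\<lambda>x. v x - w x) u = B v u - B w u"
  by (simp_all add: sym[of _ u] V_add V_scale V_diff add_right scale_right diff_right)

lemma zero_right: "u \<in> V \<Longrightarrow> B u (\<lambda>x. 0) = 0"
  using scale_right[of u "\<lambda>x. 0" 0] V_0 by simp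

lemma nonneg: "u \<in> V \<Longrightarrow> 0 \<le> B u u"
  by (cases "u = (\<lambda>x. 0)") (auto simp: zero_right V_0 dest: definite)

lemma inner_form_subspace: "\<lbrakk>W \<subseteq> V; fun_subspace W\<rbrakk> \<Longrightarrow> inner_form W B"
  using linear definite fun_linear_subset by unfold_locales (blast intro: sym | blast)+

lemma eqI:
  assumes "u \<in> V" "v \<in> V" "\<And>w. w \<in> V \<Longrightarrow> B u w = B v w"
  shows "u = v"
proof (rule ccontr)
  assume "u \<noteq> v"
  then have "(\<lambda>x. u x - v x) \<noteq> (\<lambda>x. 0)"
    by (auto simp: fun_eq_iff)
  then have "0 < B (\<lambda>x. u x - v x) (\<lambda>x. u x - v x)"
    using assms V_diff definite by blast
  then show False
    using assms V_diff by (simp add: diff_left)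
qed

lemma Cauchy_Schwarz_sqr:
  assumes u: "u \<in> V" and v: "v \<in> V"
  shows "(B u v)\<^sup>2 \<le> B u u * B v v"
proof (cases "v = (\<lambda>x. 0)")
  case False
  then have pos: "0 < B v v"
    using v definite by blast
  define t where "t = B u v / B v v"
  have tv: "(\<lambda>x. t * v x) \<in> V"
    using v V_scale by blast
  have "0 \<le> B (\<lambda>x. u x - t * v x) (\<lambda>x. u x - t * v x)"
    using u tv V_diff nonneg by blast
  also have "\<dots> = B u u - 2 * t * B u v + t\<^sup>2 * B v v"
    using u v tv V_diff
    by (simp add: diff_left diff_right scale_left scale_right sym[OF v u] power2_eq_square algebra_simps)
  also have "\<dots> = B u u - (B u v)\<^sup>2 / B v v"
    using pos by (simp add: t_def power2_eq_square field_simps)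
  finally show ?thesis
    using pos by (simp add: field_simps)
qed (simp add: zero_right u v V_0)

lemma Cauchy_Schwarz:
  assumes u: "u \<in> V" and v: "v \<in> V"
  shows "B u v \<le> sqrt (B u u) * sqrt (B v v)"
  using real_le_rsqrt[OF Cauchy_Schwarz_sqr[OF assms]] by (simp add: real_sqrt_mult)

text \<open>Gram-Schmidt: enlarging the spanning family by one function enlarges \<open>W\<close> by at most one
  vector orthogonal to the part spanned by the remaining functions.\<close>

lemma Riesz_exists:
  assumes "finite I" "fun_subspace W" "W \<subseteq> V" "spanned_by W I \<phi>" "fun_linear W L"
  shows "\<exists>w\<in>W. \<forall>v\<in>W. B w v = L v"
  using assms
proof (induction I arbitrary: W L rule: finite_induct)
  case empty
  then have "W \<subseteq> {\<lambda>x. 0}"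
    by (auto simp: spanned_by_def)
  moreover have "L (\<lambda>x. 0) = 0"
    using fun_linear_scale[OF empty(4) fun_subspace_0[OF empty(1)], of 0] by simp
  ultimately show ?case
    using fun_subspace_0[OF empty(1)] V_0 by (auto simp: zero_right intro!: bexI[of _ "\<lambda>x. 0"])
next
  case (insert i I)
  define W' where "W' = {v \<in> W. \<exists>c. v = (\<lambda>x. \<Sum>i\<in>I. c i * \<phi> i x)}"
  have W': "fun_subspace W'"
    unfolding fun_subspace_def
  proof (intro conjI ballI allI)
    show "(\<lambda>x. 0) \<in> W'"
      using fun_subspace_0[OF insert.prems(1)] by (auto simp: W'_def intro!: exI[of _ "\<lambda>_. 0"])
    show "(\<lambda>x. u x + v x) \<in> W'" if u: "u \<in> W'" and v: "v \<in> W'" for u v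
    proof -
      obtain c d where "u = (\<lambda>x. \<Sum>i\<in>I. c i * \<phi> i x)" "v = (\<lambda>x. \<Sum>i\<in>I. d i * \<phi> i x)"
        using u v by (auto simp: W'_def)
      then have "(\<lambda>x. u x + v x) = (\<lambda>x. \<Sum>i\<in>I. (c i + d i) * \<phi> i x)"
        by (simp add: sum.distrib distrib_right)
      moreover have "(\<lambda>x. u x + v x) \<in> W"
        using u v by (intro fun_subspace_add insert.prems) (auto simp: W'_def)
      ultimately show ?thesis
        unfolding W'_def by (intro CollectI conjI exI)
    qed
    show "(\<lambda>x. t * u x) \<in> W'" if u: "u \<in> W'" for t u
    proof -
      obtain c where "u = (\<lambda>x. \<Sum>i\<in>I. c i * \<phi> i x)"
        using u by (auto simp: W'_def)
      then have "(\<lambda>x. t * u x) = (\<lambda>x. \<Sum>i\<in>I. (t * c i) * \<phi> i x)"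
        by (simp add: sum_distrib_left mult.assoc)
      moreover have "(\<lambda>x. t * u x) \<in> W"
        using u by (intro fun_subspace_scale insert.prems) (auto simp: W'_def)
      ultimately show ?thesis
        unfolding W'_def by (intro CollectI conjI exI)
    qed
  qed
  have sub: "W' \<subseteq> W" "W' \<subseteq> V"
    using insert.prems(2) by (auto simp: W'_def)
  have span': "spanned_by W' I \<phi>"
    by (auto simp: W'_def spanned_by_def)
  note IH = insert.IH[OF W' sub(2) span']
  obtain w0 where w0: "w0 \<in> W'" "\<forall>v\<in>W'. B w0 v = L v"
    using IH[of L] fun_linear_subset[OF insert.prems(4) sub(1)] by blast
  show ?case
  proof (cases "W = W'")
    case True
    then show ?thesis
      using w0 by blast
  next
    case False
    then obtain e where e: "e \<in> W" "e \<notin> W'"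
      using sub by blast
    then have eV: "e \<in> V"
      using insert.prems by blast
    obtain c where c: "e = (\<lambda>x. \<Sum>j\<in>insert i I. c j * \<phi> j x)"
      using e insert.prems(3) unfolding spanned_by_def by blast
    have ci: "c i \<noteq> 0"
    proof
      assume "c i = 0"
      then have "e = (\<lambda>x. \<Sum>j\<in>I. c j * \<phi> j x)"
        using c insert.hyps by simp
      then have "e \<in> W'"
        unfolding W'_def by (intro CollectI conjI exI e(1))
      then show False
        using e(2) by blast
    qed
    \<comment> \<open>For the functional \<open>B e\<close> the induction hypothesis provides the
      orthogonal projection of \<open>e\<close> onto \<open>W'\<close>.\<close>
    obtain e' where e': "e' \<in> W'" "\<forall>v\<in>W'. B e' v = B e v"
      using IH[of "B e"] fun_linear_subset[OF linear[OF eV] sub(2)] by blast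
    define g where "g = (\<lambda>x. e x - e' x)"
    have gW: "g \<in> W"
      unfolding g_def using fun_subspace_diff[OF insert.prems(1)] e e' sub by blast
    then have gV: "g \<in> V"
      using insert.prems by blast
    have e_eq: "e = (\<lambda>x. e' x + g x)"
      by (simp add: g_def)
    have "g \<noteq> (\<lambda>x. 0)"
      using e e' e_eq by (metis add.right_neutral ext)
    then have gpos: "0 < B g g"
      using gV definite by blast
    have orth: "B g v = 0" if "v \<in> W'" for v
      using that e' eV sub unfolding g_def by (subst diff_left) auto
    \<comment> \<open>The coefficient of \<open>g\<close> is determined by
      \<open>B w g = L g\<close>; on \<open>W'\<close> the new term is invisible because
      \<open>g\<close> is orthogonal to it.\<close>
    define s where "s = (L g - B w0 g) / B g g"
    define w where "w = (\<lambda>x. w0 x + s * g x)"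
    have s: "s * B g g = L g - B w0 g"
      using gpos by (simp add: s_def)
    have w0V: "w0 \<in> V"
      using w0 sub by blast
    have "B w v = L v" if v: "v \<in> W" for v
    proof -
      obtain d where d: "v = (\<lambda>x. \<Sum>j\<in>insert i I. d j * \<phi> j x)"
        using v insert.prems(3) unfolding spanned_by_def by blast
      \<comment> \<open>In \<open>g\<close> the function \<open>\<phi> i\<close> has the coefficient
        \<open>c i\<close>, as \<open>e'\<close> is a combination of the others. This
        \<open>t\<close> therefore removes \<open>\<phi> i\<close> from
        \<open>v - t * g\<close>.\<close>
      define t where "t = d i / c i"
      define v' where "v' = (\<lambda>x. v x - t * g x)"
      obtain c' where c': "e' = (\<lambda>x. \<Sum>j\<in>I. c' j * \<phi> j x)"
        using e' by (auto simp: W'_def)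
      have "v' x = (\<Sum>j\<in>I. (d j - t * (c j - c' j)) * \<phi> j x)" for x
      proof -
        have "(\<Sum>j\<in>I. (d j - t * (c j - c' j)) * \<phi> j x) =
            (\<Sum>j\<in>I. d j * \<phi> j x) - t * ((\<Sum>j\<in>I. c j * \<phi> j x) - (\<Sum>j\<in>I. c' j * \<phi> j x))"
          by (simp add: sum_subtractf left_diff_distrib right_diff_distrib sum_distrib_left mult.assoc)
        moreover have "v' x = d i * \<phi> i x + (\<Sum>j\<in>I. d j * \<phi> j x) -
            t * (c i * \<phi> i x + (\<Sum>j\<in>I. c j * \<phi> j x) - (\<Sum>j\<in>I. c' j * \<phi> j x))"
          unfolding v'_def g_def c' unfolding c d using insert.hyps by simp
        moreover have "d i = t * c i"
          using ci by (simp add: t_def)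
        ultimately show ?thesis
          by (simp add: algebra_simps)
      qed
      then have "v' = (\<lambda>x. \<Sum>j\<in>I. (d j - t * (c j - c' j)) * \<phi> j x)"
        by (rule ext)
      moreover have "v' \<in> W"
        unfolding v'_def
        by (intro fun_subspace_diff fun_subspace_scale insert.prems v gW)
      ultimately have v': "v' \<in> W'"
        unfolding W'_def by (intro CollectI conjI exI)
      then have v'V: "v' \<in> V"
        using sub by blast
      have v_eq: "v = (\<lambda>x. v' x + t * g x)"
        by (simp add: v'_def)
      have "B w v' = L v'"
        unfolding w_def using w0 w0V v' v'V gV orth by (simp add: add_left scale_left V_scale)
      moreover have "B w g = L g"
        unfolding w_def using w0V gV s by (simp add: add_left scale_left V_scale)
      moreover have "w \<in> V"
        unfolding w_def by (intro V_add V_scale w0V gV)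
      then have "B w v = B w v' + t * B w g"
        unfolding v_eq using v'V gV by (simp add: add_right scale_right V_scale)
      moreover have "L v = L v' + t * L g"
        unfolding v_eq using v' sub gW insert.prems(1)
        by (subst fun_linear_add[OF insert.prems(4)])
          (auto simp: fun_linear_scale[OF insert.prems(4)] intro: fun_subspace_scale)
      ultimately show ?thesis
        by simp
    qed
    moreover have "w \<in> W"
      unfolding w_def using w0 sub gW by (intro fun_subspace_add fun_subspace_scale insert.prems) auto
    ultimately show ?thesis
      by blast
  qed
qed

lemma Riesz:
  assumes "finite I" "fun_subspace W" "W \<subseteq> V" "spanned_by W I \<phi>" "fun_linear W L"
  shows "\<exists>!w. w \<in> W \<and> (\<forall>v\<in>W. B w v = L v)"
proof -
  interpret W: inner_form W B
    using assms inner_form_subspace by blast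
  show ?thesis
    using Riesz_exists[OF assms] W.eqI by (metis (no_types, lifting))
qed

end

subsection \<open>Successive subspace correction and multigrid\<close>

text \<open>Cauchy-Schwarz over the incident pairs: each index is the first component of at most
  \<open>g\<close> pairs and, by the symmetry of \<open>G\<close>, the second component of at most
  \<open>g\<close>. The number of indices does not enter, which keeps the smoothing rate independent
  of the number of subdomains.\<close>

lemma sum_incidence_le:
  fixes x y :: "'i \<Rightarrow> real"
  assumes fin: "finite I" and sym: "\<And>i j. G i j \<longleftrightarrow> G j i"
    and deg: "\<And>i. i \<in> I \<Longrightarrow> real (card {j\<in>I. G i j}) \<le> g"
    and g: "0 \<le> g"
  shows "(\<Sum>i\<in>I. \<Sum>j\<in>I. if G i j then x i * y j else 0) \<le> g * (sqrt (\<Sum>i\<in>I. (x i)\<^sup>2) * sqrt (\<Sum>j\<in>I. (y j)\<^sup>2))"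
proof -
  let ?R = "SIGMA i:I. {j\<in>I. G i j}"
  have sigma: "(\<Sum>i\<in>I. \<Sum>j\<in>I. if G i j then f i j else 0) = (\<Sum>(i,j)\<in>?R. f i j)" for f :: "'i \<Rightarrow> 'i \<Rightarrow> real"
    using fin by (subst sum.Sigma[symmetric]) (auto simp: sum.inter_filter intro!: sum.cong)
  have row: "(\<Sum>(i,j)\<in>?R. (z i)\<^sup>2) \<le> g * (\<Sum>i\<in>I. (z i)\<^sup>2)" for z :: "'i \<Rightarrow> real"
    using fin deg by (subst sum.Sigma[symmetric]) (auto simp: sum_distrib_left intro!: sum_mono mult_right_mono)
  have "(\<Sum>(i,j)\<in>?R. (y j)\<^sup>2) = (\<Sum>(i,j)\<in>?R. (y i)\<^sup>2)"
    by (rule sum.reindex_bij_witness[of _ "\<lambda>(i,j). (j,i)" "\<lambda>(i,j). (j,i)"]) (auto simp: sym)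
  then have col: "(\<Sum>(i,j)\<in>?R. (y j)\<^sup>2) \<le> g * (\<Sum>i\<in>I. (y i)\<^sup>2)"
    using row[of y] by simp
  have "(\<Sum>(i,j)\<in>?R. x i * y j)\<^sup>2 \<le> (\<Sum>(i,j)\<in>?R. (x i)\<^sup>2) * (\<Sum>(i,j)\<in>?R. (y j)\<^sup>2)"
    using Cauchy_Schwarz_ineq_sum[of "\<lambda>(i,j). x i" "\<lambda>(i,j). y j" ?R] by (simp add: case_prod_beta')
  also have "\<dots> \<le> (g * (\<Sum>i\<in>I. (x i)\<^sup>2)) * (g * (\<Sum>i\<in>I. (y i)\<^sup>2))"
    using row[of x] col g by (intro mult_mono) (auto intro!: sum_nonneg mult_nonneg_nonneg)
  also have "\<dots> = (g * (sqrt (\<Sum>i\<in>I. (x i)\<^sup>2) * sqrt (\<Sum>j\<in>I. (y j)\<^sup>2)))\<^sup>2"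
    by (simp add: power_mult_distrib sum_nonneg power2_eq_square[of g])
  finally show ?thesis
    unfolding sigma by (rule power2_le_imp_le) (auto intro!: sum_nonneg mult_nonneg_nonneg g)
qed

text \<open>The square in the middle of \<open>symmetric_ssc\<close> is shared out: each half
  receives one factor \<open>id_minus (T 0)\<close>. The sweep corrects in the space with the
  largest index first.\<close>

primrec half_sweep :: "(nat \<Rightarrow> 'n::finite fun_op) \<Rightarrow> nat \<Rightarrow> 'n fun_op" where
  "half_sweep T 0 = id_minus (T 0)"
| "half_sweep T (Suc i) = half_sweep T i \<circ> id_minus (T (Suc i))"

locale subspace_correction = inner_form V B
  for V :: "(real^'n::finite \<Rightarrow> real) set" and B +
  fixes W :: "nat \<Rightarrow> (real^'n \<Rightarrow> real) set" and T :: "nat \<Rightarrow> 'n fun_op" and p :: nat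
  assumes W_subset: "i \<le> p \<Longrightarrow> W i \<subseteq> V"
    and T_in: "\<lbrakk>i \<le> p; u \<in> V\<rbrakk> \<Longrightarrow> T i u \<in> W i"
    and T_proj: "\<lbrakk>i \<le> p; u \<in> V; v \<in> W i\<rbrakk> \<Longrightarrow> B (T i u) v = B u v"
begin

lemma T_in_V: "\<lbrakk>i \<le> p; u \<in> V\<rbrakk> \<Longrightarrow> T i u \<in> V"
  using T_in W_subset by blast

lemma id_minus_in: "\<lbrakk>i \<le> p; u \<in> V\<rbrakk> \<Longrightarrow> id_minus (T i) u \<in> V"
  unfolding id_minus_def using T_in_V V_diff by blast

lemma id_minus_sym:
  assumes "i \<le> p" "u \<in> V" "v \<in> V"
  shows "B (id_minus (T i) u) v = B u (id_minus (T i) v)"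
proof -
  have "B (T i u) v = B (T i u) (T i v)"
    using assms T_proj[of i v "T i u"] T_in T_in_V by (simp add: sym)
  moreover have "B u (T i v) = B (T i u) (T i v)"
    using assms T_proj[of i u "T i v"] T_in by simp
  ultimately show ?thesis
    using assms T_in_V by (simp add: id_minus_def diff_left diff_right)
qed

lemma symmetric_ssc_in:
  assumes "i \<le> p" "u \<in> V"
  shows "symmetric_ssc T i u \<in> V"
  using assms by (induction i arbitrary: u) (auto intro: id_minus_in)

lemma half_sweep_in:
  assumes "i \<le> p" "u \<in> V"
  shows "half_sweep T i u \<in> V"
  using assms by (induction i arbitrary: u) (auto intro: id_minus_in)

text \<open>The factorisation of the smoother in weak form: the outer factors are moved to the
  second argument one by one, without an adjoint operator being formed.\<close>

lemma symmetric_ssc_half_sweep: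
  assumes "i \<le> p" "u \<in> V" "v \<in> V"
  shows "B (symmetric_ssc T i u) v = B (half_sweep T i u) (half_sweep T i v)"
  using assms
  by (induction i arbitrary: u v) (auto simp: id_minus_sym id_minus_in symmetric_ssc_in)

lemma symmetric_ssc_sym:
  assumes "u \<in> V" "v \<in> V"
  shows "B (symmetric_ssc T p u) v = B u (symmetric_ssc T p v)"
  using symmetric_ssc_half_sweep[OF order_refl assms] symmetric_ssc_half_sweep[OF order_refl assms(2,1)]
    sym[of u "symmetric_ssc T p v"] sym[of "half_sweep T p u" "half_sweep T p v"] assms
  by (simp add: symmetric_ssc_in half_sweep_in)

text \<open>\<open>d i\<close> is the correction that the sweep makes in \<open>W i\<close>,
  starting from \<open>n\<close> and going down to \<open>0\<close>. Pythagoras gives the energy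
  balance. Right after the correction in \<open>W i\<close> the remaining function is orthogonal to
  \<open>W i\<close>, so a test function from \<open>W i\<close> sees only the corrections made
  until then, those with index at least \<open>i\<close>.\<close>

lemma half_sweep_corrections:
  assumes "n \<le> p" "v \<in> V"
  obtains d where "\<And>i. i \<le> n \<Longrightarrow> d i \<in> W i"
    and "B v v - B (half_sweep T n v) (half_sweep T n v) = (\<Sum>i\<le>n. B (d i) (d i))"
    and "\<And>i z. \<lbrakk>i \<le> n; z \<in> W i\<rbrakk> \<Longrightarrow> B v z = (\<Sum>j=i..n. B (d j) z)"
proof -
  have energy: "B v v - B (id_minus (T i) v) (id_minus (T i) v) = B (T i v) (T i v)"
    if "i \<le> p" "v \<in> V" for i v
  proof -
    have "B v (T i v) = B (T i v) (T i v)"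
      using that T_proj[of i v "T i v"] T_in by simp
    then show ?thesis
      using that T_in_V sym[of "T i v" v] by (simp add: id_minus_def diff_left diff_right V_diff)
  qed
  have "\<exists>d. (\<forall>i\<le>n. d i \<in> W i) \<and>
      B v v - B (half_sweep T n v) (half_sweep T n v) = (\<Sum>i\<le>n. B (d i) (d i)) \<and>
      (\<forall>i\<le>n. \<forall>z\<in>W i. B v z = (\<Sum>j=i..n. B (d j) z))"
    using assms
  proof (induction n arbitrary: v)
    case 0
    then show ?case
      using energy[of 0 v] T_in T_proj by (intro exI[of _ "\<lambda>_. T 0 v"]) auto
  next
    case (Suc n)
    let ?v = "id_minus (T (Suc n)) v"
    obtain d where d: "\<forall>i\<le>n. d i \<in> W i"
      "B ?v ?v - B (half_sweep T n ?v) (half_sweep T n ?v) = (\<Sum>i\<le>n. B (d i) (d i))"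
      "\<forall>i\<le>n. \<forall>z\<in>W i. B ?v z = (\<Sum>j=i..n. B (d j) z)"
      using Suc.IH[of ?v] Suc.prems id_minus_in by auto
    let ?d = "d(Suc n := T (Suc n) v)"
    have "B v z = (\<Sum>j=i..Suc n. B (?d j) z)" if "i \<le> Suc n" "z \<in> W i" for i z
    proof (cases "i = Suc n")
      case True
      then show ?thesis
        using that Suc.prems T_proj by simp
    next
      case False
      then have i: "i \<le> n"
        using that by simp
      have z: "z \<in> V"
        using that Suc.prems W_subset[of i] by auto
      have "B v z = B ?v z + B (T (Suc n) v) z"
        using z Suc.prems T_in_V by (simp add: id_minus_def diff_left)
      also have "B ?v z = (\<Sum>j=i..n. B (?d j) z)"
        using d(3) i that by (auto intro!: sum.cong)
      finally show ?thesis
        using i by simp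
    qed
    moreover have "(\<Sum>i\<le>n. B (?d i) (?d i)) = (\<Sum>i\<le>n. B (d i) (d i))"
      by (intro sum.cong) auto
    then have "B v v - B (half_sweep T (Suc n) v) (half_sweep T (Suc n) v) = (\<Sum>i\<le>Suc n. B (?d i) (?d i))"
      using d(2) energy[of "Suc n" v] Suc.prems by simp
    moreover have "\<forall>i\<le>Suc n. ?d i \<in> W i"
      using d(1) Suc.prems T_in by (auto simp: le_Suc_eq)
    ultimately show ?case
      by (intro exI[of _ ?d]) blast
  qed
  then show ?thesis
    using that by blast
qed

text \<open>The coarse space \<open>W 0\<close> may interact with every other subspace, so it is estimated through the
  sum of the corrections in the other spaces, at the price of an extra \<open>sqrt g\<close>.\<close>

lemma half_sweep_contraction:
  assumes g: "0 \<le> g" and K: "0 < K"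
    and G_sym: "\<And>i j. G i j \<longleftrightarrow> G j i"
    and G_deg: "\<And>i. i \<in> {1..p} \<Longrightarrow> real (card {j\<in>{1..p}. G i j}) \<le> g"
    and G_orth: "\<And>i j u v. \<lbrakk>i \<in> {1..p}; j \<in> {1..p}; \<not> G i j; u \<in> W i; v \<in> W j\<rbrakk> \<Longrightarrow> B u v = 0"
    and v: "v \<in> V" and w: "\<And>i. i \<le> p \<Longrightarrow> w i \<in> W i" and v_eq: "v = (\<lambda>x. \<Sum>i\<le>p. w i x)"
    and stable: "(\<Sum>i\<le>p. B (w i) (w i)) \<le> K * B v v"
  shows "B v v \<le> K * (3 + 2 * g)\<^sup>2 * (B v v - B (half_sweep T p v) (half_sweep T p v))"
proof -
  define N where "N = (\<lambda>u. sqrt (B u u))"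
  obtain d where d: "\<And>i. i \<le> p \<Longrightarrow> d i \<in> W i"
    and d_energy: "B v v - B (half_sweep T p v) (half_sweep T p v) = (\<Sum>i\<le>p. B (d i) (d i))"
    and d_test: "\<And>i z. \<lbrakk>i \<le> p; z \<in> W i\<rbrakk> \<Longrightarrow> B v z = (\<Sum>j=i..p. B (d j) z)"
    using half_sweep_corrections[OF order_refl v] by blast
  have dV: "\<And>i. i \<le> p \<Longrightarrow> d i \<in> V" and wV: "\<And>i. i \<le> p \<Longrightarrow> w i \<in> V"
    using d w W_subset by blast+
  have N2: "(N u)\<^sup>2 = B u u" and N0: "0 \<le> N u" if "u \<in> V" for u
    using nonneg[OF that] by (simp_all add: N_def)
  have CS: "B u z \<le> N u * N z" if "u \<in> V" "z \<in> V" for u z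
    using Cauchy_Schwarz[OF that] by (simp add: N_def)
  \<comment> \<open>The target is \<open>B v v \<le> (1 + sqrt g + g) * (X * Y)\<close>:
    \<open>X\<close> is controlled by the stable decomposition, and the square of \<open>Y\<close>
    is the energy lost in the sweep.\<close>
  define X where "X = sqrt (\<Sum>i\<le>p. B (w i) (w i))"
  define Y where "Y = sqrt (\<Sum>i\<le>p. B (d i) (d i))"
  have X0: "0 \<le> X" and Y0: "0 \<le> Y"
    unfolding X_def Y_def using nonneg dV wV by (auto intro!: sum_nonneg)
  have X2: "X\<^sup>2 = (\<Sum>i\<le>p. B (w i) (w i))" and Y2: "Y\<^sup>2 = (\<Sum>i\<le>p. B (d i) (d i))"
    unfolding X_def Y_def using nonneg dV wV by (auto intro!: real_sqrt_pow2 sum_nonneg)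
  have part: "sqrt (\<Sum>i\<in>{1..p}. (N (u i))\<^sup>2) \<le> sqrt (\<Sum>i\<le>p. B (u i) (u i))" "N (u 0) \<le> sqrt (\<Sum>i\<le>p. B (u i) (u i))"
    if u: "\<And>i. i \<le> p \<Longrightarrow> u i \<in> V" for u
  proof -
    have "(\<Sum>i\<in>{1..p}. (N (u i))\<^sup>2) = (\<Sum>i\<in>{1..p}. B (u i) (u i))"
      using N2 u by (intro sum.cong) auto
    also have "\<dots> \<le> (\<Sum>i\<le>p. B (u i) (u i))"
      using nonneg u by (intro sum_mono2) auto
    finally show "sqrt (\<Sum>i\<in>{1..p}. (N (u i))\<^sup>2) \<le> sqrt (\<Sum>i\<le>p. B (u i) (u i))"
      by simp
    show "N (u 0) \<le> sqrt (\<Sum>i\<le>p. B (u i) (u i))"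
      unfolding N_def using nonneg u member_le_sum[of 0 "{..p}" "\<lambda>i. B (u i) (u i)"] by auto
  qed
  have incidence: "(\<Sum>i\<in>{1..p}. \<Sum>j\<in>{1..p}. if G i j then N (u i) * N (z j) else 0)
      \<le> g * (sqrt (\<Sum>i\<le>p. B (u i) (u i)) * sqrt (\<Sum>i\<le>p. B (z i) (z i)))"
    if u: "\<And>i. i \<le> p \<Longrightarrow> u i \<in> V" and z: "\<And>i. i \<le> p \<Longrightarrow> z i \<in> V" for u z
  proof -
    have "(\<Sum>i\<in>{1..p}. \<Sum>j\<in>{1..p}. if G i j then N (u i) * N (z j) else 0)
      \<le> g * (sqrt (\<Sum>i\<in>{1..p}. (N (u i))\<^sup>2) * sqrt (\<Sum>j\<in>{1..p}. (N (z j))\<^sup>2))"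
      using sum_incidence_le[of "{1..p}" G g "\<lambda>i. N (u i)" "\<lambda>i. N (z i)"] G_sym G_deg g by blast
    also have "\<dots> \<le> g * (sqrt (\<Sum>i\<le>p. B (u i) (u i)) * sqrt (\<Sum>i\<le>p. B (z i) (z i)))"
      using part(1)[of u] part(1)[of z] u z g
      by (intro mult_left_mono mult_mono) (auto intro!: sum_nonneg nonneg)
    finally show ?thesis .
  qed
  have G_le: "B u z \<le> (if G i j then N u * N z else 0)"
    if "i \<in> {1..p}" "j \<in> {1..p}" "u \<in> W i" "z \<in> W j" for i j u z
    using that CS[of u z] G_orth[of i j u z] W_subset[of i] W_subset[of j] by auto
  \<comment> \<open>The range of \<open>j\<close> reflects the order of the sweep. Enlarging it to
    \<open>{1..p}\<close> adds only nonnegative bounds and produces the full incidence sum.\<close>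
  have fine: "(\<Sum>j=i..p. B (d j) (w i)) \<le> (\<Sum>j\<in>{1..p}. if G i j then N (w i) * N (d j) else 0)"
    if i: "i \<in> {1..p}" for i
  proof -
    have "B (d j) (w i) \<le> (if G i j then N (w i) * N (d j) else 0)" if "j \<in> {i..p}" for j
      using G_le[of i j "w i" "d j"] sym[of "d j" "w i"] i that d w dV wV by simp
    then have "(\<Sum>j=i..p. B (d j) (w i)) \<le> (\<Sum>j=i..p. if G i j then N (w i) * N (d j) else 0)"
      by (rule sum_mono)
    also have "\<dots> \<le> (\<Sum>j\<in>{1..p}. if G i j then N (w i) * N (d j) else 0)"
      using i N0 dV wV by (intro sum_mono2) (auto intro!: mult_nonneg_nonneg)
    finally show ?thesis .
  qed
  \<comment> \<open>Estimating \<open>B (w 0) (d j)\<close> separately for each \<open>j\<close>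
    would cost the square root of the number of subdomains, since \<open>W 0\<close> may interact
    with all of them. The energy of \<open>s\<close> grows only with the overlap.\<close>
  define s where "s = (\<lambda>x. \<Sum>j\<in>{1..p}. d j x)"
  have sV: "s \<in> V"
    unfolding s_def using dV by (intro V_sum) auto
  have "B s s = B s (\<lambda>x. \<Sum>j\<in>{1..p}. d j x)"
    by (simp add: s_def)
  also have "\<dots> = (\<Sum>i\<in>{1..p}. B s (d i))"
    using sV dV by (intro sum_right) auto
  also have "\<dots> = (\<Sum>i\<in>{1..p}. \<Sum>j\<in>{1..p}. B (d i) (d j))"
  proof (intro sum.cong refl)
    fix i assume "i \<in> {1..p}"
    then show "B s (d i) = (\<Sum>j\<in>{1..p}. B (d i) (d j))"
      using dV sV sym[of s "d i"] sum_right[of "d i" "{1..p}" d] by (auto simp: s_def)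
  qed
  also have "\<dots> \<le> (\<Sum>i\<in>{1..p}. \<Sum>j\<in>{1..p}. if G i j then N (d i) * N (d j) else 0)"
    using G_le d by (intro sum_mono) auto
  also have "\<dots> \<le> g * (Y * Y)"
    unfolding Y_def using dV by (intro incidence) auto
  finally have "sqrt (B s s) \<le> sqrt (g * (Y * Y))"
    by simp
  then have Ns: "N s \<le> sqrt g * Y"
    using Y0 by (simp add: N_def real_sqrt_mult)
  have coarse: "(\<Sum>j=0..p. B (d j) (w 0)) \<le> X * Y + X * (sqrt g * Y)"
  proof -
    have "(\<Sum>j=0..p. B (d j) (w 0)) = B (d 0) (w 0) + (\<Sum>j\<in>{1..p}. B (d j) (w 0))"
      by (simp add: sum.atLeast_Suc_atMost)
    also have "(\<Sum>j\<in>{1..p}. B (d j) (w 0)) = B (w 0) s"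
      unfolding s_def using dV wV sym[of _ "w 0"] by (subst sum_right) auto
    also have "B (d 0) (w 0) + B (w 0) s \<le> N (d 0) * N (w 0) + N (w 0) * N s"
      using CS dV wV sV by (intro add_mono) auto
    also have "\<dots> \<le> Y * X + X * (sqrt g * Y)"
      using part(2)[of d] part(2)[of w] dV wV Ns N0 sV X0 Y0 unfolding X_def[symmetric] Y_def[symmetric]
      by (intro add_mono mult_mono) auto
    finally show ?thesis
      by (simp add: mult.commute)
  qed
  have "B v v = (\<Sum>i\<le>p. B v (w i))"
    by (subst (2) v_eq, rule sum_right) (use v wV in auto)
  also have "\<dots> = (\<Sum>i\<le>p. \<Sum>j=i..p. B (d j) (w i))"
    using d_test w by (intro sum.cong) auto
  also have "\<dots> = (\<Sum>j=0..p. B (d j) (w 0)) + (\<Sum>i\<in>{1..p}. \<Sum>j=i..p. B (d j) (w i))"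
    by (simp add: atMost_atLeast0 sum.atLeast_Suc_atMost)
  also have "\<dots> \<le> (X * Y + X * (sqrt g * Y)) + g * (X * Y)"
  proof (rule add_mono[OF coarse])
    have "(\<Sum>i\<in>{1..p}. \<Sum>j=i..p. B (d j) (w i))
        \<le> (\<Sum>i\<in>{1..p}. \<Sum>j\<in>{1..p}. if G i j then N (w i) * N (d j) else 0)"
      using fine by (intro sum_mono) auto
    also have "\<dots> \<le> g * (X * Y)"
      unfolding X_def Y_def using dV wV by (intro incidence) auto
    finally show "(\<Sum>i\<in>{1..p}. \<Sum>j=i..p. B (d j) (w i)) \<le> g * (X * Y)" .
  qed
  also have "\<dots> = (1 + sqrt g + g) * (X * Y)"
    by (simp add: algebra_simps)
  \<comment> \<open>The argument yields the constant \<open>1 + sqrt g + g\<close>; the bound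
    \<open>sqrt g \<le> 1 + g\<close> brings it under the constant that enters
    \<open>C\<^sub>5\<close>.\<close>
  also have "\<dots> \<le> (3 + 2 * g) * (X * Y)"
  proof (rule mult_right_mono)
    have "sqrt g \<le> 1 + g"
      using g by (intro real_le_lsqrt) (auto simp: power2_eq_square algebra_simps)
    then show "1 + sqrt g + g \<le> 3 + 2 * g" by simp
  qed (use X0 Y0 in simp)
  finally have "(B v v)\<^sup>2 \<le> ((3 + 2 * g) * (X * Y))\<^sup>2"
    using nonneg[OF v] by (intro power_mono)
  also have "\<dots> = (3 + 2 * g)\<^sup>2 * X\<^sup>2 * Y\<^sup>2"
    by (simp add: power_mult_distrib)
  also have "\<dots> \<le> (3 + 2 * g)\<^sup>2 * (K * B v v) * Y\<^sup>2"
    using stable by (intro mult_right_mono mult_left_mono) (auto simp: X2)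
  finally have "B v v * B v v \<le> B v v * (K * (3 + 2 * g)\<^sup>2 * Y\<^sup>2)"
    by (simp add: power2_eq_square algebra_simps)
  \<comment> \<open>One factor \<open>B v v\<close> is cancelled; where it vanishes, the claim is
    that the right-hand side is nonnegative.\<close>
  then have "B v v \<le> K * (3 + 2 * g)\<^sup>2 * Y\<^sup>2"
    using nonneg[OF v] K by (cases "B v v = 0") (auto simp: mult_le_cancel_left)
  then show ?thesis
    by (simp only: d_energy Y2)
qed

text \<open>With K for the half sweep, the smoother K* K has norm at most the square of the norm of
  K. Pairing \<open>z = symmetric_ssc T p v\<close> with itself turns its energy into the product of
  K v and K z; Cauchy-Schwarz and cancelling \<open>B z z\<close> then replace an argument with
  operator norms.\<close>

lemma symmetric_ssc_contraction:
  assumes C: "0 < C"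
    and half: "\<And>v. v \<in> V \<Longrightarrow> B v v \<le> C * (B v v - B (half_sweep T p v) (half_sweep T p v))"
    and v: "v \<in> V"
  shows "B (symmetric_ssc T p v) (symmetric_ssc T p v) \<le> (C / (C + 1))\<^sup>2 * B v v"
proof -
  let ?q = "C / (C + 1)"
  have half': "B (half_sweep T p u) (half_sweep T p u) \<le> ?q * B u u" if "u \<in> V" for u
  proof -
    let ?h = "B (half_sweep T p u) (half_sweep T p u)"
    have "C * ?h \<le> (C - 1) * B u u"
      using half[OF that] by (simp add: algebra_simps)
    \<comment> \<open>The passage from (C - 1)/C to C/(C + 1), written without fractions: (C + 1)(C
      - 1) \<le> C^2.\<close>
    then have "(C + 1) * (C * ?h) \<le> (C + 1) * ((C - 1) * B u u)"
      using C by (intro mult_left_mono) auto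
    also have "\<dots> = (C * C - 1) * B u u"
      by (simp add: algebra_simps)
    also have "\<dots> \<le> (C * C) * B u u"
      using nonneg[OF that] by (intro mult_right_mono) auto
    finally have "C * ((C + 1) * ?h) \<le> C * (C * B u u)"
      by (simp add: algebra_simps)
    then have "(C + 1) * ?h \<le> C * B u u"
      using C by simp
    then show ?thesis
      using C by (simp add: field_simps)
  qed
  define z where "z = symmetric_ssc T p v"
  have z: "z \<in> V"
    unfolding z_def using v symmetric_ssc_in by blast
  let ?h = "half_sweep T p"
  have h: "?h v \<in> V" "?h z \<in> V"
    using v z half_sweep_in by auto
  have "B z z = B (?h v) (?h z)"
    using v z symmetric_ssc_half_sweep[of p v z] by (simp add: z_def)
  then have "(B z z)\<^sup>2 \<le> B (?h v) (?h v) * B (?h z) (?h z)"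
    using Cauchy_Schwarz_sqr[OF h] by simp
  also have "\<dots> \<le> (?q * B v v) * (?q * B z z)"
    using half'[OF v] half'[OF z] nonneg h v C by (intro mult_mono) (auto intro!: mult_nonneg_nonneg)
  finally have "B z z * B z z \<le> B z z * (?q\<^sup>2 * B v v)"
    by (simp add: power2_eq_square algebra_simps)
  moreover have "0 \<le> ?q\<^sup>2 * B v v"
    using nonneg[OF v] by simp
  ultimately show ?thesis
    using nonneg[OF z] unfolding z_def[symmetric]
    by (cases "B z z = 0") (auto simp: mult_le_cancel_left)
qed

end

lemma power_contraction_le_rate:
  fixes C :: real
  assumes "0 < C"
  shows "(C / (C + 1)) ^ (2 * n) \<le> C / (C + 2 * real n)"
proof -
  have "0 \<le> 1 / C"
    using assms by simp
  then have "- 1 \<le> 1 / C"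
    by linarith
  then have "1 + real (2 * n) * (1 / C) \<le> (1 + 1 / C) ^ (2 * n)"
    by (rule Bernoulli_inequality)
  then have "(C + 2 * real n) / C \<le> ((C + 1) / C) ^ (2 * n)"
    using assms by (simp add: add_divide_distrib)
  then have "1 / (((C + 1) / C) ^ (2 * n)) \<le> 1 / ((C + 2 * real n) / C)"
    using assms by (intro divide_left_mono) (auto intro!: mult_pos_pos zero_less_power divide_pos_pos)
  then show ?thesis
    by (simp add: power_divide)
qed

text \<open>The induction carries only the weak statement a(E u, u) \<le> a(u, u). This suffices for
  the coarse correction not to increase the energy, and the rate at level \<open>k\<close> then
  comes from the smoothing on that level alone, so that nothing accumulates over the levels.\<close>

lemma mg_error_bound:
  fixes V :: "nat \<Rightarrow> (real^'n::finite \<Rightarrow> real) set"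
  assumes inner: "\<And>k. k \<le> J \<Longrightarrow> inner_form (V k) B"
    and nested: "\<And>k. Suc k \<le> J \<Longrightarrow> V k \<subseteq> V (Suc k)"
    and P_in: "\<And>k u. \<lbrakk>Suc k \<le> J; u \<in> V (Suc k)\<rbrakk> \<Longrightarrow> P k u \<in> V k"
    and P_proj: "\<And>k u v. \<lbrakk>Suc k \<le> J; u \<in> V (Suc k); v \<in> V k\<rbrakk> \<Longrightarrow> B (P k u) v = B u v"
    and S_in: "\<And>k u. \<lbrakk>k \<le> J; u \<in> V k\<rbrakk> \<Longrightarrow> S k u \<in> V k"
    and S_sym: "\<And>k u v. \<lbrakk>k \<le> J; u \<in> V k; v \<in> V k\<rbrakk> \<Longrightarrow> B (S k u) v = B u (S k v)"
    and S_contr: "\<And>k u. \<lbrakk>k \<le> J; u \<in> V k\<rbrakk> \<Longrightarrow> B (S k u) (S k u) \<le> (C k / (C k + 1))\<^sup>2 * B u u"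
    and C: "\<And>k. 0 < C k"
    and k: "1 \<le> k" "k \<le> J" and v: "v \<in> V k"
  shows "B (mg_error S P m k v) v \<le> C k / (C k + 2 * real (m k)) * B v v"
proof -
  have iter_in: "(S k ^^ n) u \<in> V k" if "k \<le> J" "u \<in> V k" for k n u
    using that by (induction n) (auto intro: S_in)
  \<comment> \<open>Moves the post-smoothing steps to the second argument, where they produce the
    same function as the pre-smoothing steps.\<close>
  have iter_sym: "B ((S k ^^ n) u) v = B u ((S k ^^ n) v)" if "k \<le> J" "u \<in> V k" "v \<in> V k" for k n u v
    using that
  proof (induction n arbitrary: v)
    case (Suc n)
    then have "B ((S k ^^ Suc n) u) v = B ((S k ^^ n) u) (S k v)"
      using iter_in by (simp add: S_sym)
    then show ?case
      using Suc S_in by (simp add: funpow_swap1)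
  qed simp
  have iter_contr: "B ((S k ^^ n) u) ((S k ^^ n) u) \<le> (C k / (C k + 1)) ^ (2 * n) * B u u"
    if "k \<le> J" "u \<in> V k" for k n u
  proof (induction n)
    case (Suc n)
    have "B ((S k ^^ Suc n) u) ((S k ^^ Suc n) u) \<le> (C k / (C k + 1))\<^sup>2 * B ((S k ^^ n) u) ((S k ^^ n) u)"
      using S_contr iter_in that by simp
    also have "\<dots> \<le> (C k / (C k + 1))\<^sup>2 * ((C k / (C k + 1)) ^ (2 * n) * B u u)"
      using Suc by (intro mult_left_mono) auto
    also have "\<dots> = (C k / (C k + 1)) ^ (2 * Suc n) * B u u"
      by (simp add: power2_eq_square)
    finally show ?case .
  qed simp
  have E_in: "mg_error S P m k v \<in> V k" if "k \<le> J" "v \<in> V k" for k v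
    using that
  proof (induction k arbitrary: v)
    case 0
    then show ?case
      using inner_form.V_0[OF inner] by simp
  next
    case (Suc k)
    let ?w = "(S (Suc k) ^^ m (Suc k)) v"
    have w: "?w \<in> V (Suc k)"
      using iter_in Suc.prems by blast
    then have "mg_error S P m k (P k ?w) \<in> V (Suc k)" "P k ?w \<in> V (Suc k)"
      using Suc P_in nested by (meson Suc_leD subsetD)+
    then show ?case
      using iter_in inner_form.V_diff[OF inner] Suc.prems w by (simp add: id_minus_def)
  qed
  have step: "B (mg_error S P m (Suc k) v) v \<le> (C (Suc k) / (C (Suc k) + 1)) ^ (2 * m (Suc k)) * B v v"
    if k: "Suc k \<le> J" and v: "v \<in> V (Suc k)"
      and IH: "\<And>u. u \<in> V k \<Longrightarrow> B (mg_error S P m k u) u \<le> B u u" for k v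
  proof -
    interpret inner_form "V (Suc k)" B
      using inner k by blast
    define w where "w = (S (Suc k) ^^ m (Suc k)) v"
    define u where "u = P k w"
    define e where "e = mg_error S P m k u"
    have w: "w \<in> V (Suc k)"
      unfolding w_def using iter_in k v by blast
    have u: "u \<in> V k" "u \<in> V (Suc k)"
      unfolding u_def using P_in nested k w by blast+
    have e: "e \<in> V k" "e \<in> V (Suc k)"
      unfolding e_def using E_in[of k u] u nested k by auto
    have "mg_error S P m (Suc k) v = (S (Suc k) ^^ m (Suc k)) (\<lambda>x. w x - (u x - e x))"
      by (simp add: id_minus_def w_def u_def e_def)
    then have "B (mg_error S P m (Suc k) v) v = B (\<lambda>x. w x - (u x - e x)) w"
      using iter_sym[OF k _ v] w u e V_diff by (simp add: w_def)
    also have "\<dots> = B w w - B u w + B e w"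
      using w u e V_diff by (simp add: diff_left)
    \<comment> \<open>\<open>u\<close> is the energy projection of \<open>w\<close> onto
      \<open>V k\<close>, which contains both \<open>u\<close> and \<open>e\<close>. So
      \<open>w\<close> may be replaced by \<open>u\<close>, and what is left besides
      \<open>B w w\<close> is \<open>B e u - B u u\<close>, which the induction hypothesis makes
      nonpositive.\<close>
    also have "B u w = B u u"
      using P_proj[OF k w u(1)] u w sym by (simp add: u_def)
    also have "B e w = B e u"
      using P_proj[OF k w e(1)] u e w sym by (simp add: u_def)
    finally have "B (mg_error S P m (Suc k) v) v \<le> B w w"
      using IH[OF u(1)] by (simp add: e_def)
    also have "\<dots> \<le> (C (Suc k) / (C (Suc k) + 1)) ^ (2 * m (Suc k)) * B v v"
      unfolding w_def using iter_contr k v by blast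
    finally show ?thesis .
  qed
  have E_le: "B (mg_error S P m k v) v \<le> B v v" if "k \<le> J" "v \<in> V k" for k v
    using that
  proof (induction k arbitrary: v)
    case 0
    interpret inner_form "V 0" B
      using inner 0 by blast
    show ?case
      using 0 sym[of "\<lambda>x. 0" v] by (simp add: V_0 zero_right nonneg)
  next
    case (Suc k)
    interpret inner_form "V (Suc k)" B
      using inner Suc by blast
    let ?q = "C (Suc k) / (C (Suc k) + 1)"
    have "?q ^ (2 * m (Suc k)) \<le> 1"
      using C[of "Suc k"] by (intro power_le_one) auto
    then have "?q ^ (2 * m (Suc k)) * B v v \<le> B v v"
      using nonneg[OF Suc.prems(2)] by (intro mult_left_le_one_le) (auto intro!: zero_le_power divide_nonneg_nonneg simp: C less_imp_le)
    then show ?case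
      using step[OF Suc.prems] Suc by simp
  qed
  obtain l where l: "k = Suc l"
    using k by (cases k) auto
  have "B (mg_error S P m k v) v \<le> (C k / (C k + 1)) ^ (2 * m k) * B v v"
    unfolding l using step[of l v] E_le[of l] k v l by simp
  also have "\<dots> \<le> C k / (C k + 2 * real (m k)) * B v v"
    using power_contraction_le_rate[OF C] inner_form.nonneg[OF inner[OF k(2)] v]
    by (intro mult_right_mono)
  finally show ?thesis .
qed

subsection \<open>Test functions and the fundamental lemma of the calculus of variations\<close>

lemma partial_eqI: "(f has_derivative f') (at x) \<Longrightarrow> partial i f x = f' (axis i 1)"
  unfolding partial_def by (metis frechet_derivative_at)

lemma partial_add:
  assumes "\<And>x. f differentiable (at x)" "\<And>x. g differentiable (at x)"
  shows "partial i (\<lambda>x. f x + g x) = (\<lambda>x. partial i f x + partial i g x)"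
  using has_derivative_add[OF assms(1)[unfolded frechet_derivative_works] assms(2)[unfolded frechet_derivative_works]]
  by (intro ext) (subst partial_eqI, assumption, simp add: partial_def)

lemma partial_mult:
  assumes "\<And>x. f differentiable (at x)" "\<And>x. g differentiable (at x)"
  shows "partial i (\<lambda>x. f x * g x) = (\<lambda>x. f x * partial i g x + partial i f x * g x)"
  using has_derivative_mult[OF assms(1)[unfolded frechet_derivative_works] assms(2)[unfolded frechet_derivative_works]]
  by (intro ext) (subst partial_eqI, assumption, simp add: partial_def)

lemma Ck_SucD: "Ck (Suc r) f \<Longrightarrow> Ck r f"
proof (induction r arbitrary: f)
  case 0
  then show ?case
    by (auto simp: continuous_on_eq_continuous_at intro: differentiable_imp_continuous_within)
next
  case (Suc r)
  then show ?case
    by (subst Ck.simps(2)) (metis Ck.simps(2))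
qed

lemma Ck_const: "Ck r (\<lambda>x. c)"
proof (induction r arbitrary: c)
  case (Suc r)
  have "partial i (\<lambda>x. c) = (\<lambda>x. 0)" for i :: 'a
    by (intro ext) (simp add: partial_eqI[OF has_derivative_const])
  then show ?case
    using Suc by simp
qed simp

lemma Ck_add: "\<lbrakk>Ck r f; Ck r g\<rbrakk> \<Longrightarrow> Ck r (\<lambda>x. f x + g x)"
  by (induction r arbitrary: f g) (auto simp: partial_add intro: continuous_on_add)

lemma Ck_mult: "\<lbrakk>Ck r f; Ck r g\<rbrakk> \<Longrightarrow> Ck r (\<lambda>x. f x * g x)"
proof (induction r arbitrary: f g)
  case (Suc r)
  \<comment> \<open>The product rule leaves one factor undifferentiated; it is needed with one order
    less.\<close>
  note D = Suc.prems[THEN Ck_SucD]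
  show ?case
    using Suc D by (auto simp: partial_mult intro!: Ck_add)
qed (auto intro: continuous_on_mult)

lemma Ck_prod: "(\<And>i. i \<in> I \<Longrightarrow> Ck r (f i)) \<Longrightarrow> Ck r (\<lambda>x. \<Prod>i\<in>I. f i x)"
  by (induction I rule: infinite_finite_induct) (auto intro: Ck_const Ck_mult)

text \<open>\<open>flat k\<close> and all its derivatives vanish at \<open>0\<close>; the family is closed under differentiation up
  to linear combinations.\<close>

definition flat :: "nat \<Rightarrow> real \<Rightarrow> real" where
  "flat k t = (if 0 < t then (1 / t) ^ k * exp (- (1 / t)) else 0)"

lemma flat_has_derivative:
  "(flat k has_real_derivative - real k * flat (k + 1) t + flat (k + 2) t) (at t)"
proof -
  consider "0 < t" | "t < 0" | "t = 0" by linarith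
  then show ?thesis
  proof cases
    case 1
    have "((\<lambda>t. (1 / t) ^ k * exp (- (1 / t))) has_real_derivative
        - real k * flat (k + 1) t + flat (k + 2) t) (at t)"
      using 1 by (cases k) (auto intro!: derivative_eq_intros simp: flat_def field_simps power2_eq_square,
        metis One_nat_def power_eq_if)
    then show ?thesis
      by (rule has_field_derivative_transform_within_open[where S = "{0<..}"])
        (use 1 in \<open>auto simp: flat_def\<close>)
  next
    case 2
    have "((\<lambda>t. 0) has_real_derivative - real k * flat (k + 1) t + flat (k + 2) t) (at t)"
      using 2 by (simp add: flat_def)
    then show ?thesis
      by (rule has_field_derivative_transform_within_open[where S = "{..<0}"])
        (use 2 in \<open>auto simp: flat_def\<close>)
  next
    case 3
    have "((\<lambda>h. flat k h / h) \<longlongrightarrow> 0) (at 0)"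
      unfolding filterlim_at_split
    proof
      show "((\<lambda>h. flat k h / h) \<longlongrightarrow> 0) (at_left 0)"
        by (rule tendsto_eventually) (auto simp: eventually_at_filter flat_def)
      \<comment> \<open>With s = 1/h the difference quotient from the right is s^(k + 1) exp(-s),
        which tends to 0 as s grows.\<close>
      have "((\<lambda>h. inverse h ^ (k + 1) / exp (inverse h)) \<longlongrightarrow> (0::real)) (at_right 0)"
        by (rule filterlim_compose[OF tendsto_power_div_exp_0 filterlim_inverse_at_top_right])
      then show "((\<lambda>h. flat k h / h) \<longlongrightarrow> 0) (at_right 0)"
        by (rule Lim_transform_eventually)
          (auto simp: eventually_at_filter flat_def exp_minus inverse_eq_divide divide_simps)
    qed
    then show ?thesis
      using 3 by (simp add: has_field_derivative_iff flat_def)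
  qed
qed

lemma partial_flat:
  fixes i j :: "'n::finite"
  shows "((\<lambda>x::real^'n. flat k (c * x $ i + d)) has_derivative
      (\<lambda>h. (- real k * flat (k + 1) (c * x $ i + d) + flat (k + 2) (c * x $ i + d)) * (c * h $ i))) (at x)"
    and "partial j (\<lambda>x. flat k (c * x $ i + d)) =
      (\<lambda>x. (if j = i then c else 0) *
        (- real k * flat (k + 1) (c * x $ i + d) + flat (k + 2) (c * x $ i + d)))"
proof -
  have "((\<lambda>x::real^'n. c * x $ i + d) has_derivative (\<lambda>h. c * h $ i)) (at x)" for x
    by (auto intro!: derivative_eq_intros bounded_linear_imp_has_derivative bounded_linear_vec_nth)
  from has_derivative_compose[OF this flat_has_derivative[unfolded has_field_derivative_def]]
  show D: "((\<lambda>x::real^'n. flat k (c * x $ i + d)) has_derivative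
      (\<lambda>h. (- real k * flat (k + 1) (c * x $ i + d) + flat (k + 2) (c * x $ i + d)) * (c * h $ i))) (at x)" for x
    by (simp add: mult.commute)
  show "partial j (\<lambda>x. flat k (c * x $ i + d)) =
      (\<lambda>x. (if j = i then c else 0) *
        (- real k * flat (k + 1) (c * x $ i + d) + flat (k + 2) (c * x $ i + d)))"
    by (intro ext) (subst partial_eqI[OF D], simp add: axis_def mult.commute)
qed

lemma Ck_flat: "Ck r (\<lambda>x::real^'n::finite. flat k (c * x $ i + d))"
proof (induction r arbitrary: k)
  case 0
  have "isCont (flat k) t" for t
    by (rule DERIV_isCont[OF flat_has_derivative])
  then have "continuous_on UNIV (flat k)"
    by (simp add: continuous_at_imp_continuous_on)
  then show ?case
    by (auto intro!: continuous_on_compose2[of UNIV "flat k"] continuous_intros)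
next
  case (Suc r)
  then show ?case
    unfolding Ck.simps(2) partial_flat(2)
    by (intro conjI allI Ck_add Ck_mult Ck_const) (auto intro: differentiableI partial_flat(1))
qed

lemma flat_0_bounds: "0 \<le> flat 0 t" "flat 0 t \<le> 1"
  by (auto simp: flat_def)

lemma flat_0_limit: "(\<lambda>n. flat 0 (real (Suc n) * t)) \<longlonglongrightarrow> (if 0 < t then 1 else 0)"
proof (cases "0 < t")
  case True
  have "(\<lambda>n. - (1 / t * inverse (real (Suc n)))) \<longlonglongrightarrow> - (1 / t * 0)"
    by (intro tendsto_intros LIMSEQ_inverse_real_of_nat)
  from tendsto_exp[OF this] have "(\<lambda>n. exp (- (1 / t * inverse (real (Suc n))))) \<longlonglongrightarrow> 1"
    by simp
  moreover have "flat 0 (real (Suc n) * t) = exp (- (1 / t * inverse (real (Suc n))))" for n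
  proof -
    have "0 < real (Suc n) * t"
      using True by (intro mult_pos_pos) auto
    then show ?thesis
      by (simp add: flat_def inverse_eq_divide mult.commute)
  qed
  ultimately show ?thesis
    using True by simp
next
  case False
  then have "\<not> 0 < real (Suc n) * t" for n
    by (simp add: not_less mult_nonneg_nonpos)
  then show ?thesis
    using False by (simp add: flat_def)
qed

text \<open>Smooth functions tending pointwise to the indicator of the open box: each face
  contributes a factor \<open>flat 0\<close> whose argument is stretched into a step by
  \<open>Suc n\<close>. Products of functions of one coordinate make mollification by convolution
  unnecessary; the arguments have the affine form of \<open>Ck_flat\<close>.\<close>

definition box_bump :: "real^'n::finite \<Rightarrow> real^'n \<Rightarrow> nat \<Rightarrow> real^'n \<Rightarrow> real" where
  "box_bump a b n x = (\<Prod>i\<in>UNIV. flat 0 (real (Suc n) * x $ i + - (real (Suc n) * a $ i)) *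
     flat 0 (- real (Suc n) * x $ i + real (Suc n) * b $ i))"

lemma box_bump_outside: "x \<notin> box a b \<Longrightarrow> box_bump a b n x = 0"
proof -
  assume "x \<notin> box a b"
  then obtain i where i: "x $ i \<le> a $ i \<or> b $ i \<le> x $ i"
    by (auto simp: mem_box_cart not_less)
  have "real (Suc n) * x $ i \<le> real (Suc n) * a $ i \<or> real (Suc n) * b $ i \<le> real (Suc n) * x $ i"
    using i by (auto intro: mult_left_mono)
  then show ?thesis
    unfolding box_bump_def
    by (intro prod_zero bexI[of _ i]) (auto simp: flat_def simp del: of_nat_Suc)
qed

lemma box_bump_bounds: "0 \<le> box_bump a b n x" "box_bump a b n x \<le> 1"
  unfolding box_bump_def
  by (auto intro!: prod_nonneg prod_le_1 mult_nonneg_nonneg mult_le_one simp: flat_0_bounds)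

lemma box_bump_limit: "(\<lambda>n. box_bump a b n x) \<longlonglongrightarrow> indicator (box a b) x"
proof -
  have "(\<lambda>n. box_bump a b n x) \<longlonglongrightarrow>
      (\<Prod>i\<in>UNIV. (if 0 < x $ i - a $ i then 1 else 0) * (if 0 < b $ i - x $ i then 1 else 0))"
    unfolding box_bump_def
    by (intro tendsto_prod tendsto_mult flat_0_limit[THEN back_subst[of "\<lambda>f. f \<longlonglongrightarrow> _"]])
      (auto simp: algebra_simps)
  also have "(\<Prod>i\<in>UNIV. (if 0 < x $ i - a $ i then 1 else 0) * (if 0 < b $ i - x $ i then 1 else 0)) =
      (indicator (box a b) x :: real)"
    by (auto simp: indicator_def mem_box_cart prod_zero_iff)
  finally show ?thesis .
qed

lemma box_bump_test_function:
  assumes "cbox a b \<subseteq> U"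
  shows "box_bump a b n \<in> test_functions U"
proof -
  have "{x. box_bump a b n x \<noteq> 0} \<subseteq> cbox a b"
    using box_bump_outside[of _ a b n] box_subset_cbox by blast
  then have sub: "closure {x. box_bump a b n x \<noteq> 0} \<subseteq> cbox a b"
    by (rule closure_minimal) (rule closed_cbox)
  then have "compact (closure {x. box_bump a b n x \<noteq> 0})"
    by (metis bounded_cbox bounded_subset closed_closure compact_eq_bounded_closed)
  moreover have "Ck r (box_bump a b n)" for r
    unfolding box_bump_def[abs_def] by (intro Ck_prod Ck_mult Ck_flat)
  ultimately show ?thesis
    using assms sub by (auto simp: test_functions_def)
qed


section \<open>Square-integrable functions and the fundamental lemma\<close>

lemma L2_lebesgue:
  assumes "open \<Omega>"
  shows "f \<in> L2 \<Omega> \<longleftrightarrow> (\<lambda>x. indicator \<Omega> x * f x) \<in> borel_measurable lebesgue \<and>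
    integrable lebesgue (\<lambda>x. (indicator \<Omega> x * f x)\<^sup>2)"
proof -
  have \<Omega>: "\<Omega> \<in> sets lebesgue" "\<Omega> \<inter> space lebesgue \<in> sets lebesgue"
    using assms by auto
  have "(\<lambda>x. (indicator \<Omega> x * f x)\<^sup>2) = (\<lambda>x. indicator \<Omega> x *\<^sub>R (f x)\<^sup>2)"
    by (auto simp: indicator_def)
  then show ?thesis
    using borel_measurable_restrict_space_iff[OF \<Omega>(2), of f] integrable_restrict_space[OF \<Omega>(2), of "\<lambda>x. (f x)\<^sup>2"]
    unfolding L2_def by simp
qed

lemma l2_lebesgue:
  assumes "open \<Omega>"
  shows "l2 \<Omega> u v = (\<integral>x. (indicator \<Omega> x * u x) * (indicator \<Omega> x * v x) \<partial>lebesgue)"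
proof -
  have "\<Omega> \<inter> space lebesgue \<in> sets lebesgue"
    using assms by auto
  moreover have "(\<lambda>x. (indicator \<Omega> x * u x) * (indicator \<Omega> x * v x)) = (\<lambda>x. indicator \<Omega> x *\<^sub>R (u x * v x))"
    by (auto simp: indicator_def)
  ultimately show ?thesis
    unfolding l2_def by (simp add: integral_restrict_space)
qed

lemma integrable_L2_mult:
  assumes "u \<in> L2 \<Omega>" "v \<in> L2 \<Omega>"
  shows "integrable (lebesgue_on \<Omega>) (\<lambda>x. u x * v x)"
proof (rule Bochner_Integration.integrable_bound)
  show "integrable (lebesgue_on \<Omega>) (\<lambda>x. (u x)\<^sup>2 + (v x)\<^sup>2)"
    using assms by (auto simp: L2_def)
  show "(\<lambda>x. u x * v x) \<in> borel_measurable (lebesgue_on \<Omega>)"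
    using assms by (auto simp: L2_def)
  have "\<bar>a * b\<bar> \<le> a\<^sup>2 + b\<^sup>2" for a b :: real
    using sum_squares_bound[of "\<bar>a\<bar>" "\<bar>b\<bar>"] mult_nonneg_nonneg[of "\<bar>a\<bar>" "\<bar>b\<bar>"]
    by (simp only: abs_mult power2_abs) linarith
  then show "AE x in lebesgue_on \<Omega>. norm (u x * v x) \<le> norm ((u x)\<^sup>2 + (v x)\<^sup>2)"
    by simp
qed

lemma L2_add:
  assumes "u \<in> L2 \<Omega>" "v \<in> L2 \<Omega>"
  shows "(\<lambda>x. u x + v x) \<in> L2 \<Omega>"
  using assms integrable_L2_mult[OF assms]
  by (auto simp: L2_def power2_sum mult.assoc)

lemma L2_scale: "u \<in> L2 \<Omega> \<Longrightarrow> (\<lambda>x. c * u x) \<in> L2 \<Omega>"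
  by (auto simp: L2_def power_mult_distrib)

text \<open>The estimate |a| \<le> a^2 + 1 suffices, because the constant 1 is integrable over a
  bounded box.\<close>

lemma L2_integrable_cbox:
  assumes \<Omega>: "open \<Omega>" and f: "f \<in> L2 \<Omega>"
  shows "(\<lambda>x. indicator \<Omega> x * f x) absolutely_integrable_on cbox a b"
  unfolding set_integrable_def
proof (rule Bochner_Integration.integrable_bound)
  show "integrable lebesgue (\<lambda>x. (indicator \<Omega> x * f x)\<^sup>2 + indicator (cbox a b) x :: real)"
    using f L2_lebesgue[OF \<Omega>] lmeasurable_cbox[of a b]
    by (intro Bochner_Integration.integrable_add integrable_real_indicator) (auto simp: fmeasurable_def)
  have "(\<lambda>x. indicator \<Omega> x * f x) \<in> borel_measurable lebesgue"
    using f L2_lebesgue[OF \<Omega>] by blast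
  then show "(\<lambda>x. indicator (cbox a b) x *\<^sub>R (indicator \<Omega> x * f x)) \<in> borel_measurable lebesgue"
    by (intro borel_measurable_scaleR borel_measurable_indicator) auto
  have "\<bar>a\<bar> \<le> a\<^sup>2 + 1" for a :: real
    using sum_squares_bound[of "\<bar>a\<bar>" 1] by simp
  then show "AE x in lebesgue. norm (indicator (cbox a b) x *\<^sub>R (indicator \<Omega> x * f x))
      \<le> norm ((indicator \<Omega> x * f x)\<^sup>2 + indicator (cbox a b) x)"
    by (auto simp: indicator_def)
qed

text \<open>Test functions approximating the indicator of a box make the integral of
  \<open>h\<close> over every closed box inside \<open>U\<close> vanish, and at almost every point
  \<open>h\<close> is the limit of its means over shrinking cubes. Keeping \<open>U\<close> apart
  from \<Omega> serves two uses: the uniqueness of weak derivatives, with \<open>U\<close> equal to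
  \<Omega>, and their vanishing off a support.\<close>

lemma AE_zero_if_l2_test_functions_zero:
  assumes \<Omega>: "open \<Omega>" and U: "open U" "U \<subseteq> \<Omega>" and h: "h \<in> L2 \<Omega>"
    and orth: "\<And>\<phi>. \<phi> \<in> test_functions U \<Longrightarrow> l2 \<Omega> h \<phi> = 0"
  shows "AE x in lebesgue_on \<Omega>. x \<in> U \<longrightarrow> h x = 0"
proof -
  define f where "f = (\<lambda>x. indicator \<Omega> x * h x)"
  have int: "f absolutely_integrable_on cbox a b" for a b
    unfolding f_def by (rule L2_integrable_cbox[OF \<Omega> h])
  have meas: "f \<in> borel_measurable lebesgue"
    using h L2_lebesgue[OF \<Omega>] by (simp add: f_def)
  have box_zero: "integral (cbox a b) f = 0" if ab: "cbox a b \<subseteq> U" for a b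
  proof -
    have bump_eq: "indicator \<Omega> x * box_bump a b n x = box_bump a b n x" for n x
      using ab U box_subset_cbox[of a b] box_bump_outside[of x a b n] by (auto simp: indicator_def)
    have "(\<lambda>n. \<integral>x. f x * box_bump a b n x \<partial>lebesgue) \<longlonglongrightarrow> (\<integral>x. f x * indicator (box a b) x \<partial>lebesgue)"
    proof (rule integral_dominated_convergence)
      show "integrable lebesgue (\<lambda>x. \<bar>indicator (cbox a b) x *\<^sub>R f x\<bar>)"
        using int[of a b] by (auto simp: set_integrable_def)
      have "continuous_on UNIV (box_bump a b n)" for n
        using box_bump_test_function[OF ab, of n] Ck.simps(1) by (fastforce simp: test_functions_def)
      then have "box_bump a b n \<in> borel_measurable lebesgue" for n
        by (intro measurable_completion) (simp add: borel_measurable_continuous_onI)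
      then show "(\<lambda>x. f x * box_bump a b n x) \<in> borel_measurable lebesgue" for n
        using meas by measurable
      show "(\<lambda>x. f x * indicator (box a b) x) \<in> borel_measurable lebesgue"
        using meas by (intro borel_measurable_times borel_measurable_indicator) auto
      show "AE x in lebesgue. (\<lambda>n. f x * box_bump a b n x) \<longlonglongrightarrow> f x * indicator (box a b) x"
        by (intro AE_I2 tendsto_intros box_bump_limit)
      show "AE x in lebesgue. norm (f x * box_bump a b n x) \<le> \<bar>indicator (cbox a b) x *\<^sub>R f x\<bar>" for n
      proof (rule AE_I2)
        fix x
        show "norm (f x * box_bump a b n x) \<le> \<bar>indicator (cbox a b) x *\<^sub>R f x\<bar>"
        proof (cases "x \<in> box a b")
          case True
          then have "x \<in> cbox a b"
            using box_subset_cbox by blast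
          then show ?thesis
            using box_bump_bounds[of a b n x] by (simp add: abs_mult mult_left_le)
        qed (simp add: box_bump_outside)
      qed
    qed
    moreover have "(\<integral>x. f x * box_bump a b n x \<partial>lebesgue) = 0" for n
      using orth[OF box_bump_test_function[OF ab, of n]] bump_eq by (simp add: l2_lebesgue[OF \<Omega>] f_def)
    ultimately have "(\<integral>x. f x * indicator (box a b) x \<partial>lebesgue) = 0"
      using LIMSEQ_unique[OF _ tendsto_const] by simp
    moreover have "f absolutely_integrable_on box a b"
      using int[of a b] by (rule set_integrable_subset) (auto simp: box_subset_cbox)
    ultimately have "integral (box a b) f = 0"
      using set_lebesgue_integral_eq_integral(2)[of "box a b" f]
      by (simp add: set_lebesgue_integral_def mult.commute)
    then show ?thesis
      by (simp add: integral_open_interval)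
  qed
  obtain N where N: "negligible N" and lebesgue_point: "\<And>x e. \<lbrakk>x \<notin> N; 0 < e\<rbrakk> \<Longrightarrow>
      \<exists>d>0. \<forall>t. 0 < t \<and> t < d \<longrightarrow>
        norm (integral (cbox x (x + t *\<^sub>R One)) f /\<^sub>R t ^ DIM(real^'a) - f x) < e"
    using integrable_ccontinuous_explicit[of f] int set_lebesgue_integral_eq_integral(1) by metis
  have zero: "f x = 0" if x: "x \<in> U" "x \<notin> N" for x
  proof (rule ccontr)
    assume "f x \<noteq> 0"
    \<comment> \<open>With the tolerance \<open>\<bar>f x\<bar>\<close> the mean over a small cube
      would have to be nonzero, while it vanishes as soon as the cube lies in
      \<open>U\<close>.\<close>
    then obtain d where d: "d > 0" "\<And>t. \<lbrakk>0 < t; t < d\<rbrakk> \<Longrightarrow>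
        norm (integral (cbox x (x + t *\<^sub>R One)) f /\<^sub>R t ^ DIM(real^'a) - f x) < \<bar>f x\<bar>"
      using lebesgue_point[OF x(2), of "\<bar>f x\<bar>"] by auto
    obtain r where r: "r > 0" "cball x r \<subseteq> U"
      using U x open_contains_cball by blast
    define t where "t = min (d / 2) (r / (norm (One :: real^'a) + 1))"
    have t: "0 < t" "t < d"
      using d r by (auto simp: t_def add_nonneg_pos)
    have "t * norm (One :: real^'a) \<le> r / (norm (One :: real^'a) + 1) * (norm (One :: real^'a) + 1)"
      unfolding t_def using d r by (intro mult_mono) auto
    also have "\<dots> = r"
      using add_nonneg_pos[OF norm_ge_zero[of "One :: real^'a"] zero_less_one] by simp
    finally have tr: "t * norm (One :: real^'a) \<le> r" .
    have "cbox x (x + t *\<^sub>R One) \<subseteq> cball x r"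
    proof
      fix y assume y: "y \<in> cbox x (x + t *\<^sub>R One)"
      have "norm (y - x) \<le> norm (t *\<^sub>R (One :: real^'a))"
        using y t by (intro norm_le_componentwise) (auto simp: mem_box inner_diff_left inner_add_left)
      then show "y \<in> cball x r"
        using t tr by (simp add: dist_norm norm_minus_commute)
    qed
    then show False
      using box_zero[of x "x + t *\<^sub>R One"] d(2)[OF t] r(2) by auto
  qed
  have zero': "h x = 0" if "x \<in> \<Omega>" "x \<in> U" "x \<notin> N" for x
    using zero[of x] that by (simp add: f_def)
  have "AE x in lebesgue. x \<notin> N"
    using N by (intro AE_not_in) (simp add: negligible_iff_null_sets)
  then have "AE x in lebesgue. x \<in> \<Omega> \<longrightarrow> x \<in> U \<longrightarrow> h x = 0"
    by eventually_elim (use zero' in blast)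
  then show ?thesis
    using \<Omega> by (simp add: AE_restrict_space_iff)
qed

subsection \<open>Weak derivatives\<close>

lemma compact_closed_subset: "\<lbrakk>compact K; closed C; C \<subseteq> K\<rbrakk> \<Longrightarrow> compact C"
  using compact_Int_closed[of K C] by (simp add: inf.absorb2)

lemma test_functionD:
  assumes "\<phi> \<in> test_functions \<Omega>"
  shows "Ck r \<phi>" and "continuous_on UNIV \<phi>" and "\<phi> differentiable (at x)"
    and "compact (closure {x. \<phi> x \<noteq> 0})" and "closure {x. \<phi> x \<noteq> 0} \<subseteq> \<Omega>" and "x \<notin> \<Omega> \<Longrightarrow> \<phi> x = 0"
proof -
  show Ck: "Ck r \<phi>" for r
    using assms by (simp add: test_functions_def)
  show "continuous_on UNIV \<phi>"
    using Ck[of 0] by simp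
  show "\<phi> differentiable (at x)"
    using Ck[of 1] by simp
  show "compact (closure {x. \<phi> x \<noteq> 0})" and sub: "closure {x. \<phi> x \<noteq> 0} \<subseteq> \<Omega>"
    using assms by (auto simp: test_functions_def)
  show "\<phi> x = 0" if "x \<notin> \<Omega>"
    using that sub closure_subset[of "{x. \<phi> x \<noteq> 0}"] by blast
qed

lemma test_functionI:
  assumes "\<And>r. Ck r \<psi>" "\<phi> \<in> test_functions \<Omega>" "{x. \<psi> x \<noteq> 0} \<subseteq> closure {x. \<phi> x \<noteq> 0}"
  shows "\<psi> \<in> test_functions \<Omega>"
proof -
  have "closure {x. \<psi> x \<noteq> 0} \<subseteq> closure {x. \<phi> x \<noteq> 0}"
    by (rule closure_minimal[OF assms(3) closed_closure])
  moreover from this have "compact (closure {x. \<psi> x \<noteq> 0})"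
    using compact_closed_subset[OF test_functionD(4)[OF assms(2)] closed_closure] by blast
  ultimately show ?thesis
    using assms(1) test_functionD(5)[OF assms(2)] by (auto simp: test_functions_def)
qed

lemma test_function_mult:
  assumes "\<phi> \<in> test_functions \<Omega>" "\<psi> \<in> test_functions \<Omega>"
  shows "(\<lambda>x. \<phi> x * \<psi> x) \<in> test_functions \<Omega>"
proof (rule test_functionI[OF _ assms(1)])
  show "{x. \<phi> x * \<psi> x \<noteq> 0} \<subseteq> closure {x. \<phi> x \<noteq> 0}"
    using closure_subset[of "{x. \<phi> x \<noteq> 0}"] by auto
qed (intro Ck_mult test_functionD(1)[OF assms(1)] test_functionD(1)[OF assms(2)])

lemma test_function_scale:
  assumes "\<phi> \<in> test_functions \<Omega>"
  shows "(\<lambda>x. c * \<phi> x) \<in> test_functions \<Omega>"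
proof (rule test_functionI[OF _ assms(1)])
  show "{x. c * \<phi> x \<noteq> 0} \<subseteq> closure {x. \<phi> x \<noteq> 0}"
    using closure_subset[of "{x. \<phi> x \<noteq> 0}"] by auto
qed (intro Ck_mult Ck_const test_functionD(1)[OF assms(1)])

lemma test_function_add:
  assumes "\<phi> \<in> test_functions \<Omega>" "\<psi> \<in> test_functions \<Omega>"
  shows "(\<lambda>x. \<phi> x + \<psi> x) \<in> test_functions \<Omega>"
proof -
  let ?K = "closure {x. \<phi> x \<noteq> 0} \<union> closure {x. \<psi> x \<noteq> 0}"
  have "{x. \<phi> x + \<psi> x \<noteq> 0} \<subseteq> {x. \<phi> x \<noteq> 0} \<union> {x. \<psi> x \<noteq> 0}"
    by auto
  also have "\<dots> \<subseteq> ?K"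
    by (intro Un_mono closure_subset)
  finally have sub: "closure {x. \<phi> x + \<psi> x \<noteq> 0} \<subseteq> ?K"
    by (rule closure_minimal) auto
  have "compact ?K"
    using assms by (intro compact_Un test_functionD(4))
  with sub have "compact (closure {x. \<phi> x + \<psi> x \<noteq> 0})"
    using compact_closed_subset[OF _ closed_closure] by blast
  then show ?thesis
    using sub assms[THEN test_functionD(5)] assms[THEN test_functionD(1)]
    by (auto simp: test_functions_def intro: Ck_add)
qed

lemma test_function_zero: "(\<lambda>x. 0) \<in> test_functions \<Omega>"
  by (auto simp: test_functions_def intro: Ck_const)

lemma test_function_partial:
  assumes "\<phi> \<in> test_functions \<Omega>"
  shows "partial i \<phi> \<in> test_functions \<Omega>"
proof (rule test_functionI[OF _ assms])
  show "Ck r (partial i \<phi>)" for r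
    using test_functionD(1)[OF assms, of "Suc r"] by simp
  show "{x. partial i \<phi> x \<noteq> 0} \<subseteq> closure {x. \<phi> x \<noteq> 0}"
  proof (rule ccontr)
    assume "\<not> ?thesis"
    then obtain x where x: "partial i \<phi> x \<noteq> 0" "x \<in> - closure {x. \<phi> x \<noteq> 0}"
      by blast
    have "\<phi> y = 0" if "y \<in> - closure {x. \<phi> x \<noteq> 0}" for y
      using that closure_subset[of "{x. \<phi> x \<noteq> 0}"] by blast
    note zero = this
    have "open (- closure {x. \<phi> x \<noteq> 0})"
      by (rule open_Compl) (rule closed_closure)
    from has_derivative_transform_within_open[OF has_derivative_const this x(2)]
    have "(\<phi> has_derivative (\<lambda>x. 0)) (at x)"
      using zero by metis
    then show False
      using x(1) partial_eqI by force
  qed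
qed

lemma test_function_integrable:
  assumes "\<phi> \<in> test_functions \<Omega>"
  shows "integrable lborel \<phi>"
proof -
  have "(\<lambda>x. indicator (closure {x. \<phi> x \<noteq> 0}) x *\<^sub>R \<phi> x) = \<phi>"
    using closure_subset[of "{x. \<phi> x \<noteq> 0}"] by (auto simp: indicator_def fun_eq_iff)
  then show ?thesis
    using borel_integrable_compact[OF test_functionD(4)[OF assms] continuous_on_subset[OF test_functionD(2)[OF assms]]]
    by simp
qed

lemma test_function_measurable:
  assumes "\<phi> \<in> test_functions \<Omega>"
  shows "\<phi> \<in> borel_measurable borel"
  using test_functionD(2)[OF assms] by (rule borel_measurable_continuous_onI)

lemma test_function_bounded:
  assumes "\<phi> \<in> test_functions \<Omega>"
  obtains M where "\<And>x. \<bar>\<phi> x\<bar> \<le> M" "0 \<le> M"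
proof -
  have "compact (\<phi> ` closure {x. \<phi> x \<noteq> 0})"
    using assms by (intro compact_continuous_image continuous_on_subset[OF test_functionD(2)] test_functionD(4)) auto
  then obtain M where M: "\<And>x. x \<in> closure {x. \<phi> x \<noteq> 0} \<Longrightarrow> \<bar>\<phi> x\<bar> \<le> M"
    using compact_imp_bounded by (force simp: bounded_iff)
  have "\<bar>\<phi> x\<bar> \<le> max M 0" for x
    using M[of x] closure_subset[of "{x. \<phi> x \<noteq> 0}"] by (cases "\<phi> x = 0") auto
  then show ?thesis
    using that[of "max M 0"] by simp
qed

lemma test_function_L2:
  assumes "open \<Omega>" "\<phi> \<in> test_functions \<Omega>"
  shows "\<phi> \<in> L2 \<Omega>"
proof -
  have eq: "(\<lambda>x. indicator \<Omega> x * \<phi> x) = \<phi>"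
    using test_functionD(6)[OF assms(2)] by (auto simp: indicator_def fun_eq_iff)
  have "\<phi> \<in> borel_measurable lebesgue"
    using test_function_measurable[OF assms(2)] by (intro measurable_completion) simp
  moreover have "integrable lborel (\<lambda>x. (\<phi> x)\<^sup>2)"
    using test_function_integrable[OF test_function_mult[OF assms(2,2)]] by (simp add: power2_eq_square)
  then have "integrable lebesgue (\<lambda>x. (\<phi> x)\<^sup>2)"
    by (subst integrable_completion) auto
  moreover have "(\<lambda>x. (indicator \<Omega> x * \<phi> x)\<^sup>2) = (\<lambda>x. (\<phi> x)\<^sup>2)"
    using eq by (metis (lifting))
  ultimately show ?thesis
    using L2_lebesgue[OF assms(1)] eq by simp
qed

text \<open>By translation invariance the integral of each difference quotient vanishes.\<close>

lemma integral_partial_eq_0: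
  fixes f :: "real^'n::finite \<Rightarrow> real"
  assumes f: "f \<in> test_functions \<Omega>"
  shows "(\<integral>x. partial i f x \<partial>lborel) = 0"
proof -
  define e where "e = (axis i 1 :: real^'n)"
  have ne: "norm e = 1"
    by (simp add: e_def)
  define F where "F = (\<lambda>n x. (f (inverse (real (Suc n)) *\<^sub>R e + x) - f x) / inverse (real (Suc n)))"
  have fm: "f \<in> borel_measurable borel"
    using f by (rule test_function_measurable)
  have fi: "integrable lborel f"
    using f by (rule test_function_integrable)
  have line: "((\<lambda>s. f (s *\<^sub>R e + x)) has_real_derivative partial i f (s *\<^sub>R e + x)) (at s)" for s x
  proof -
    have "(f has_derivative frechet_derivative f (at (s *\<^sub>R e + x))) (at (s *\<^sub>R e + x))"
      using test_functionD(3)[OF f] frechet_derivative_works by blast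
    moreover have "((\<lambda>s. s *\<^sub>R e + x) has_derivative (\<lambda>h. h *\<^sub>R e)) (at s)"
      by (auto intro!: derivative_eq_intros)
    ultimately have D: "((\<lambda>s. f (s *\<^sub>R e + x)) has_derivative
        (\<lambda>h. frechet_derivative f (at (s *\<^sub>R e + x)) (h *\<^sub>R e))) (at s)"
      by (rule has_derivative_compose[rotated])
    have "linear (frechet_derivative f (at (s *\<^sub>R e + x)))"
      using test_functionD(3)[OF f] linear_frechet_derivative by blast
    then show ?thesis
      using D by (simp add: has_field_derivative_def partial_def e_def linear_cmul mult_commute_abs)
  qed
  obtain M where M: "\<And>x. \<bar>partial i f x\<bar> \<le> M" "0 \<le> M"
    using test_function_bounded[OF test_function_partial[OF f]] by blast
  obtain R where R: "\<And>x. x \<in> closure {x. f x \<noteq> 0} \<Longrightarrow> norm x \<le> R"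
    using compact_imp_bounded[OF test_functionD(4)[OF f]] unfolding bounded_iff by blast
  have supp: "f x = 0" if "norm x > R" for x
    using R[OF subsetD[OF closure_subset], of x] that by auto
  \<comment> \<open>The mean value theorem bounds the quotients by \<open>M\<close>. The shifts have
    length at most 1, so all quotients vanish outside the ball of radius \<open>R + 1\<close>, which
    makes the bound integrable.\<close>
  have bound: "\<bar>F n x\<bar> \<le> indicator (cball 0 (R + 1)) x *\<^sub>R M" for n x
  proof (cases "x \<in> cball 0 (R + 1)")
    case True
    define t where "t = inverse (real (Suc n))"
    have t: "0 < t"
      by (simp add: t_def)
    obtain z where "f (t *\<^sub>R e + x) - f (0 *\<^sub>R e + x) = (t - 0) * partial i f (z *\<^sub>R e + x)"
      using MVT2[OF t, of "\<lambda>s. f (s *\<^sub>R e + x)" "\<lambda>s. partial i f (s *\<^sub>R e + x)"] line by blast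
    then have "F n x = partial i f (z *\<^sub>R e + x)"
      unfolding F_def t_def[symmetric] using t by simp
    then show ?thesis
      using True M by simp
  next
    case False
    then have "norm x > R + 1"
      by simp
    moreover have "norm (inverse (real (Suc n)) *\<^sub>R e) \<le> 1"
      using ne by (simp add: inverse_le_1_iff)
    ultimately have "norm (inverse (real (Suc n)) *\<^sub>R e + x) > R" "norm x > R"
      using norm_triangle_ineq2[of x "- (inverse (real (Suc n)) *\<^sub>R e)"] by (simp_all add: add.commute)
    then have "f (inverse (real (Suc n)) *\<^sub>R e + x) = 0" "f x = 0"
      by (auto intro: supp)
    then show ?thesis
      using False by (simp add: F_def)
  qed
  have shift: "distr lborel lborel (\<lambda>x. c + x) = (lborel :: (real^'n) measure)" for c
    using lborel_distr_plus[of c] by (simp cong: distr_cong)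
  have "(\<integral>x. F n x \<partial>lborel) = 0" for n
  proof -
    let ?c = "inverse (real (Suc n)) *\<^sub>R e"
    have "integrable lborel (\<lambda>x. f (?c + x))"
      using integrable_distr[of "\<lambda>x. ?c + x" lborel lborel f] fi shift by simp
    moreover have "(\<integral>x. f (?c + x) \<partial>lborel) = (\<integral>x. f x \<partial>lborel)"
      using integral_distr[of "\<lambda>x. ?c + x" lborel lborel f] fm shift by simp
    ultimately show ?thesis
      using fi by (simp add: F_def)
  qed
  moreover have "(\<lambda>n. \<integral>x. F n x \<partial>lborel) \<longlonglongrightarrow> (\<integral>x. partial i f x \<partial>lborel)"
  proof (rule integral_dominated_convergence)
    show "integrable lborel (\<lambda>x. indicator (cball 0 (R + 1)) x *\<^sub>R M :: real)"
      by (rule borel_integrable_compact) auto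
    show "partial i f \<in> borel_measurable lborel"
      using test_function_measurable[OF test_function_partial[OF f]] by simp
    show "F n \<in> borel_measurable lborel" for n
    proof -
      have "(\<lambda>x. f (inverse (real (Suc n)) *\<^sub>R e + x)) \<in> borel_measurable borel"
        by (rule measurable_compose[OF _ fm]) measurable
      then show ?thesis
        unfolding F_def using fm by simp
    qed
    show "AE x in lborel. (\<lambda>n. F n x) \<longlonglongrightarrow> partial i f x"
    proof (rule AE_I2)
      fix x
      have "((\<lambda>h. (f (h *\<^sub>R e + x) - f x) / h) \<longlongrightarrow> partial i f x) (at 0)"
        using line[of x 0] by (simp add: has_field_derivative_iff)
      moreover have "filterlim (\<lambda>n. inverse (real (Suc n))) (at 0) sequentially"
        by (intro filterlim_atI LIMSEQ_inverse_real_of_nat) auto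
      ultimately show "(\<lambda>n. F n x) \<longlonglongrightarrow> partial i f x"
        unfolding F_def by (rule filterlim_compose)
    qed
    show "AE x in lborel. norm (F n x) \<le> indicator (cball 0 (R + 1)) x *\<^sub>R M" for n
      using bound by simp
  qed
  ultimately show ?thesis
    using LIMSEQ_unique[OF _ tendsto_const] by simp
qed

lemma l2_test_functions:
  assumes "open \<Omega>" "\<phi> \<in> test_functions \<Omega>" "\<psi> \<in> test_functions \<Omega>"
  shows "l2 \<Omega> \<phi> \<psi> = (\<integral>x. \<phi> x * \<psi> x \<partial>lborel)"
proof -
  have "(\<lambda>x. (indicator \<Omega> x * \<phi> x) * (indicator \<Omega> x * \<psi> x)) = (\<lambda>x. \<phi> x * \<psi> x)"
    using test_functionD(6)[OF assms(2)] by (auto simp: indicator_def fun_eq_iff)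
  moreover have "(\<lambda>x. \<phi> x * \<psi> x) \<in> borel_measurable lborel"
    using test_function_measurable[OF test_function_mult[OF assms(2,3)]] by simp
  ultimately show ?thesis
    by (simp add: l2_lebesgue[OF assms(1)] integral_completion)
qed

text \<open>Integration by parts: the product of two test functions is a test function, so the
  integral of its partial derivative vanishes. This puts test functions into \<open>H1\<close>, as
  the approximations in \<open>H10\<close> require.\<close>

lemma is_weak_partial_test_function:
  assumes \<Omega>: "open \<Omega>" and \<phi>: "\<phi> \<in> test_functions \<Omega>"
  shows "is_weak_partial \<Omega> i \<phi> (partial i \<phi>)"
  unfolding is_weak_partial_def
proof (intro conjI ballI)
  show "partial i \<phi> \<in> L2 \<Omega>"
    using test_function_L2[OF \<Omega> test_function_partial[OF \<phi>]] .
  fix \<psi> assume \<psi>: "\<psi> \<in> test_functions \<Omega>"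
  have "0 = (\<integral>x. \<phi> x * partial i \<psi> x + partial i \<phi> x * \<psi> x \<partial>lborel)"
    using integral_partial_eq_0[OF test_function_mult[OF \<phi> \<psi>]]
      partial_mult[OF test_functionD(3)[OF \<phi>] test_functionD(3)[OF \<psi>]] by simp
  also have "\<dots> = (\<integral>x. \<phi> x * partial i \<psi> x \<partial>lborel) + (\<integral>x. partial i \<phi> x * \<psi> x \<partial>lborel)"
    by (intro Bochner_Integration.integral_add test_function_integrable[of _ \<Omega>] test_function_mult
        test_function_partial \<phi> \<psi>)
  finally show "l2 \<Omega> \<phi> (partial i \<psi>) = - l2 \<Omega> (partial i \<phi>) \<psi>"
    using l2_test_functions[OF \<Omega> \<phi> test_function_partial[OF \<psi>]]
      l2_test_functions[OF \<Omega> test_function_partial[OF \<phi>] \<psi>] by simp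
qed

lemma l2_commute: "l2 \<Omega> u v = l2 \<Omega> v u"
  by (simp add: l2_def mult.commute)

lemma l2_linear: "u \<in> L2 \<Omega> \<Longrightarrow> fun_linear (L2 \<Omega>) (l2 \<Omega> u)"
  unfolding fun_linear_def l2_def
  by (auto simp: distrib_left mult.left_commute integrable_L2_mult)

lemma l2_add_right: "\<lbrakk>u \<in> L2 \<Omega>; v \<in> L2 \<Omega>; w \<in> L2 \<Omega>\<rbrakk> \<Longrightarrow> l2 \<Omega> u (\<lambda>x. v x + w x) = l2 \<Omega> u v + l2 \<Omega> u w"
  and l2_scale_right: "\<lbrakk>u \<in> L2 \<Omega>; v \<in> L2 \<Omega>\<rbrakk> \<Longrightarrow> l2 \<Omega> u (\<lambda>x. c * v x) = c * l2 \<Omega> u v"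
  using l2_linear[of u \<Omega>] by (auto simp: fun_linear_def)

lemma l2_add_left: "\<lbrakk>u \<in> L2 \<Omega>; v \<in> L2 \<Omega>; w \<in> L2 \<Omega>\<rbrakk> \<Longrightarrow> l2 \<Omega> (\<lambda>x. v x + w x) u = l2 \<Omega> v u + l2 \<Omega> w u"
  and l2_scale_left: "\<lbrakk>u \<in> L2 \<Omega>; v \<in> L2 \<Omega>\<rbrakk> \<Longrightarrow> l2 \<Omega> (\<lambda>x. c * v x) u = c * l2 \<Omega> v u"
  by (simp_all add: l2_commute[of _ _ u] l2_add_right l2_scale_right)

lemma l2_nonneg: "0 \<le> l2 \<Omega> u u"
  by (auto simp: l2_def)

lemma l2_cong_AE:
  assumes "u \<in> L2 \<Omega>" "u' \<in> L2 \<Omega>" "v \<in> L2 \<Omega>" "v' \<in> L2 \<Omega>"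
    and "AE x in lebesgue_on \<Omega>. u x = u' x" "AE x in lebesgue_on \<Omega>. v x = v' x"
  shows "l2 \<Omega> u v = l2 \<Omega> u' v'"
  unfolding l2_def
proof (rule integral_cong_AE)
  show "AE x in lebesgue_on \<Omega>. u x * v x = u' x * v' x"
    using assms(5,6) by eventually_elim simp
qed (use assms in \<open>auto simp: L2_def\<close>)

lemma l2_parallelogram_le:
  assumes "u \<in> L2 \<Omega>" "v \<in> L2 \<Omega>"
  shows "l2 \<Omega> (\<lambda>x. u x + v x) (\<lambda>x. u x + v x) \<le> 2 * l2 \<Omega> u u + 2 * l2 \<Omega> v v"
proof -
  have "0 \<le> l2 \<Omega> (\<lambda>x. u x + - 1 * v x) (\<lambda>x. u x + - 1 * v x)"
    by (rule l2_nonneg)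
  also have "\<dots> = l2 \<Omega> u u - 2 * l2 \<Omega> u v + l2 \<Omega> v v"
    using assms l2_commute[of \<Omega> v u]
    by (simp only: l2_add_left l2_add_right l2_scale_left l2_scale_right L2_add L2_scale)
  finally show ?thesis
    using assms l2_commute[of \<Omega> v u]
    by (simp only: l2_add_left l2_add_right L2_add)
qed

text \<open>This gives \<open>weak_partial\<close> a meaning: under an integral the chosen
  representative may be replaced by any other candidate. The difference of two candidates is
  annihilated by all test functions, and the fundamental lemma applies.\<close>

lemma is_weak_partial_unique:
  assumes \<Omega>: "open \<Omega>" and g: "is_weak_partial \<Omega> i u g" and g': "is_weak_partial \<Omega> i u g'"
  shows "AE x in lebesgue_on \<Omega>. g x = g' x"
proof -
  have L2: "g \<in> L2 \<Omega>" "(\<lambda>x. - 1 * g' x) \<in> L2 \<Omega>" "g' \<in> L2 \<Omega>"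
    using g g' L2_scale[of g' \<Omega> "-1"] by (auto simp: is_weak_partial_def)
  have "l2 \<Omega> (\<lambda>x. g x + - 1 * g' x) \<phi> = 0" if \<phi>: "\<phi> \<in> test_functions \<Omega>" for \<phi>
  proof -
    have "l2 \<Omega> (\<lambda>x. g x + - 1 * g' x) \<phi> = l2 \<Omega> g \<phi> + - 1 * l2 \<Omega> g' \<phi>"
      using L2 test_function_L2[OF \<Omega> \<phi>] by (simp only: l2_add_left l2_scale_left)
    moreover have "l2 \<Omega> g \<phi> = l2 \<Omega> g' \<phi>"
      using g g' \<phi> by (simp add: is_weak_partial_def)
    ultimately show ?thesis
      by simp
  qed
  then have "AE x in lebesgue_on \<Omega>. x \<in> \<Omega> \<longrightarrow> g x + - 1 * g' x = 0"
    using AE_zero_if_l2_test_functions_zero[OF \<Omega> \<Omega> subset_refl L2_add[OF L2(1,2)]] by blast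
  moreover have "AE x in lebesgue_on \<Omega>. x \<in> \<Omega>"
    using \<Omega> AE_space[of "lebesgue_on \<Omega>"] by (simp add: space_restrict_space)
  ultimately show ?thesis
    by eventually_elim simp
qed

lemma is_weak_partial_add:
  assumes \<Omega>: "open \<Omega>" and u: "u \<in> L2 \<Omega>" "is_weak_partial \<Omega> i u g"
    and v: "v \<in> L2 \<Omega>" "is_weak_partial \<Omega> i v h"
  shows "is_weak_partial \<Omega> i (\<lambda>x. u x + v x) (\<lambda>x. g x + h x)"
  using assms test_function_L2[OF \<Omega>] test_function_partial[of _ \<Omega> i]
  by (auto simp: is_weak_partial_def L2_add l2_add_left)

lemma is_weak_partial_scale:
  assumes \<Omega>: "open \<Omega>" and u: "u \<in> L2 \<Omega>" "is_weak_partial \<Omega> i u g"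
  shows "is_weak_partial \<Omega> i (\<lambda>x. c * u x) (\<lambda>x. c * g x)"
  using assms test_function_L2[OF \<Omega>] test_function_partial[of _ \<Omega> i]
  by (auto simp: is_weak_partial_def L2_scale l2_scale_left)

lemma weak_partial: "u \<in> H1 \<Omega> \<Longrightarrow> is_weak_partial \<Omega> i u (weak_partial \<Omega> i u)"
  unfolding weak_partial_def H1_def using someI_ex[of "is_weak_partial \<Omega> i u"] by blast

lemma H1_L2: "u \<in> H1 \<Omega> \<Longrightarrow> u \<in> L2 \<Omega>"
  by (simp add: H1_def)

lemma weak_partial_L2: "u \<in> H1 \<Omega> \<Longrightarrow> weak_partial \<Omega> i u \<in> L2 \<Omega>"
  using weak_partial is_weak_partial_def by blast

lemma test_function_H1:
  assumes "open \<Omega>" "\<phi> \<in> test_functions \<Omega>"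
  shows "\<phi> \<in> H1 \<Omega>"
  using test_function_L2[OF assms] is_weak_partial_test_function[OF assms] by (auto simp: H1_def)

lemma H1_subspace:
  assumes \<Omega>: "open \<Omega>"
  shows "fun_subspace (H1 \<Omega>)"
  unfolding fun_subspace_def
proof (intro conjI ballI allI)
  show "(\<lambda>x. 0) \<in> H1 \<Omega>"
    by (rule test_function_H1[OF \<Omega> test_function_zero])
  show "(\<lambda>x. u x + v x) \<in> H1 \<Omega>" if "u \<in> H1 \<Omega>" "v \<in> H1 \<Omega>" for u v
    using is_weak_partial_add[OF \<Omega> H1_L2[OF that(1)] weak_partial[OF that(1)] H1_L2[OF that(2)] weak_partial[OF that(2)]]
      L2_add[OF that[THEN H1_L2]]
    unfolding H1_def by blast
  show "(\<lambda>x. c * u x) \<in> H1 \<Omega>" if "u \<in> H1 \<Omega>" for c u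
    using is_weak_partial_scale[OF \<Omega> H1_L2[OF that] weak_partial[OF that]] L2_scale[OF H1_L2[OF that]]
    unfolding H1_def by blast
qed

lemma weak_partial_add_AE:
  assumes \<Omega>: "open \<Omega>" and "u \<in> H1 \<Omega>" "v \<in> H1 \<Omega>"
  shows "AE x in lebesgue_on \<Omega>. weak_partial \<Omega> i (\<lambda>x. u x + v x) x = weak_partial \<Omega> i u x + weak_partial \<Omega> i v x"
  using assms H1_subspace[OF \<Omega>]
  by (intro is_weak_partial_unique[OF \<Omega> weak_partial is_weak_partial_add] fun_subspace_add)
    (auto intro: H1_L2 weak_partial)

lemma weak_partial_scale_AE:
  assumes \<Omega>: "open \<Omega>" and "u \<in> H1 \<Omega>"
  shows "AE x in lebesgue_on \<Omega>. weak_partial \<Omega> i (\<lambda>x. c * u x) x = c * weak_partial \<Omega> i u x"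
  using assms H1_subspace[OF \<Omega>]
  by (intro is_weak_partial_unique[OF \<Omega> weak_partial is_weak_partial_scale] fun_subspace_scale)
    (auto intro: H1_L2 weak_partial)

text \<open>The chosen representatives of the derivatives add up only outside a null set, which the
  integral does not see.\<close>

lemma l2_weak_partial_add:
  assumes "open \<Omega>" "u \<in> H1 \<Omega>" "v \<in> H1 \<Omega>" "g \<in> L2 \<Omega>"
  shows "l2 \<Omega> g (weak_partial \<Omega> i (\<lambda>x. u x + v x)) = l2 \<Omega> g (weak_partial \<Omega> i u) + l2 \<Omega> g (weak_partial \<Omega> i v)"
proof -
  have "l2 \<Omega> g (weak_partial \<Omega> i (\<lambda>x. u x + v x)) = l2 \<Omega> g (\<lambda>x. weak_partial \<Omega> i u x + weak_partial \<Omega> i v x)"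
    using assms by (intro l2_cong_AE L2_add weak_partial_L2 weak_partial_add_AE fun_subspace_add[OF H1_subspace]) auto
  then show ?thesis
    using assms by (simp add: l2_add_right weak_partial_L2)
qed

lemma l2_weak_partial_scale:
  assumes "open \<Omega>" "u \<in> H1 \<Omega>" "g \<in> L2 \<Omega>"
  shows "l2 \<Omega> g (weak_partial \<Omega> i (\<lambda>x. c * u x)) = c * l2 \<Omega> g (weak_partial \<Omega> i u)"
proof -
  have "l2 \<Omega> g (weak_partial \<Omega> i (\<lambda>x. c * u x)) = l2 \<Omega> g (\<lambda>x. c * weak_partial \<Omega> i u x)"
    using assms by (intro l2_cong_AE L2_scale weak_partial_L2 weak_partial_scale_AE fun_subspace_scale[OF H1_subspace]) auto
  then show ?thesis
    using assms by (simp add: l2_scale_right weak_partial_L2)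
qed

lemma bilin_l2:
  "bilin \<Omega> \<Theta> u v = (\<Sum>i\<in>UNIV. \<Sum>j\<in>UNIV. \<Theta> $ i $ j * l2 \<Omega> (weak_partial \<Omega> j u) (weak_partial \<Omega> i v))"
  by (simp add: bilin_def l2_def mult.assoc)

lemma bilin_linear:
  assumes "open \<Omega>" "u \<in> H1 \<Omega>"
  shows "fun_linear (H1 \<Omega>) (bilin \<Omega> \<Theta> u)"
  using assms weak_partial_L2[OF assms(2)] unfolding fun_linear_def bilin_l2
  by (simp add: l2_weak_partial_add l2_weak_partial_scale distrib_left sum.distrib sum_distrib_left mult.left_commute)

lemma bilin_sym:
  assumes "transpose \<Theta> = \<Theta>"
  shows "bilin \<Omega> \<Theta> u v = bilin \<Omega> \<Theta> v u"
proof -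
  have "\<Theta> $ i $ j = \<Theta> $ j $ i" for i j
    using assms by (metis transpose_def vec_lambda_beta)
  then show ?thesis
    unfolding bilin_l2 by (subst sum.swap) (simp add: l2_commute[of \<Omega> "weak_partial \<Omega> _ u"])
qed

lemma H1_norm_sqr: "(H1_norm \<Omega> u)\<^sup>2 = l2 \<Omega> u u + (\<Sum>i\<in>UNIV. l2 \<Omega> (weak_partial \<Omega> i u) (weak_partial \<Omega> i u))"
  unfolding H1_norm_def by (intro real_sqrt_pow2 add_nonneg_nonneg sum_nonneg l2_nonneg)

text \<open>A substitute for the triangle inequality: it serves to show that a sum of approximation
  errors tends to zero, where the factor 2 does no harm.\<close>

lemma H1_norm_add_le:
  assumes \<Omega>: "open \<Omega>" and u: "u \<in> H1 \<Omega>" and v: "v \<in> H1 \<Omega>"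
  shows "(H1_norm \<Omega> (\<lambda>x. u x + v x))\<^sup>2 \<le> 2 * (H1_norm \<Omega> u)\<^sup>2 + 2 * (H1_norm \<Omega> v)\<^sup>2"
proof -
  let ?w = "\<lambda>i. weak_partial \<Omega> i"
  have "l2 \<Omega> (?w i (\<lambda>x. u x + v x)) (?w i (\<lambda>x. u x + v x)) \<le> 2 * l2 \<Omega> (?w i u) (?w i u) + 2 * l2 \<Omega> (?w i v) (?w i v)" for i
  proof -
    have "l2 \<Omega> (?w i (\<lambda>x. u x + v x)) (?w i (\<lambda>x. u x + v x)) =
        l2 \<Omega> (\<lambda>x. ?w i u x + ?w i v x) (\<lambda>x. ?w i u x + ?w i v x)"
      using assms by (intro l2_cong_AE L2_add weak_partial_L2 weak_partial_add_AE fun_subspace_add[OF H1_subspace]) auto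
    then show ?thesis
      using l2_parallelogram_le[OF weak_partial_L2[OF u] weak_partial_L2[OF v]] by simp
  qed
  then have "(\<Sum>i\<in>UNIV. l2 \<Omega> (?w i (\<lambda>x. u x + v x)) (?w i (\<lambda>x. u x + v x))) \<le>
      (\<Sum>i\<in>UNIV. 2 * l2 \<Omega> (?w i u) (?w i u) + 2 * l2 \<Omega> (?w i v) (?w i v))"
    by (intro sum_mono)
  then show ?thesis
    using l2_parallelogram_le[OF H1_L2[OF u] H1_L2[OF v]]
    by (simp add: H1_norm_sqr sum.distrib sum_distrib_left)
qed

lemma H1_norm_scale:
  assumes \<Omega>: "open \<Omega>" and u: "u \<in> H1 \<Omega>"
  shows "(H1_norm \<Omega> (\<lambda>x. c * u x))\<^sup>2 = c\<^sup>2 * (H1_norm \<Omega> u)\<^sup>2"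
proof -
  have cu: "(\<lambda>x. c * u x) \<in> H1 \<Omega>"
    using fun_subspace_scale[OF H1_subspace[OF \<Omega>] u] .
  have "l2 \<Omega> (weak_partial \<Omega> i (\<lambda>x. c * u x)) (weak_partial \<Omega> i (\<lambda>x. c * u x)) =
      c\<^sup>2 * l2 \<Omega> (weak_partial \<Omega> i u) (weak_partial \<Omega> i u)" for i
    using l2_weak_partial_scale[OF \<Omega> u weak_partial_L2[OF cu, of i], of i c]
      l2_weak_partial_scale[OF \<Omega> u weak_partial_L2[OF u, of i], of i c]
      l2_commute[of \<Omega> "weak_partial \<Omega> i (\<lambda>x. c * u x)" "weak_partial \<Omega> i u"]
    by (simp add: power2_eq_square)
  moreover have "l2 \<Omega> (\<lambda>x. c * u x) (\<lambda>x. c * u x) = c\<^sup>2 * l2 \<Omega> u u"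
    using H1_L2[OF u] by (simp add: l2_scale_left l2_scale_right L2_scale power2_eq_square)
  ultimately show ?thesis
    by (simp add: H1_norm_sqr distrib_left sum_distrib_left)
qed

lemma H10I:
  assumes "u \<in> H1 \<Omega>" "\<And>n. \<phi> n \<in> test_functions \<Omega>"
    and "(\<lambda>n. (H1_norm \<Omega> (\<lambda>x. u x - \<phi> n x))\<^sup>2) \<longlonglongrightarrow> 0"
  shows "u \<in> H10 \<Omega>"
proof -
  have "0 \<le> H1_norm \<Omega> v" for v
    by (simp add: H1_norm_def sum_nonneg l2_nonneg add_nonneg_nonneg)
  then have "(\<lambda>n. H1_norm \<Omega> (\<lambda>x. u x - \<phi> n x)) \<longlonglongrightarrow> 0"
    using tendsto_real_sqrt[OF assms(3)] by simp
  then show ?thesis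
    unfolding H10_def using assms(1,2) by (intro CollectI conjI exI[of _ \<phi>]) auto
qed

lemma H10E:
  assumes "open \<Omega>" "u \<in> H10 \<Omega>"
  obtains \<phi> where "\<And>n::nat. \<phi> n \<in> test_functions \<Omega>" "\<And>n. (\<lambda>x. u x - \<phi> n x) \<in> H1 \<Omega>"
    "(\<lambda>n. (H1_norm \<Omega> (\<lambda>x. u x - \<phi> n x))\<^sup>2) \<longlonglongrightarrow> 0"
proof -
  obtain \<phi> where \<phi>: "\<And>n::nat. \<phi> n \<in> test_functions \<Omega>" "(\<lambda>n. H1_norm \<Omega> (\<lambda>x. u x - \<phi> n x)) \<longlonglongrightarrow> 0"
    and u: "u \<in> H1 \<Omega>"
    using assms(2) unfolding H10_def by blast
  show ?thesis
    using that[of \<phi>] \<phi>(1) fun_subspace_diff[OF H1_subspace[OF assms(1)] u test_function_H1[OF assms(1) \<phi>(1)]]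
      tendsto_power[OF \<phi>(2), of 2] by simp
qed

lemma H10_subspace:
  assumes \<Omega>: "open \<Omega>"
  shows "fun_subspace (H10 \<Omega>)"
  unfolding fun_subspace_def
proof (intro conjI ballI allI)
  note H1 = H1_subspace[OF \<Omega>]
  have H1I: "u \<in> H1 \<Omega>" if "u \<in> H10 \<Omega>" for u
    using that by (simp add: H10_def)
  show "(\<lambda>x. 0) \<in> H10 \<Omega>"
  proof (rule H10I)
    have "(H1_norm \<Omega> (\<lambda>x. 0))\<^sup>2 = 0"
      using H1_norm_scale[OF \<Omega> fun_subspace_0[OF H1], of 0] by simp
    then show "(\<lambda>n. (H1_norm \<Omega> (\<lambda>x. 0 - 0))\<^sup>2) \<longlonglongrightarrow> 0"
      by simp
  qed (rule fun_subspace_0[OF H1] test_function_zero)+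
  show "(\<lambda>x. u x + v x) \<in> H10 \<Omega>" if u: "u \<in> H10 \<Omega>" and v: "v \<in> H10 \<Omega>" for u v
  proof -
    obtain \<phi> where \<phi>: "\<And>n::nat. \<phi> n \<in> test_functions \<Omega>" "\<And>n. (\<lambda>x. u x - \<phi> n x) \<in> H1 \<Omega>"
      "(\<lambda>n. (H1_norm \<Omega> (\<lambda>x. u x - \<phi> n x))\<^sup>2) \<longlonglongrightarrow> 0"
      using H10E[OF \<Omega> u] by blast
    obtain \<psi> where \<psi>: "\<And>n::nat. \<psi> n \<in> test_functions \<Omega>" "\<And>n. (\<lambda>x. v x - \<psi> n x) \<in> H1 \<Omega>"
      "(\<lambda>n. (H1_norm \<Omega> (\<lambda>x. v x - \<psi> n x))\<^sup>2) \<longlonglongrightarrow> 0"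
      using H10E[OF \<Omega> v] by blast
    have eq: "(\<lambda>x. (u x - \<phi> n x) + (v x - \<psi> n x)) = (\<lambda>x. u x + v x - (\<phi> n x + \<psi> n x))" for n
      by (auto simp: algebra_simps)
    define b where "b = (\<lambda>n. 2 * (H1_norm \<Omega> (\<lambda>x. u x - \<phi> n x))\<^sup>2 + 2 * (H1_norm \<Omega> (\<lambda>x. v x - \<psi> n x))\<^sup>2)"
    have "b \<longlonglongrightarrow> 2 * 0 + 2 * 0"
      unfolding b_def by (intro tendsto_intros \<phi>(3) \<psi>(3))
    then have b: "b \<longlonglongrightarrow> 0"
      by simp
    have le: "(H1_norm \<Omega> (\<lambda>x. u x + v x - (\<phi> n x + \<psi> n x)))\<^sup>2 \<le> b n" for n
      using H1_norm_add_le[OF \<Omega> \<phi>(2)[of n] \<psi>(2)[of n]] by (simp add: eq b_def)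
    show ?thesis
    proof (rule H10I)
      show "(\<lambda>x. u x + v x) \<in> H1 \<Omega>"
        using fun_subspace_add[OF H1 H1I[OF u] H1I[OF v]] .
      show "(\<lambda>x. \<phi> n x + \<psi> n x) \<in> test_functions \<Omega>" for n
        using test_function_add[OF \<phi>(1) \<psi>(1)] .
      show "(\<lambda>n. (H1_norm \<Omega> (\<lambda>x. u x + v x - (\<phi> n x + \<psi> n x)))\<^sup>2) \<longlonglongrightarrow> 0"
        by (rule tendsto_sandwich[OF _ _ tendsto_const b]) (use le in auto)
    qed
  qed
  show "(\<lambda>x. c * u x) \<in> H10 \<Omega>" if u: "u \<in> H10 \<Omega>" for c u
  proof -
    obtain \<phi> where \<phi>: "\<And>n::nat. \<phi> n \<in> test_functions \<Omega>" "\<And>n. (\<lambda>x. u x - \<phi> n x) \<in> H1 \<Omega>"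
      "(\<lambda>n. (H1_norm \<Omega> (\<lambda>x. u x - \<phi> n x))\<^sup>2) \<longlonglongrightarrow> 0"
      using H10E[OF \<Omega> u] by blast
    show ?thesis
    proof (rule H10I)
      show "(\<lambda>x. c * u x) \<in> H1 \<Omega>"
        using fun_subspace_scale[OF H1 H1I[OF u]] .
      show "(\<lambda>x. c * \<phi> n x) \<in> test_functions \<Omega>" for n
        using test_function_scale[OF \<phi>(1)] .
      have "(H1_norm \<Omega> (\<lambda>x. c * u x - c * \<phi> n x))\<^sup>2 = c\<^sup>2 * (H1_norm \<Omega> (\<lambda>x. u x - \<phi> n x))\<^sup>2" for n
        using H1_norm_scale[OF \<Omega> \<phi>(2)] by (simp add: right_diff_distrib)
      then show "(\<lambda>n. (H1_norm \<Omega> (\<lambda>x. c * u x - c * \<phi> n x))\<^sup>2) \<longlonglongrightarrow> 0"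
        using tendsto_mult_left[OF \<phi>(3), of "c\<^sup>2"] by simp
    qed
  qed
qed

text \<open>Locality: a test function supported in \<open>U\<close> is also one on \<Omega>, and its
  partial derivative is supported in \<open>U\<close>, where \<open>u\<close> vanishes.\<close>

lemma weak_partial_zero_on_open:
  assumes \<Omega>: "open \<Omega>" and U: "open U" "U \<subseteq> \<Omega>" and u: "u \<in> H1 \<Omega>" and zero: "\<And>x. x \<in> U \<Longrightarrow> u x = 0"
  shows "AE x in lebesgue_on \<Omega>. x \<in> U \<longrightarrow> weak_partial \<Omega> i u x = 0"
proof (rule AE_zero_if_l2_test_functions_zero[OF \<Omega> U weak_partial_L2[OF u]])
  fix \<phi> assume \<phi>: "\<phi> \<in> test_functions U"
  then have "\<phi> \<in> test_functions \<Omega>"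
    using U(2) by (auto simp: test_functions_def)
  then have "l2 \<Omega> (weak_partial \<Omega> i u) \<phi> = - l2 \<Omega> u (partial i \<phi>)"
    using weak_partial[OF u] by (simp add: is_weak_partial_def)
  also have "(\<lambda>x. u x * partial i \<phi> x) = (\<lambda>x. 0)"
    using zero test_functionD(6)[OF test_function_partial[OF \<phi>]] by (auto simp: fun_eq_iff)
  then have "l2 \<Omega> u (partial i \<phi>) = 0"
    by (simp add: l2_def)
  finally show "l2 \<Omega> (weak_partial \<Omega> i u) \<phi> = 0"
    by simp
qed

subsection \<open>Finite element spaces\<close>

lemma fe_space_affine:
  assumes "v \<in> fe_space \<Omega> \<T>" "\<tau> \<in> \<T>"
  obtains b c where "\<And>x. \<lbrakk>x \<in> \<tau>; x \<in> \<Omega>\<rbrakk> \<Longrightarrow> v x = b \<bullet> x + c"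
proof -
  have "\<exists>b c. \<forall>x\<in>\<tau> \<inter> \<Omega>. v x = b \<bullet> x + c"
    using assms by (simp add: fe_space_def)
  then show ?thesis
    using that by (metis IntI)
qed

lemma fe_space_subspace:
  assumes \<Omega>: "open \<Omega>"
  shows "fun_subspace (fe_space \<Omega> \<T>)"
  unfolding fun_subspace_def
proof (intro conjI ballI allI)
  note H10 = H10_subspace[OF \<Omega>]
  have "\<exists>b c. \<forall>x\<in>\<tau> \<inter> \<Omega>. 0 = b \<bullet> x + c" for \<tau>
    by (intro exI[of _ 0]) simp
  then show "(\<lambda>x. 0) \<in> fe_space \<Omega> \<T>"
    unfolding fe_space_def using fun_subspace_0[OF H10] by simp
  show "(\<lambda>x. u x + v x) \<in> fe_space \<Omega> \<T>" if u: "u \<in> fe_space \<Omega> \<T>" and v: "v \<in> fe_space \<Omega> \<T>" for u v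
  proof -
    have "\<exists>b c. \<forall>x\<in>\<tau> \<inter> \<Omega>. u x + v x = b \<bullet> x + c" if \<tau>: "\<tau> \<in> \<T>" for \<tau>
    proof -
      obtain b c where u': "\<And>x. \<lbrakk>x \<in> \<tau>; x \<in> \<Omega>\<rbrakk> \<Longrightarrow> u x = b \<bullet> x + c"
        using fe_space_affine[OF u \<tau>] by blast
      obtain b' c' where v': "\<And>x. \<lbrakk>x \<in> \<tau>; x \<in> \<Omega>\<rbrakk> \<Longrightarrow> v x = b' \<bullet> x + c'"
        using fe_space_affine[OF v \<tau>] by blast
      have "\<forall>x\<in>\<tau> \<inter> \<Omega>. u x + v x = (b + b') \<bullet> x + (c + c')"
        by (simp add: inner_add_left u' v')
      then show ?thesis
        by (intro exI)
    qed
    then show ?thesis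
      using u v fun_subspace_add[OF H10, of u v] by (simp add: fe_space_def continuous_on_add)
  qed
  show "(\<lambda>x. t * u x) \<in> fe_space \<Omega> \<T>" if u: "u \<in> fe_space \<Omega> \<T>" for t u
  proof -
    have "\<exists>b c. \<forall>x\<in>\<tau> \<inter> \<Omega>. t * u x = b \<bullet> x + c" if \<tau>: "\<tau> \<in> \<T>" for \<tau>
    proof -
      obtain b c where u': "\<And>x. \<lbrakk>x \<in> \<tau>; x \<in> \<Omega>\<rbrakk> \<Longrightarrow> u x = b \<bullet> x + c"
        using fe_space_affine[OF u \<tau>] by blast
      have "\<forall>x\<in>\<tau> \<inter> \<Omega>. t * u x = (t *\<^sub>R b) \<bullet> x + t * c"
        by (simp add: distrib_left u')
      then show ?thesis
        by (intro exI)
    qed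
    then show ?thesis
      using u fun_subspace_scale[OF H10, of u t] by (simp add: fe_space_def continuous_on_mult_left)
  qed
qed

lemma fe_space_H1: "v \<in> fe_space \<Omega> \<T> \<Longrightarrow> v \<in> H1 \<Omega>"
  by (simp add: fe_space_def H10_def)

lemma fe_space_mono:
  assumes "\<And>\<tau>. \<tau> \<in> \<T>' \<Longrightarrow> \<exists>\<sigma>\<in>\<T>. \<tau> \<subseteq> \<sigma>"
  shows "fe_space \<Omega> \<T> \<subseteq> fe_space \<Omega> \<T>'"
proof
  fix v assume v: "v \<in> fe_space \<Omega> \<T>"
  have "\<exists>b c. \<forall>x\<in>\<tau> \<inter> \<Omega>. v x = b \<bullet> x + c" if \<tau>: "\<tau> \<in> \<T>'" for \<tau>
  proof -
    obtain \<sigma> where \<sigma>: "\<sigma> \<in> \<T>" "\<tau> \<subseteq> \<sigma>"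
      using assms[OF \<tau>] by blast
    obtain b c where "\<And>x. \<lbrakk>x \<in> \<sigma>; x \<in> \<Omega>\<rbrakk> \<Longrightarrow> v x = b \<bullet> x + c"
      using fe_space_affine[OF v \<sigma>(1)] by blast
    then have "\<forall>x\<in>\<tau> \<inter> \<Omega>. v x = b \<bullet> x + c"
      using \<sigma>(2) by auto
    then show ?thesis
      by (intro exI)
  qed
  then show "v \<in> fe_space \<Omega> \<T>'"
    using v by (simp add: fe_space_def)
qed

text \<open>A function in the space is the sum over the elements \<open>\<tau>\<close> of an affine function cut off to the
  points of \<open>\<Omega>\<close> that are assigned to \<open>\<tau>\<close>; on the overlaps of the elements the assignment is arbitrary.\<close>

lemma fe_space_spanned:
  fixes \<T> :: "(real^'n::finite) set set"
  assumes fin: "finite \<T>" and cover: "\<Omega> \<subseteq> \<Union>\<T>"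
  obtains I :: "((real^'n) set \<times> 'n option) set" and \<phi>
  where "finite I" "spanned_by (fe_space \<Omega> \<T>) I \<phi>"
proof -
  define cell where "cell = (\<lambda>x. SOME \<tau>. \<tau> \<in> \<T> \<and> x \<in> \<tau>)"
  have cell: "cell x \<in> \<T>" "x \<in> cell x" if "x \<in> \<Omega>" for x
  proof -
    have "\<exists>\<tau>. \<tau> \<in> \<T> \<and> x \<in> \<tau>"
      using cover that by blast
    from someI_ex[OF this] show "cell x \<in> \<T>" "x \<in> cell x"
      by (simp_all add: cell_def)
  qed
  \<comment> \<open>\<open>None\<close> stands for the constant and \<open>Some j\<close> for the
    coordinate \<open>j\<close>, so each element contributes \<open>CARD('n) + 1\<close>
    functions.\<close>
  define \<phi> where "\<phi> = (\<lambda>(\<tau>, i) x. if x \<in> \<Omega> \<and> cell x = \<tau> then case i of None \<Rightarrow> 1 | Some j \<Rightarrow> x $ j else 0 :: real)"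
  have "\<exists>c. v = (\<lambda>x. \<Sum>i\<in>\<T> \<times> UNIV. c i * \<phi> i x)" if v: "v \<in> fe_space \<Omega> \<T>" for v
  proof -
    have "\<forall>\<tau>\<in>\<T>. \<exists>b c. \<forall>x\<in>\<tau> \<inter> \<Omega>. v x = b \<bullet> x + c"
      using v by (simp add: fe_space_def)
    then obtain b where "\<forall>\<tau>\<in>\<T>. \<exists>c. \<forall>x\<in>\<tau> \<inter> \<Omega>. v x = b \<tau> \<bullet> x + c"
      by (rule bchoice[THEN exE])
    then obtain c where "\<forall>\<tau>\<in>\<T>. \<forall>x\<in>\<tau> \<inter> \<Omega>. v x = b \<tau> \<bullet> x + c \<tau>"
      by (rule bchoice[THEN exE])
    then have bc: "\<And>\<tau> x. \<lbrakk>\<tau> \<in> \<T>; x \<in> \<tau>; x \<in> \<Omega>\<rbrakk> \<Longrightarrow> v x = b \<tau> \<bullet> x + c \<tau>"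
      by simp
    define d where "d = (\<lambda>(\<tau>, i). case i of None \<Rightarrow> c \<tau> | Some j \<Rightarrow> b \<tau> $ j)"
    have "v x = (\<Sum>i\<in>\<T> \<times> UNIV. d i * \<phi> i x)" for x
    proof (cases "x \<in> \<Omega>")
      case True
      have inner: "(\<Sum>i\<in>UNIV. d (\<tau>, i) * \<phi> (\<tau>, i) x) = (if cell x = \<tau> then b \<tau> \<bullet> x + c \<tau> else 0)" for \<tau>
        using True by (simp add: d_def \<phi>_def UNIV_option_conv sum.reindex inner_vec_def)
      have "(\<Sum>i\<in>\<T> \<times> UNIV. d i * \<phi> i x) = (\<Sum>\<tau>\<in>\<T>. \<Sum>i\<in>UNIV. d (\<tau>, i) * \<phi> (\<tau>, i) x)"
        by (simp add: sum.cartesian_product)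
      also have "\<dots> = b (cell x) \<bullet> x + c (cell x)"
        using fin cell(1)[OF True] by (simp add: inner)
      also have "\<dots> = v x"
        using bc[of "cell x" x] cell[OF True] True by simp
      finally show ?thesis
        by simp
    next
      case False
      then have "\<phi> i x = 0" for i
        by (cases i) (simp add: \<phi>_def)
      then show ?thesis
        using v False by (simp add: fe_space_def)
    qed
    then show ?thesis
      by blast
  qed
  then have "spanned_by (fe_space \<Omega> \<T>) (\<T> \<times> UNIV) \<phi>"
    by (simp add: spanned_by_def)
  then show ?thesis
    using that[of "\<T> \<times> UNIV" \<phi>] fin by simp
qed

text \<open>Definiteness comes from continuity: the set where \<open>u\<close> is nonzero is open,
  and a nonempty open set is not negligible. Because of the extension by zero, a function that is
  not identically zero is nonzero somewhere in \<Omega>.\<close>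

lemma l2_inner_form:
  assumes \<Omega>: "open \<Omega>"
  shows "inner_form (fe_space \<Omega> \<T>) (l2 \<Omega>)"
proof
  show "fun_subspace (fe_space \<Omega> \<T>)"
    by (rule fe_space_subspace[OF \<Omega>])
  show "fun_linear (fe_space \<Omega> \<T>) (l2 \<Omega> u)" if "u \<in> fe_space \<Omega> \<T>" for u
    using l2_linear[OF H1_L2[OF fe_space_H1[OF that]]] by (rule fun_linear_subset) (auto intro: H1_L2 fe_space_H1)
  show "l2 \<Omega> u v = l2 \<Omega> v u" for u v
    by (rule l2_commute)
  show "0 < l2 \<Omega> u u" if u: "u \<in> fe_space \<Omega> \<T>" and nz: "u \<noteq> (\<lambda>x. 0)" for u
  proof (rule ccontr)
    assume "\<not> 0 < l2 \<Omega> u u"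
    then have "l2 \<Omega> u u = 0"
      using l2_nonneg[of \<Omega> u] by simp
    then have "AE x in lebesgue_on \<Omega>. u x * u x = 0"
      using integrable_L2_mult[of u \<Omega> u] H1_L2[OF fe_space_H1[OF u]]
      by (subst (asm) l2_def, subst (asm) integral_nonneg_eq_0_iff_AE) auto
    then have "AE x in lebesgue. x \<in> \<Omega> \<longrightarrow> u x = 0"
      using \<Omega> by (simp add: AE_restrict_space_iff)
    then have "AE x in lebesgue. x \<notin> {x\<in>\<Omega>. u x \<noteq> 0}"
      by eventually_elim blast
    moreover have "{x\<in>\<Omega>. u x \<noteq> 0} = \<Omega> \<inter> u -` (- {0})"
      by auto
    then have op: "open {x\<in>\<Omega>. u x \<noteq> 0}"
      using u continuous_open_preimage[of \<Omega> u "- {0}"] \<Omega> by (simp add: fe_space_def open_Compl)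
    ultimately have "negligible {x\<in>\<Omega>. u x \<noteq> 0}"
      by (simp add: negligible_iff_null_sets AE_iff_null_sets)
    moreover obtain x where "u x \<noteq> 0"
      using nz by (auto simp: fun_eq_iff)
    then have "{x\<in>\<Omega>. u x \<noteq> 0} \<noteq> {}"
      using u by (auto simp: fe_space_def)
    ultimately show False
      using op open_not_negligible by blast
  qed
qed

text \<open>Definiteness is inherited from the L2 product: the H1 norm dominates the L2 norm, and
  ellipticity bounds the energy from below by the H1 norm.\<close>

lemma bilin_inner_form:
  assumes \<Omega>: "open \<Omega>" and sym: "transpose \<Theta> = \<Theta>" and c: "0 < c"
    and coercive: "\<And>u. u \<in> fe_space \<Omega> \<T> \<Longrightarrow> c * (H1_norm \<Omega> u)\<^sup>2 \<le> bilin \<Omega> \<Theta> u u"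
  shows "inner_form (fe_space \<Omega> \<T>) (bilin \<Omega> \<Theta>)"
proof
  show "fun_subspace (fe_space \<Omega> \<T>)"
    by (rule fe_space_subspace[OF \<Omega>])
  show "fun_linear (fe_space \<Omega> \<T>) (bilin \<Omega> \<Theta> u)" if "u \<in> fe_space \<Omega> \<T>" for u
    using bilin_linear[OF \<Omega> fe_space_H1[OF that]] by (rule fun_linear_subset) (auto intro: fe_space_H1)
  show "bilin \<Omega> \<Theta> u v = bilin \<Omega> \<Theta> v u" for u v
    by (rule bilin_sym[OF sym])
  show "0 < bilin \<Omega> \<Theta> u u" if u: "u \<in> fe_space \<Omega> \<T>" "u \<noteq> (\<lambda>x. 0)" for u
  proof -
    have "0 < l2 \<Omega> u u"
      using inner_form.definite[OF l2_inner_form[OF \<Omega>] u] .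
    also have "\<dots> \<le> (H1_norm \<Omega> u)\<^sup>2"
      by (simp add: H1_norm_sqr sum_nonneg l2_nonneg)
    finally have "0 < c * (H1_norm \<Omega> u)\<^sup>2"
      using c by simp
    then show ?thesis
      using coercive[OF u(1)] by linarith
  qed
qed

lemma supp_add_subset: "supp \<Omega> (\<lambda>x. u x + v x) \<subseteq> supp \<Omega> u \<union> supp \<Omega> v"
proof -
  have "{x\<in>\<Omega>. u x + v x \<noteq> 0} \<subseteq> {x\<in>\<Omega>. u x \<noteq> 0} \<union> {x\<in>\<Omega>. v x \<noteq> 0}"
    by auto
  from closure_mono[OF this] show ?thesis
    by (auto simp: supp_def)
qed

lemma supp_scale_subset: "supp \<Omega> (\<lambda>x. c * u x) \<subseteq> supp \<Omega> u"
proof -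
  have "{x\<in>\<Omega>. c * u x \<noteq> 0} \<subseteq> {x\<in>\<Omega>. u x \<noteq> 0}"
    by auto
  from closure_mono[OF this] show ?thesis
    by (auto simp: supp_def)
qed

lemma subspace_family_subspace:
  assumes "open \<Omega>"
  shows "fun_subspace (subspace_family \<Omega> h \<T> D k i)"
proof (cases "i = 0")
  case False
  have "supp \<Omega> (\<lambda>x. 0) = {}"
    by (simp add: supp_def)
  then show ?thesis
    using False supp_add_subset[of \<Omega>] supp_scale_subset[of \<Omega>]
      fun_subspace_0[OF fe_space_subspace[OF assms]] fun_subspace_add[OF fe_space_subspace[OF assms]]
      fun_subspace_scale[OF fe_space_subspace[OF assms]]
    unfolding subspace_family_def fun_subspace_def by (simp; blast)
qed (simp add: subspace_family_def fe_space_subspace assms)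

text \<open>At almost every point of \<Omega> one of the two gradients vanishes, by locality on the
  open complement of each support. For subdomains with disjoint extensions this is the orthogonality
  required by \<open>half_sweep_contraction\<close>.\<close>

lemma bilin_disjoint_supp:
  assumes \<Omega>: "open \<Omega>" and u: "u \<in> H1 \<Omega>" and v: "v \<in> H1 \<Omega>" and disj: "supp \<Omega> u \<inter> supp \<Omega> v = {}"
  shows "bilin \<Omega> \<Theta> u v = 0"
proof -
  have off: "AE x in lebesgue_on \<Omega>. x \<in> \<Omega> - supp \<Omega> w \<longrightarrow> weak_partial \<Omega> i w x = 0" if w: "w \<in> H1 \<Omega>" for w i
  proof (rule weak_partial_zero_on_open[OF \<Omega> _ _ w])
    have "\<Omega> - supp \<Omega> w = \<Omega> - closure {x\<in>\<Omega>. w x \<noteq> 0}"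
      by (auto simp: supp_def)
    then show "open (\<Omega> - supp \<Omega> w)"
      using \<Omega> by (simp add: open_Diff)
    show "w x = 0" if "x \<in> \<Omega> - supp \<Omega> w" for x
      using that closure_subset[of "{x\<in>\<Omega>. w x \<noteq> 0}"] by (auto simp: supp_def)
  qed auto
  have "l2 \<Omega> (weak_partial \<Omega> j u) (weak_partial \<Omega> i v) = 0" for i j
    unfolding l2_def
  proof (rule integral_eq_zero_AE)
    have "AE x in lebesgue_on \<Omega>. x \<in> \<Omega>"
      using \<Omega> AE_space[of "lebesgue_on \<Omega>"] by (simp add: space_restrict_space)
    then show "AE x in lebesgue_on \<Omega>. weak_partial \<Omega> j u x * weak_partial \<Omega> i v x = 0"
      using off[OF u, of j] off[OF v, of i] by eventually_elim (use disj in auto)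
  qed
  then show ?thesis
    by (simp add: bilin_l2)
qed

section \<open>The discrete operators as Riesz representatives\<close>

locale fe_subspace =
  fixes \<Omega> :: "(real^'n::finite) set" and \<Theta> :: "real^'n^'n" and V W :: "(real^'n \<Rightarrow> real) set"
    and I :: "'i set" and \<phi> :: "'i \<Rightarrow> real^'n \<Rightarrow> real"
  assumes l2_form: "inner_form V (l2 \<Omega>)" and a_form: "inner_form V (bilin \<Omega> \<Theta>)"
    and W: "fun_subspace W" "W \<subseteq> V" and span: "finite I" "spanned_by V I \<phi>"
begin

lemma span_W: "spanned_by W I \<phi>"
  using W span unfolding spanned_by_def by blast

lemma stiffness:
  assumes "u \<in> V"
  shows "stiffness \<Omega> \<Theta> V u \<in> V" and "v \<in> V \<Longrightarrow> l2 \<Omega> (stiffness \<Omega> \<Theta> V u) v = bilin \<Omega> \<Theta> u v"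
  using theI'[OF inner_form.Riesz[OF l2_form span(1) inner_form.subspace[OF l2_form] subset_refl span(2)
        inner_form.linear[OF a_form assms]]]
  unfolding stiffness_def by blast+

lemma l2_projection:
  assumes "f \<in> V"
  shows "l2_projection \<Omega> W f \<in> W" and "v \<in> W \<Longrightarrow> l2 \<Omega> (l2_projection \<Omega> W f) v = l2 \<Omega> f v"
  using theI'[OF inner_form.Riesz[OF l2_form span(1) W span_W
        fun_linear_subset[OF inner_form.linear[OF l2_form assms] W(2)]]]
  unfolding l2_projection_def by blast+

lemma a_projection:
  assumes "u \<in> V"
  shows "a_projection \<Omega> \<Theta> W u \<in> W" and "v \<in> W \<Longrightarrow> bilin \<Omega> \<Theta> (a_projection \<Omega> \<Theta> W u) v = bilin \<Omega> \<Theta> u v"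
  using theI'[OF inner_form.Riesz[OF a_form span(1) W span_W
        fun_linear_subset[OF inner_form.linear[OF a_form assms] W(2)]]]
  unfolding a_projection_def by blast+

lemma sub_stiffness_eq: "sub_stiffness \<Omega> \<Theta> V W u = l2_projection \<Omega> W (stiffness \<Omega> \<Theta> V u)"
  by (simp add: sub_stiffness_def l2_projection_def)

lemma sub_stiffness:
  assumes "u \<in> V"
  shows "sub_stiffness \<Omega> \<Theta> V W u \<in> W" and "v \<in> W \<Longrightarrow> l2 \<Omega> (sub_stiffness \<Omega> \<Theta> V W u) v = bilin \<Omega> \<Theta> u v"
  using l2_projection[OF stiffness(1)[OF assms]] stiffness(2)[OF assms] W(2)
  by (auto simp: sub_stiffness_eq)

text \<open>The projected residual is \<open>sub_stiffness\<close> of the energy projection of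
  \<open>u\<close>; hence it lies in the image of \<open>W\<close>, and \<open>inv_into\<close>
  returns a genuine preimage. Every preimage has the same energy products with \<open>W\<close> as
  \<open>u\<close>, so the choice does not matter.\<close>

lemma subspace_solve:
  assumes u: "u \<in> V"
  shows "subspace_solve \<Omega> \<Theta> V W u \<in> W"
    and "v \<in> W \<Longrightarrow> bilin \<Omega> \<Theta> (subspace_solve \<Omega> \<Theta> V W u) v = bilin \<Omega> \<Theta> u v"
proof -
  let ?t = "a_projection \<Omega> \<Theta> W u" and ?b = "l2_projection \<Omega> W (stiffness \<Omega> \<Theta> V u)"
  interpret l2W: inner_form W "l2 \<Omega>"
    using inner_form.inner_form_subspace[OF l2_form W(2,1)] .
  have b: "?b = sub_stiffness \<Omega> \<Theta> V W u"
    by (simp add: sub_stiffness_eq)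
  have t: "?t \<in> W" "?t \<in> V"
    using a_projection(1)[OF u] W(2) by auto
  have "sub_stiffness \<Omega> \<Theta> V W ?t = ?b"
    unfolding b by (rule l2W.eqI) (use sub_stiffness[OF u] sub_stiffness[OF t(2)] a_projection(2)[OF u] in auto)
  then have mem: "?b \<in> sub_stiffness \<Omega> \<Theta> V W ` W"
    using t(1) by (metis imageI)
  have z: "subspace_solve \<Omega> \<Theta> V W u \<in> W"
    unfolding subspace_solve_def by (rule inv_into_into[OF mem])
  then show "subspace_solve \<Omega> \<Theta> V W u \<in> W" .
  have eq: "sub_stiffness \<Omega> \<Theta> V W (subspace_solve \<Omega> \<Theta> V W u) = sub_stiffness \<Omega> \<Theta> V W u"
    using f_inv_into_f[OF mem] by (simp add: subspace_solve_def b)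
  show "bilin \<Omega> \<Theta> (subspace_solve \<Omega> \<Theta> V W u) v = bilin \<Omega> \<Theta> u v" if v: "v \<in> W"
    using sub_stiffness(2)[OF u v] sub_stiffness(2)[OF subsetD[OF W(2) z] v] eq by simp
qed

end

lemma overlap_number_ge:
  assumes "i \<in> {1..p}"
  shows "card {j\<in>{1..p}. overlap_domain \<Omega> h (D i) \<inter> overlap_domain \<Omega> h (D j) \<noteq> {}} \<le> overlap_number \<Omega> h p D"
proof -
  have "card {j\<in>{1..p}. overlap_domain \<Omega> h (D i) \<inter> overlap_domain \<Omega> h (D j) \<noteq> {}} =
      (\<Sum>j=1..p. if overlap_domain \<Omega> h (D i) \<inter> overlap_domain \<Omega> h (D j) \<noteq> {} then 1 else 0)"
    unfolding card_eq_sum by (rule sum.inter_filter) simp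
  also have "\<dots> \<le> overlap_number \<Omega> h p D"
    unfolding overlap_number_def by (rule Max_ge) (use assms in \<open>auto intro: imageI\<close>)
  finally show ?thesis .
qed

section \<open>Rates that are constant across the levels\<close>

lemma rate_eq_iff:
  assumes "0 < C"
  shows "rate C m k = rate C m l \<longleftrightarrow> m k * (1 + l\<^sup>2) = m l * (1 + k\<^sup>2)"
proof -
  let ?a = "C * (1 + (real k)\<^sup>2)" and ?b = "C * (1 + (real l)\<^sup>2)"
  have pos: "0 < ?a" "0 < ?b"
    using assms by (auto intro!: mult_pos_pos add_pos_nonneg)
  then have "0 < ?a + 2 * real (m k)" "0 < ?b + 2 * real (m l)"
    by (auto intro: add_pos_nonneg)
  then have "rate C m k = rate C m l \<longleftrightarrow> ?a * (?b + 2 * real (m l)) = ?b * (?a + 2 * real (m k))"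
    unfolding rate_def by (subst frac_eq_eq) auto
  also have "\<dots> \<longleftrightarrow> 2 * C * (real (m k) * (1 + (real l)\<^sup>2)) = 2 * C * (real (m l) * (1 + (real k)\<^sup>2))"
    by (auto simp: algebra_simps)
  also have "\<dots> \<longleftrightarrow> real (m k) * (1 + (real l)\<^sup>2) = real (m l) * (1 + (real k)\<^sup>2)"
    using assms by simp
  also have "\<dots> \<longleftrightarrow> real (m k * (1 + l\<^sup>2)) = real (m l * (1 + k\<^sup>2))"
    by (simp add: distrib_left)
  finally show ?thesis
    by (simp only: of_nat_eq_iff)
qed

text \<open>Levels 1 and 2 give 2 \<open>m 2\<close> = 5 \<open>m 1\<close>, so \<open>m 1\<close>
  is even and its half is the natural number \<open>q\<close>. Level 1 alone would admit an odd
  \<open>m 1\<close>, which no \<open>q\<close> produces.\<close>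

lemma constant_rate_iff:
  assumes C: "0 < C" and K: "1 \<in> K" "2 \<in> K"
  shows "(\<forall>k\<in>K. rate C m k = rate C m 1) \<longleftrightarrow> (\<exists>q. \<forall>k\<in>K. m k = q * (1 + k\<^sup>2))"
proof
  assume "\<forall>k\<in>K. rate C m k = rate C m 1"
  then have *: "m k * 2 = m 1 * (1 + k\<^sup>2)" if "k \<in> K" for k
    using that rate_eq_iff[OF C, of m k 1] by simp
  have "m 2 * 2 = m 1 * 5"
    using *[OF K(2)] by simp
  then have "even (m 1)"
    by presburger
  then obtain q where "m 1 = 2 * q"
    by (elim evenE)
  then have "m k = q * (1 + k\<^sup>2)" if "k \<in> K" for k
    using *[OF that] by simp
  then show "\<exists>q. \<forall>k\<in>K. m k = q * (1 + k\<^sup>2)"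
    by blast
next
  assume "\<exists>q. \<forall>k\<in>K. m k = q * (1 + k\<^sup>2)"
  then show "\<forall>k\<in>K. rate C m k = rate C m 1"
    using K by (auto simp: rate_eq_iff[OF C] algebra_simps)
qed

lemma rate_quadratic_smoothing:
  assumes "0 < C" "m k = q * (1 + k\<^sup>2)"
  shows "rate C m k = C / (2 * real q + C)"
proof -
  have "rate C m k = (1 + (real k)\<^sup>2) * C / ((1 + (real k)\<^sup>2) * (2 * real q + C))"
    unfolding rate_def assms(2) by (simp add: algebra_simps)
  also have "\<dots> = C / (2 * real q + C)"
    by (intro mult_divide_mult_cancel_left) (metis add_pos_nonneg less_irrefl zero_le_power2 zero_less_one)
  finally show ?thesis .
qed

subsection \<open>The convergence theorem\<close>

text \<open>A hierarchy with \<open>J\<close> levels has the bound \<open>rate\<close> at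
  \<open>J\<close>. Independence of the number of levels therefore compares the rates at any two
  indices, with \<open>m\<close> a sequence that continues beyond \<open>J\<close>. The comparison
  within one hierarchy asks for two levels, as a single one leaves the parity of \<open>m 1\<close>
  open.\<close>

theorem theorem5:
  fixes \<Omega> :: "(real^'n::finite) set" and \<Theta> :: "real^'n^'n" and J :: nat
    and h\<^sub>0 C\<^sub>0 g\<^sub>0 C\<^sub>5 :: real
    and \<Omega>s :: "nat \<Rightarrow> (real^'n) set" and \<T> :: "nat \<Rightarrow> (real^'n) set set"
    and p m :: "nat \<Rightarrow> nat" and D :: "nat \<Rightarrow> nat \<Rightarrow> (real^'n) set"
    and V :: "nat \<Rightarrow> (real^'n \<Rightarrow> real) set" and E :: "nat \<Rightarrow> 'n fun_op"
  assumes hierarchy: "refinement_hierarchy \<Omega> J h\<^sub>0 \<Omega>s \<T>"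
    and V_eq: "V = (\<lambda>k. fe_space \<Omega> (\<T> k))"
    and symmetric: "transpose \<Theta> = \<Theta>"
    and elliptic: "\<exists>c\<^sub>1>0. \<exists>c\<^sub>2>0. \<forall>k\<le>J. \<forall>u\<in>V k.
           c\<^sub>1 * (H1_norm \<Omega> u)\<^sup>2 \<le> bilin \<Omega> \<Theta> u u \<and> bilin \<Omega> \<Theta> u u \<le> c\<^sub>2 * (H1_norm \<Omega> u)\<^sup>2"
    and subdomains: "\<forall>k\<le>J. subdomain_partition \<Omega> h\<^sub>0 (\<T> k) (p k) (D k)"
    and C\<^sub>0_pos: "C\<^sub>0 > 0"
    and decomposition: "\<forall>k\<le>J. \<forall>v\<in>V k. \<exists>w.
           (\<forall>i\<le>p k. w i \<in> subspace_family \<Omega> h\<^sub>0 \<T> D k i) \<and>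
           (\<forall>x. v x = (\<Sum>i\<le>p k. w i x)) \<and>
           (\<Sum>i\<le>p k. bilin \<Omega> \<Theta> (w i) (w i)) \<le> C\<^sub>0 * (1 + real k ^ 2) * bilin \<Omega> \<Theta> v v"
    and overlap: "\<forall>k\<le>J. real (overlap_number \<Omega> h\<^sub>0 (p k) (D k)) \<le> g\<^sub>0"
    and m_pos: "\<forall>k\<ge>1. m k \<ge> 1"
    and C\<^sub>5_eq: "C\<^sub>5 = C\<^sub>0 * (3 + 2 * g\<^sub>0)\<^sup>2"
    and E_eq: "E = mg_error (ssc_smoother \<Omega> \<Theta> h\<^sub>0 \<T> p D) (\<lambda>k. a_projection \<Omega> \<Theta> (V k)) m"
  shows "(antimono_on {1..J} (\<lambda>k. real (m k) / (C\<^sub>0 * (1 + real k ^ 2) * (3 + 2 * g\<^sub>0)\<^sup>2)) \<longrightarrow>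
           (\<forall>k\<in>{1..J}. \<forall>v\<in>V k. bilin \<Omega> \<Theta> (E k v) v \<le> rate C\<^sub>5 m k * bilin \<Omega> \<Theta> v v)) \<and>
         ((\<forall>K\<ge>1. \<forall>L\<ge>1. rate C\<^sub>5 m K = rate C\<^sub>5 m L) \<longleftrightarrow>
            (\<exists>q::nat. \<forall>k\<ge>1. m k = q * (1 + k\<^sup>2))) \<and>
         (J \<ge> 2 \<longrightarrow>
           ((\<forall>k\<in>{1..J}. rate C\<^sub>5 m k = rate C\<^sub>5 m 1) \<longleftrightarrow>
            (\<exists>q::nat. \<forall>k\<in>{1..J}. m k = q * (1 + k\<^sup>2)))) \<and>
         (\<forall>q::nat. (\<forall>k\<in>{1..J}. m k = q * (1 + k\<^sup>2)) \<longrightarrow>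
            (\<forall>k\<in>{1..J}. rate C\<^sub>5 m k = C\<^sub>5 / (2 * real q + C\<^sub>5)))"
proof -
  have \<Omega>: "open \<Omega>"
    using hierarchy by (simp add: refinement_hierarchy_def polygonal_def)
  \<comment> \<open>\<open>g\<^sub>0\<close> bounds a natural number at level
    \<open>0\<close>.\<close>
  have g\<^sub>0: "0 \<le> g\<^sub>0"
    using overlap[rule_format, of 0] by linarith
  then have "0 < (3 + 2 * g\<^sub>0)\<^sup>2"
    by simp
  then have C\<^sub>5: "0 < C\<^sub>5"
    using C\<^sub>0_pos by (simp add: C\<^sub>5_eq)
  define C where "C = (\<lambda>k. C\<^sub>5 * (1 + (real k)\<^sup>2))"
  have C: "0 < C k" for k
    unfolding C_def using C\<^sub>5 by (intro mult_pos_pos add_pos_nonneg) auto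
  define B where "B = bilin \<Omega> \<Theta>"
  define S where "S = ssc_smoother \<Omega> \<Theta> h\<^sub>0 \<T> p D"
  have l2_form: "inner_form (V k) (l2 \<Omega>)" for k
    unfolding V_eq by (rule l2_inner_form[OF \<Omega>])
  obtain c where c: "0 < c" "\<And>k u. \<lbrakk>k \<le> J; u \<in> V k\<rbrakk> \<Longrightarrow> c * (H1_norm \<Omega> u)\<^sup>2 \<le> bilin \<Omega> \<Theta> u u"
    using elliptic by metis
  have a_form: "inner_form (V k) (bilin \<Omega> \<Theta>)" if "k \<le> J" for k
    using bilin_inner_form[OF \<Omega> symmetric c(1)] c(2)[OF that] unfolding V_eq by blast
  have nested: "V j \<subseteq> V k" if "j \<le> k" "k \<le> J" for j k
    unfolding V_eq using refinement_hierarchy_mesh(3)[OF hierarchy that(2,1)] by (rule fe_space_mono)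
  \<comment> \<open>Applied to \<open>V k\<close> inside \<open>V (Suc k)\<close> for the coarse
    grid correction and to each \<open>W k i\<close> inside \<open>V k\<close> for the
    smoother.\<close>
  have projections: "\<exists>(I :: ((real^'n) set \<times> 'n option) set) \<phi>. fe_subspace \<Omega> \<Theta> (V k) W I \<phi>"
    if k: "k \<le> J" and W: "fun_subspace W" "W \<subseteq> V k" for k W
  proof -
    obtain I :: "((real^'n) set \<times> 'n option) set" and \<phi> where "finite I" "spanned_by (V k) I \<phi>"
      using fe_space_spanned[OF refinement_hierarchy_mesh(1,2)[OF hierarchy k]] unfolding V_eq by blast
    then have "fe_subspace \<Omega> \<Theta> (V k) W I \<phi>"
      using l2_form a_form k W by (intro fe_subspace.intro)
    then show ?thesis
      by blast
  qed
  have P_in: "a_projection \<Omega> \<Theta> (V k) u \<in> V k"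
    and P_proj: "v \<in> V k \<Longrightarrow> B (a_projection \<Omega> \<Theta> (V k) u) v = B u v"
    if k: "Suc k \<le> J" "u \<in> V (Suc k)" for k u v
  proof -
    have sub: "fun_subspace (V k)"
      unfolding V_eq by (rule fe_space_subspace[OF \<Omega>])
    obtain I :: "((real^'n) set \<times> 'n option) set" and \<phi> where "fe_subspace \<Omega> \<Theta> (V (Suc k)) (V k) I \<phi>"
      using projections[OF k(1) sub nested[OF le_SucI[OF order_refl] k(1)]] by blast
    then interpret fe_subspace \<Omega> \<Theta> "V (Suc k)" "V k" I \<phi> .
    show "a_projection \<Omega> \<Theta> (V k) u \<in> V k"
      and "v \<in> V k \<Longrightarrow> B (a_projection \<Omega> \<Theta> (V k) u) v = B u v"
      using a_projection[OF k(2)] by (auto simp: B_def)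
  qed
  define W where "W = subspace_family \<Omega> h\<^sub>0 \<T> D"
  define T where "T = (\<lambda>k i. subspace_solve \<Omega> \<Theta> (V k) (W k i))"
  have S_eq: "S k = symmetric_ssc (T k) (p k)" for k
    by (simp add: S_def ssc_smoother_def T_def W_def V_eq)
  \<comment> \<open>For \<open>i = 0\<close> this is the nestedness of \<open>V 0\<close> in
    \<open>V k\<close>.\<close>
  have W_V: "W k i \<subseteq> V k" if "k \<le> J" for k i
    using nested[of 0 k] that by (auto simp: W_def subspace_family_def V_eq)
  have W_supp: "supp \<Omega> u \<subseteq> overlap_domain \<Omega> h\<^sub>0 (D k i)" if "u \<in> W k i" "i \<noteq> 0" for u k i
    using that by (simp add: W_def subspace_family_def)
  have correction: "subspace_correction (V k) B (W k) (T k) (p k)" if k: "k \<le> J" for k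
  proof (intro subspace_correction.intro subspace_correction_axioms.intro)
    show "inner_form (V k) B"
      using a_form[OF k] by (simp add: B_def)
    show "W k i \<subseteq> V k" for i
      using W_V[OF k] .
    fix i u assume u: "u \<in> V k"
    have sub: "fun_subspace (W k i)"
      unfolding W_def by (rule subspace_family_subspace[OF \<Omega>])
    obtain I :: "((real^'n) set \<times> 'n option) set" and \<phi> where "fe_subspace \<Omega> \<Theta> (V k) (W k i) I \<phi>"
      using projections[OF k sub W_V[OF k]] by blast
    then interpret fe_subspace \<Omega> \<Theta> "V k" "W k i" I \<phi> .
    show "T k i u \<in> W k i"
      using subspace_solve(1)[OF u] by (simp add: T_def)
    show "B (T k i u) v = B u v" if "v \<in> W k i" for v
      using subspace_solve(2)[OF u that] by (simp add: T_def B_def)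
  qed
  have half_sweep: "B v v \<le> C k * (B v v - B (half_sweep (T k) (p k) v) (half_sweep (T k) (p k) v))"
    if k: "k \<le> J" and v: "v \<in> V k" for k v
  proof -
    interpret subspace_correction "V k" B "W k" "T k" "p k"
      by (rule correction[OF k])
    \<comment> \<open>The coarse space, with index \<open>0\<close>, stays outside this pattern,
      since no support condition is imposed on its functions.\<close>
    define G where "G = (\<lambda>i j. overlap_domain \<Omega> h\<^sub>0 (D k i) \<inter> overlap_domain \<Omega> h\<^sub>0 (D k j) \<noteq> {})"
    obtain w where w: "\<And>i. i \<le> p k \<Longrightarrow> w i \<in> W k i" "\<And>x. v x = (\<Sum>i\<le>p k. w i x)"
      "(\<Sum>i\<le>p k. B (w i) (w i)) \<le> C\<^sub>0 * (1 + real k ^ 2) * B v v"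
      using decomposition[rule_format, OF k v] unfolding W_def B_def by blast
    have "B v v \<le> C\<^sub>0 * (1 + real k ^ 2) * (3 + 2 * g\<^sub>0)\<^sup>2 *
        (B v v - B (half_sweep (T k) (p k) v) (half_sweep (T k) (p k) v))"
    proof (rule half_sweep_contraction[OF g\<^sub>0, of _ G _ w])
      show "0 < C\<^sub>0 * (1 + real k ^ 2)"
        using C\<^sub>0_pos by (intro mult_pos_pos add_pos_nonneg) auto
      show "G i j \<longleftrightarrow> G j i" for i j
        by (auto simp: G_def)
      show "real (card {j\<in>{1..p k}. G i j}) \<le> g\<^sub>0" if "i \<in> {1..p k}" for i
        using overlap_number_ge[OF that, of \<Omega> h\<^sub>0 "D k"] overlap[rule_format, OF k]
        unfolding G_def by linarith
      show "B u z = 0" if "i \<in> {1..p k}" "j \<in> {1..p k}" "\<not> G i j" "u \<in> W k i" "z \<in> W k j" for i j u z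
      proof -
        have "supp \<Omega> u \<inter> supp \<Omega> z = {}"
          using W_supp[OF that(4)] W_supp[OF that(5)] that(1-3) by (auto simp: G_def)
        moreover have "u \<in> H1 \<Omega>" "z \<in> H1 \<Omega>"
          using W_V[OF k] that(4,5) fe_space_H1 unfolding V_eq by blast+
        ultimately show ?thesis
          unfolding B_def by (intro bilin_disjoint_supp[OF \<Omega>])
      qed
      show "v = (\<lambda>x. \<Sum>i\<le>p k. w i x)"
        using w(2) by (rule ext)
    qed (fact v w)+
    also have "C\<^sub>0 * (1 + real k ^ 2) * (3 + 2 * g\<^sub>0)\<^sup>2 = C k"
      by (simp add: C_def C\<^sub>5_eq)
    finally show ?thesis .
  qed
  have bound: "B (E k v) v \<le> rate C\<^sub>5 m k * B v v" if k: "k \<in> {1..J}" and v: "v \<in> V k" for k v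
  proof -
    have "B (mg_error S (\<lambda>k. a_projection \<Omega> \<Theta> (V k)) m k v) v \<le> C k / (C k + 2 * real (m k)) * B v v"
    proof (rule mg_error_bound[where V = V and J = J])
      show "inner_form (V k) B" if "k \<le> J" for k
        using a_form[OF that] by (simp add: B_def)
      show "V k \<subseteq> V (Suc k)" if "Suc k \<le> J" for k
        using nested[of k "Suc k"] that by simp
      show "S k u \<in> V k" if "k \<le> J" "u \<in> V k" for k u
        using subspace_correction.symmetric_ssc_in[OF correction[OF that(1)] order_refl that(2)] by (simp add: S_eq)
      show "B (S k u) v = B u (S k v)" if "k \<le> J" "u \<in> V k" "v \<in> V k" for k u v
        using subspace_correction.symmetric_ssc_sym[OF correction[OF that(1)] that(2,3)] by (simp add: S_eq)
      show "B (S k u) (S k u) \<le> (C k / (C k + 1))\<^sup>2 * B u u" if "k \<le> J" "u \<in> V k" for k u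
        using subspace_correction.symmetric_ssc_contraction[OF correction[OF that(1)], OF C half_sweep[OF that(1)] that(2)]
        by (simp add: S_eq)
    qed (use k v C P_in P_proj in auto)
    then show ?thesis
      by (simp add: E_eq S_def rate_def C_def)
  qed
  \<comment> \<open>Comparing every index with the first one is the form of
    \<open>constant_rate_iff\<close>, used here with the infinite index set
    \<open>{1..}\<close>.\<close>
  have pairwise: "(\<forall>K\<ge>1. \<forall>L\<ge>1. rate C\<^sub>5 m K = rate C\<^sub>5 m L) \<longleftrightarrow> (\<forall>k\<in>{1..}. rate C\<^sub>5 m k = rate C\<^sub>5 m 1)"
    by (metis atLeast_iff order_refl)
  have "(\<forall>K\<ge>1. \<forall>L\<ge>1. rate C\<^sub>5 m K = rate C\<^sub>5 m L) \<longleftrightarrow> (\<exists>q. \<forall>k\<ge>1. m k = q * (1 + k\<^sup>2))"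
    unfolding pairwise using constant_rate_iff[OF C\<^sub>5, of "{1..}" m]
    by (simp only: Ball_def atLeast_iff)
  moreover have "(\<forall>k\<in>{1..J}. rate C\<^sub>5 m k = rate C\<^sub>5 m 1) \<longleftrightarrow> (\<exists>q. \<forall>k\<in>{1..J}. m k = q * (1 + k\<^sup>2))"
    if "2 \<le> J"
    using that by (intro constant_rate_iff[OF C\<^sub>5]) auto
  moreover have "\<forall>k\<in>{1..J}. rate C\<^sub>5 m k = C\<^sub>5 / (2 * real q + C\<^sub>5)"
    if "\<forall>k\<in>{1..J}. m k = q * (1 + k\<^sup>2)" for q
    using that rate_quadratic_smoothing[OF C\<^sub>5] by blast
  ultimately show ?thesis
    using bound unfolding B_def by blast
qed

end
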